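(* Let $k$ be a field of characteristic $p>0$, let $L$ be a commutative separable $k$-algebra (containing $k$), and let $A$ be a commutative finitely generated $k$-algebra. Put $A_L=L\otimes_k A$. Then for every integer $m\ge 1$ the base change map $$\Phi^{L,A}_m: L\otimes_k \mathrm{IDer}_k(A;m)\longrightarrow \mathrm{IDer}_L(A_L;m),\qquad c\otimes\delta\longmapsto c\,\widetilde\delta,$$ is an isomorphism of $A_L$-modules. Moreover, $\mathrm{Leaps}_k(A)=\mathrm{Leaps}_L(A_L)$.
   Context: All rings are commutative. A $k$-algebra $L$ containing the field $k$ is separable over $k$ if $K\otimes_k L$ is reduced for every field extension $K$ of $k$ ($L$ need not be a field). For a ring $k$, a $k$-algebra $A$ and an integer $m\ge 1$, a Hasse-Schmidt derivation of $A$ over $k$ of length $m$ is a sequence $D=(D_0,D_1,\dots,D_m)$ of $k$-linear maps $D_i:A\to A$ with $D_0=\mathrm{Id}_A$ and $D_n(xy)=\sum_{i+j=n}D_i(x)D_j(y)$ for all $x,y\in A$ and all $n\le m$. In particular $D_1\in\mathrm{Der}_k(A)$. A derivation $\delta\in\mathrm{Der}_k(A)$ is $m$-integrable if there is a Hasse-Schmidt derivation $D$ of $A$ over $k$ of length $m$ with $D_1=\delta$; the set $\mathrm{IDer}_k(A;m)$ of $m$-integrable derivations is an $A$-submodule of $\mathrm{Der}_k(A)$. The $k$-algebra $A$ has a leap at an integer $s>1$ if the inclusion $\mathrm{IDer}_k(A;s)\subseteq\mathrm{IDer}_k(A;s-1)$ is proper; $\mathrm{Leaps}_k(A)$ is the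 set of leaps of $A$ over $k$ (and similarly for the $L$-algebra $A_L$ over $L$). For $\delta\in\mathrm{Der}_k(A)$, $\widetilde\delta\in\mathrm{Der}_L(A_L)$ is its $L$-linear extension $\widetilde\delta(c\otimes a)=c\otimes\delta(a)$; if $\delta$ is $m$-integrable then so is $\widetilde\delta$, so $\Phi^{L,A}_m$ is well defined. *)

theory Defs
  imports "HOL-Algebra.Algebra"
begin

section \<open>Algebras over a ring\<close>

definition has_char :: "('k, 'x) ring_scheme \<Rightarrow> nat \<Rightarrow> bool"
  where "has_char k p \<longleftrightarrow> (\<forall>n::nat. add_pow k n \<one>\<^bsub>k\<^esub> = \<zero>\<^bsub>k\<^esub> \<longleftrightarrow> p dvd n)"

definition reduced_ring :: "('a, 'x) ring_scheme \<Rightarrow> bool"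
  where "reduced_ring R \<longleftrightarrow>
    (\<forall>x\<in>carrier R. \<forall>n::nat. x [^]\<^bsub>R\<^esub> n = \<zero>\<^bsub>R\<^esub> \<longrightarrow> x = \<zero>\<^bsub>R\<^esub>)"

definition fin_gen_algebra :: "('k, 'x) ring_scheme \<Rightarrow> ('k, 'a, 'y) module_scheme \<Rightarrow> bool"
  where "fin_gen_algebra k A \<longleftrightarrow> algebra k A \<and>
    (\<exists>S. finite S \<and> S \<subseteq> carrier A \<and>
      generate_ring A ((\<lambda>r. r \<odot>\<^bsub>A\<^esub> \<one>\<^bsub>A\<^esub>) ` carrier k \<union> S) = carrier A)"

text \<open>Maps are normalised to be \<^const>\<open>undefined\<close> off the carrier, so that equality of functions is
  equality of maps between the carriers.\<close>

definition module_homs ::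
    "('k, 'x) ring_scheme \<Rightarrow> ('k, 'm, 'y) module_scheme \<Rightarrow> ('k, 'n, 'z) module_scheme \<Rightarrow> ('m \<Rightarrow> 'n) set"
  where "module_homs R M N = {f \<in> carrier M \<rightarrow>\<^sub>E carrier N.
    (\<forall>x\<in>carrier M. \<forall>y\<in>carrier M. f (x \<oplus>\<^bsub>M\<^esub> y) = f x \<oplus>\<^bsub>N\<^esub> f y) \<and>
    (\<forall>r\<in>carrier R. \<forall>x\<in>carrier M. f (r \<odot>\<^bsub>M\<^esub> x) = r \<odot>\<^bsub>N\<^esub> f x)}"

definition is_module_iso ::
    "('k, 'x) ring_scheme \<Rightarrow> ('k, 'm, 'y) module_scheme \<Rightarrow> ('k, 'n, 'z) module_scheme \<Rightarrow> ('m \<Rightarrow> 'n) \<Rightarrow> bool"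
  where "is_module_iso R M N f \<longleftrightarrow>
    module R M \<and> module R N \<and> f \<in> module_homs R M N \<and> bij_betw f (carrier M) (carrier N)"

text \<open>An \<open>A\<close>-module regarded as a module over \<open>k\<close> through \<open>k \<rightarrow> A\<close>, \<open>r \<mapsto> r \<odot> \<one>\<close>.\<close>

definition restrict_scalars ::
    "('k, 'a, 'x) module_scheme \<Rightarrow> ('a, 'm, 'y) module_scheme \<Rightarrow> ('k, 'm) module"
  where "restrict_scalars A M =
    \<lparr>carrier = carrier M, monoid.mult = monoid.mult M, monoid.one = monoid.one M,
     ring.zero = ring.zero M, ring.add = ring.add M, module.smult = (\<lambda>r x. (r \<odot>\<^bsub>A\<^esub> \<one>\<^bsub>A\<^esub>) \<odot>\<^bsub>M\<^esub> x)\<rparr>"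


section \<open>Tensor products\<close>

definition tensor_relators ::
    "('k, 'x) ring_scheme \<Rightarrow> ('k, 'm, 'y) module_scheme \<Rightarrow> ('k, 'n, 'z) module_scheme
      \<Rightarrow> ('m \<times> 'n \<Rightarrow>\<^sub>0 int) set"
  where "tensor_relators k M N =
    {frag_of (x \<oplus>\<^bsub>M\<^esub> x', y) - frag_of (x, y) - frag_of (x', y) | x x' y.
       x \<in> carrier M \<and> x' \<in> carrier M \<and> y \<in> carrier N} \<union>
    {frag_of (x, y \<oplus>\<^bsub>N\<^esub> y') - frag_of (x, y) - frag_of (x, y') | x y y'.
       x \<in> carrier M \<and> y \<in> carrier N \<and> y' \<in> carrier N} \<union>
    {frag_of (r \<odot>\<^bsub>M\<^esub> x, y) - frag_of (x, r \<odot>\<^bsub>N\<^esub> y) | r x y.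
       r \<in> carrier k \<and> x \<in> carrier M \<and> y \<in> carrier N}"

definition tensor_null ::
    "('k, 'x) ring_scheme \<Rightarrow> ('k, 'm, 'y) module_scheme \<Rightarrow> ('k, 'n, 'z) module_scheme
      \<Rightarrow> ('m \<times> 'n \<Rightarrow>\<^sub>0 int) set"
  where "tensor_null k M N =
    generate (free_Abelian_group (carrier M \<times> carrier N)) (tensor_relators k M N)"

text \<open>The additive group of the tensor product over \<open>k\<close>, written as a (multiplicative)
  \<^typ>\<open>'a monoid\<close>; its elements are cosets in the free abelian group on pairs.\<close>

definition tensor_group ::
    "('k, 'x) ring_scheme \<Rightarrow> ('k, 'm, 'y) module_scheme \<Rightarrow> ('k, 'n, 'z) module_scheme
      \<Rightarrow> ('m \<times> 'n \<Rightarrow>\<^sub>0 int) set monoid"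
  where "tensor_group k M N =
    free_Abelian_group (carrier M \<times> carrier N) Mod tensor_null k M N"

definition pure_tensor ::
    "('k, 'x) ring_scheme \<Rightarrow> ('k, 'm, 'y) module_scheme \<Rightarrow> ('k, 'n, 'z) module_scheme
      \<Rightarrow> 'm \<Rightarrow> 'n \<Rightarrow> ('m \<times> 'n \<Rightarrow>\<^sub>0 int) set"
  where "pure_tensor k M N x y =
    tensor_null k M N #>\<^bsub>free_Abelian_group (carrier M \<times> carrier N)\<^esub> frag_of (x, y)"

text \<open>For an abelian group \<open>G\<close> (written multiplicatively) and a \<open>k\<close>-balanced biadditive map \<open>b\<close>,
  this is the homomorphism from the tensor product to \<open>G\<close> with \<open>x \<otimes> y \<mapsto> b x y\<close>: the value
  on the class of \<open>u\<close> does not depend on the representative \<open>u\<close>.\<close>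

definition tensor_lift ::
    "('k, 'x) ring_scheme \<Rightarrow> ('k, 'm, 'y) module_scheme \<Rightarrow> ('k, 'n, 'z) module_scheme
      \<Rightarrow> ('g, 'w) monoid_scheme \<Rightarrow> ('m \<Rightarrow> 'n \<Rightarrow> 'g) \<Rightarrow> ('m \<times> 'n \<Rightarrow>\<^sub>0 int) set \<Rightarrow> 'g"
  where "tensor_lift k M N G b =
    (\<lambda>U\<in>carrier (tensor_group k M N).
      the_elem ((\<lambda>u. finprod G (\<lambda>(x, y). b x y [^]\<^bsub>G\<^esub> Poly_Mapping.lookup u (x, y))
        (Poly_Mapping.keys u)) ` U))"

text \<open>\<open>L \<otimes>\<^sub>k A\<close> as an \<open>L\<close>-algebra, with \<open>(c \<otimes> a)(d \<otimes> b) = cd \<otimes> ab\<close>.\<close>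

definition base_change ::
    "('k, 'x) ring_scheme \<Rightarrow> ('k, 'l, 'y) module_scheme \<Rightarrow> ('k, 'a, 'z) module_scheme
      \<Rightarrow> ('l, ('l \<times> 'a \<Rightarrow>\<^sub>0 int) set) module"
  where "base_change k L A =
    (let T = tensor_group k L A in
     \<lparr>carrier = carrier T,
      monoid.mult = (\<lambda>U V. tensor_lift k L A T (\<lambda>c a.
        tensor_lift k L A T (\<lambda>d b. pure_tensor k L A (c \<otimes>\<^bsub>L\<^esub> d) (a \<otimes>\<^bsub>A\<^esub> b)) V) U),
      monoid.one = pure_tensor k L A \<one>\<^bsub>L\<^esub> \<one>\<^bsub>A\<^esub>,
      ring.zero = \<one>\<^bsub>T\<^esub>,
      ring.add = monoid.mult T,
      module.smult = (\<lambda>c. tensor_lift k L A T (\<lambda>d a. pure_tensor k L A (c \<otimes>\<^bsub>L\<^esub> d) a))\<rparr>)"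

text \<open>For an \<open>A\<close>-module \<open>M\<close>, the tensor product \<open>L \<otimes>\<^sub>k M\<close> as a module over \<open>L \<otimes>\<^sub>k A\<close>, with
  \<open>(c \<otimes> a)(d \<otimes> x) = cd \<otimes> ax\<close>. The fields \<^const>\<open>monoid.mult\<close> and \<^const>\<open>one\<close> play no role
  for modules.\<close>

definition base_change_module ::
    "('k, 'x) ring_scheme \<Rightarrow> ('k, 'l, 'y) module_scheme \<Rightarrow> ('k, 'a, 'z) module_scheme
      \<Rightarrow> ('a, 'm, 'w) module_scheme
      \<Rightarrow> (('l \<times> 'a \<Rightarrow>\<^sub>0 int) set, ('l \<times> 'm \<Rightarrow>\<^sub>0 int) set) module"
  where "base_change_module k L A M =
    (let M' = restrict_scalars A M; T = tensor_group k L M' in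
     \<lparr>carrier = carrier T, monoid.mult = undefined, monoid.one = undefined,
      ring.zero = \<one>\<^bsub>T\<^esub>, ring.add = monoid.mult T,
      module.smult = (\<lambda>U V. tensor_lift k L A T (\<lambda>c a.
        tensor_lift k L M' T (\<lambda>d x. pure_tensor k L M' (c \<otimes>\<^bsub>L\<^esub> d) (a \<odot>\<^bsub>M\<^esub> x)) V) U)\<rparr>)"


section \<open>Separable algebras\<close>

text \<open>HOL cannot quantify over field extensions \<open>K\<close> of \<open>k\<close> living in arbitrary types. Nothing is
  lost by taking them in \<^typ>\<open>'k list\<close>: a nilpotent element of \<open>K \<otimes>\<^sub>k L\<close> already comes from a
  nilpotent element of \<open>K' \<otimes>\<^sub>k L\<close> for some finitely generated subextension \<open>K'\<close> of \<open>K\<close>, and the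
  cardinality of such a \<open>K'\<close> is at most that of \<^typ>\<open>'k list\<close>, the maximum of \<open>\<aleph>\<^sub>0\<close> and the
  cardinality of \<^typ>\<open>'k\<close>.\<close>

definition separable_algebra :: "('k, 'x) ring_scheme \<Rightarrow> ('k, 'l, 'y) module_scheme \<Rightarrow> bool"
  where "separable_algebra k L \<longleftrightarrow> algebra k L \<and>
    (\<forall>K :: ('k, 'k list) module. field K \<and> algebra k K \<longrightarrow> reduced_ring (base_change k K L))"


section \<open>Hasse-Schmidt derivations and leaps\<close>

definition Der :: "('k, 'x) ring_scheme \<Rightarrow> ('k, 'a, 'y) module_scheme \<Rightarrow> ('a \<Rightarrow> 'a) set"
  where "Der k A = {\<delta> \<in> module_homs k A A. \<forall>x\<in>carrier A. \<forall>y\<in>carrier A.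
    \<delta> (x \<otimes>\<^bsub>A\<^esub> y) = \<delta> x \<otimes>\<^bsub>A\<^esub> y \<oplus>\<^bsub>A\<^esub> x \<otimes>\<^bsub>A\<^esub> \<delta> y}"

text \<open>Only the components \<open>D 0, \<dots>, D m\<close> matter.\<close>

definition hasse_schmidt ::
    "('k, 'x) ring_scheme \<Rightarrow> ('k, 'a, 'y) module_scheme \<Rightarrow> nat \<Rightarrow> (nat \<Rightarrow> 'a \<Rightarrow> 'a) \<Rightarrow> bool"
  where "hasse_schmidt k A m D \<longleftrightarrow>
    (\<forall>i\<le>m. D i \<in> module_homs k A A) \<and>
    (\<forall>x\<in>carrier A. D 0 x = x) \<and>
    (\<forall>n\<le>m. \<forall>x\<in>carrier A. \<forall>y\<in>carrier A.
      D n (x \<otimes>\<^bsub>A\<^esub> y) = (\<Oplus>\<^bsub>A\<^esub>i\<in>{..n}. D i x \<otimes>\<^bsub>A\<^esub> D (n - i) y))"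

definition IDer :: "('k, 'x) ring_scheme \<Rightarrow> ('k, 'a, 'y) module_scheme \<Rightarrow> nat \<Rightarrow> ('a \<Rightarrow> 'a) set"
  where "IDer k A m = {\<delta> \<in> Der k A. \<exists>D. hasse_schmidt k A m D \<and> D 1 = \<delta>}"

definition IDer_module ::
    "('k, 'x) ring_scheme \<Rightarrow> ('k, 'a, 'y) module_scheme \<Rightarrow> nat \<Rightarrow> ('a, 'a \<Rightarrow> 'a) module"
  where "IDer_module k A m =
    \<lparr>carrier = IDer k A m, monoid.mult = undefined, monoid.one = undefined,
     ring.zero = (\<lambda>x\<in>carrier A. \<zero>\<^bsub>A\<^esub>),
     ring.add = (\<lambda>\<delta> \<epsilon>. \<lambda>x\<in>carrier A. \<delta> x \<oplus>\<^bsub>A\<^esub> \<epsilon> x),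
     module.smult = (\<lambda>a \<delta>. \<lambda>x\<in>carrier A. a \<otimes>\<^bsub>A\<^esub> \<delta> x)\<rparr>"

definition Leaps :: "('k, 'x) ring_scheme \<Rightarrow> ('k, 'a, 'y) module_scheme \<Rightarrow> nat set"
  where "Leaps k A = {s. s > 1 \<and> IDer k A s \<subset> IDer k A (s - 1)}"


section \<open>Base change of derivations\<close>

definition extend_der ::
    "('k, 'x) ring_scheme \<Rightarrow> ('k, 'l, 'y) module_scheme \<Rightarrow> ('k, 'a, 'z) module_scheme
      \<Rightarrow> ('a \<Rightarrow> 'a) \<Rightarrow> ('l \<times> 'a \<Rightarrow>\<^sub>0 int) set \<Rightarrow> ('l \<times> 'a \<Rightarrow>\<^sub>0 int) set"
  where "extend_der k L A \<delta> =
    tensor_lift k L A (tensor_group k L A) (\<lambda>c a. pure_tensor k L A c (\<delta> a))"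

definition scaled_extension ::
    "('k, 'x) ring_scheme \<Rightarrow> ('k, 'l, 'y) module_scheme \<Rightarrow> ('k, 'a, 'z) module_scheme
      \<Rightarrow> 'l \<Rightarrow> ('a \<Rightarrow> 'a) \<Rightarrow> ('l \<times> 'a \<Rightarrow>\<^sub>0 int) set \<Rightarrow> ('l \<times> 'a \<Rightarrow>\<^sub>0 int) set"
  where "scaled_extension k L A c \<delta> =
    (\<lambda>z\<in>carrier (base_change k L A). c \<odot>\<^bsub>base_change k L A\<^esub> extend_der k L A \<delta> z)"

definition IDer_base_change_map ::
    "('k, 'x) ring_scheme \<Rightarrow> ('k, 'l, 'y) module_scheme \<Rightarrow> ('k, 'a, 'z) module_scheme \<Rightarrow> nat
      \<Rightarrow> ('l \<times> ('a \<Rightarrow> 'a) \<Rightarrow>\<^sub>0 int) set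
      \<Rightarrow> ('l \<times> 'a \<Rightarrow>\<^sub>0 int) set \<Rightarrow> ('l \<times> 'a \<Rightarrow>\<^sub>0 int) set"
  where "IDer_base_change_map k L A m =
    tensor_lift k L (restrict_scalars A (IDer_module k A m))
      (add_monoid (IDer_module L (base_change k L A) m)) (scaled_extension k L A)"

end

theory Submission
  imports Defs "HOL-Computational_Algebra.Formal_Power_Series"
begin

text \<open>A Hasse-Schmidt derivation of length \<open>m - 1\<close> extends to length \<open>m\<close> (without changing \<open>D\<^sub>1\<close>) iff its
  obstruction, a symmetric 2-cochain modulo coboundaries, is the obstruction of some \<open>F\<close> with \<open>F\<^sub>1 = 0\<close>.
  Obstructions add under composition, and rescaling the variable by \<open>a\<close> multiplies them by \<open>a\<^sup>m\<close>.
  In characteristic \<open>p\<close> the group of obstructions at \<open>m\<close> lies in that of the \<open>p\<close>-part of \<open>m\<close>; hence an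
  integrable derivation loses integrability only at powers of \<open>p\<close>, and there the obstructions of all
  \<open>F\<close> with \<open>F\<^sub>1 = 0\<close> come from length \<open>p\<^bsup>s-1\<^esup>\<close>.

  Over \<open>L\<close>, a derivation \<open>E\<^sub>1 = \<Sum> b\<^sub>j \<delta>\<^sub>j\<close> integrable up to \<open>p\<^sup>s\<close> has, by induction, \<open>\<delta>\<^sub>j\<close> integrable by some
  \<open>D\<^sub>j\<close> up to \<open>p\<^sup>s - 1\<close>, and \<open>0 = \<Sum> b\<^sub>j\<^bsup>p^s\<^esup> ob(D\<^sub>j) + ob(F)\<close> with \<open>F\<^sub>1 = 0\<close>. Separability lifts any linear
  functional \<open>\<phi>\<close> on \<open>L\<close> to one, \<open>\<phi>'\<close>, with \<open>\<phi>'(c\<^sup>p) = \<phi>(c)\<^sup>p\<close>. An \<open>s\<close>-fold lift of \<open>\<phi>\<close> maps the equation to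
  \<open>0 = \<Sum> \<phi>(b\<^sub>j)\<^bsup>p^s\<^esup> ob(D\<^sub>j) + c\<close>, where \<open>c\<close> again comes from length \<open>p\<^bsup>s-1\<^esup>\<close> over \<open>k\<close>; so \<open>\<Sum> \<phi>(b\<^sub>j) \<delta>\<^sub>j\<close> is
  integrable over \<open>k\<close> up to \<open>p\<^sup>s\<close>. Finite generation of \<open>A\<close> makes all sums finite.\<close>

text \<open>The obstacle is that a functional \<open>\<phi>\<close> on \<open>L\<close> is additive
  but not multiplicative, so it cannot be applied to all the components of a Hasse-Schmidt
  derivation over \<open>L\<close>. It does respect the first component and the obstruction, because
  both enter linear equations; this is why integrability is phrased through obstruction cochains.
  The drop from \<open>p ^ s\<close> to \<open>p ^ (s - 1)\<close> when the first component vanishes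
  has this source: the leading component sits at some \<open>r \<ge> 2\<close> and is the first
  component of another Hasse-Schmidt derivation \<open>\<Delta>\<close> of smaller length.
  Substituting \<open>fps_X ^ r\<close> into \<open>\<Delta>\<close> accounts for that component,
  and contributes an obstruction at \<open>p ^ s\<close> only if \<open>r\<close> divides
  \<open>p ^ s\<close>, namely the one of \<open>\<Delta>\<close> at the smaller power
  \<open>p ^ s / r\<close>. Such components are removed one after the other until a coboundary is
  left. The integrability of leading components and the reduction to the \<open>p\<close>-part rely
  on each other, hence a simultaneous induction. The computations take place in type class rings, of
  which the given algebras are direct factors cut out by an idempotent \<open>e\<close>.\<close>

unbundle fps_syntax

section \<open>Hasse-Schmidt derivations as automorphisms of power series\<close>

lemma fps_decompose: "(f :: 'a::comm_ring_1 fps) = fps_const (f $ 0) + fps_X * fps_shift 1 f"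
  by (rule fps_ext) (auto simp: fps_X_mult_nth)

lemma fps_decompose_power:
  "(\<And>i. i < n \<Longrightarrow> (f :: 'a::comm_ring_1 fps) $ i = 0) \<Longrightarrow> f = fps_X ^ n * fps_shift n f"
  by (rule fps_ext) (auto simp: fps_X_power_mult_nth)

text \<open>Because \<open>c\<close> has no constant term, \<open>c ^ i\<close> has no coefficient
  below \<open>i\<close>, so the truncated sums defining the compositions may all be taken over one
  common range.\<close>

lemma fps_compose_X_mult:
  fixes f c :: "'a::comm_ring_1 fps"
  assumes "c $ 0 = 0"
  shows "(fps_X * f) oo c = c * (f oo c)"
proof (rule fps_ext)
  fix n
  have z: "(c ^ i) $ j = 0" if "j < i" for i j
    using startsby_zero_power_prefix[OF assms] that by blast
  have "((fps_X * f) oo c) $ n = (\<Sum>i\<in>{0..n}. (if i = 0 then 0 else f $ (i - 1)) * (c ^ i $ n))"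
    by (simp add: fps_compose_nth)
  also have "\<dots> = (\<Sum>i\<in>{1..Suc n}. f $ (i - 1) * (c ^ i $ n))"
    by (rule sum.mono_neutral_cong) (auto simp: z)
  also have "\<dots> = (\<Sum>i\<in>{0..n}. f $ i * (c ^ Suc i $ n))"
    by (rule sum.reindex_bij_witness[of _ Suc "\<lambda>i. i - 1"]) auto
  also have "\<dots> = (\<Sum>i\<in>{0..n}. \<Sum>j\<in>{0..n}. c $ j * (f $ i * (c ^ i $ (n - j))))"
    by (simp add: fps_mult_nth sum_distrib_left ac_simps)
  also have "\<dots> = (\<Sum>j\<in>{0..n}. c $ j * (\<Sum>i\<in>{0..n}. f $ i * (c ^ i $ (n - j))))"
    by (subst sum.swap) (simp add: sum_distrib_left)
  also have "\<dots> = (\<Sum>j\<in>{0..n}. c $ j * (f oo c) $ (n - j))"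
    by (intro sum.cong refl arg_cong2[where f = "(*)"])
      (auto simp: fps_compose_nth z intro!: sum.mono_neutral_right)
  finally show "((fps_X * f) oo c) $ n = (c * (f oo c)) $ n"
    by (simp add: fps_mult_nth)
qed

text \<open>The library has this only over integral domains.\<close>

lemma fps_compose_mult_distrib_ring:
  fixes f g c :: "'a::comm_ring_1 fps"
  assumes c: "c $ 0 = 0"
  shows "(f * g) oo c = (f oo c) * (g oo c)"
proof -
  have const: "(fps_const a * h) oo c = fps_const a * (h oo c)" for a h
    by (rule fps_ext) (simp add: fps_compose_nth sum_distrib_left ac_simps)
  have step: "(f oo c) = fps_const (f $ 0) + c * (fps_shift 1 f oo c)" for f
    by (subst fps_decompose[of f]) (simp add: fps_compose_add_distrib fps_compose_X_mult[OF c])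
  \<comment> \<open>Splitting off the constant term of \<open>f\<close> leaves a factor
    \<open>c\<close> without constant term, so coefficient \<open>n\<close> involves only smaller
    coefficients for the shifted series; hence \<open>f\<close> is arbitrary in the
    induction.\<close>
  have "((f * g) oo c) $ n = ((f oo c) * (g oo c)) $ n" for n
  proof (induction n arbitrary: f rule: less_induct)
    case (less n)
    let ?h = "fps_shift 1 f"
    have eq: "(f * g) oo c = fps_const (f $ 0) * (g oo c) + c * ((?h * g) oo c)"
    proof -
      have "f * g = fps_const (f $ 0) * g + fps_X * (?h * g)"
        by (subst fps_decompose[of f]) (simp add: algebra_simps)
      then show ?thesis
        by (simp add: fps_compose_add_distrib fps_compose_X_mult[OF c] const)
    qed
    have "(c * ((?h * g) oo c)) $ n = (c * ((?h oo c) * (g oo c))) $ n"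
      unfolding fps_mult_nth[of c]
    proof (rule sum.cong[OF refl])
      fix i assume "i \<in> {0..n}"
      then show "c $ i * ((?h * g) oo c) $ (n - i) = c $ i * ((?h oo c) * (g oo c)) $ (n - i)"
        using less.IH[of "n - i" ?h] c by (cases "i = 0") auto
    qed
    moreover have "(f oo c) * (g oo c) = fps_const (f $ 0) * (g oo c) + c * ((?h oo c) * (g oo c))"
      by (subst step[of f]) (simp add: algebra_simps)
    ultimately show ?case
      by (simp add: eq)
  qed
  then show ?thesis
    by (rule fps_ext)
qed

definition fps_cong :: "nat \<Rightarrow> 'a::comm_ring_1 fps \<Rightarrow> 'a fps \<Rightarrow> bool"
  where "fps_cong n f g \<longleftrightarrow> (\<forall>i<n. f $ i = g $ i)"

lemma fps_cong_refl [simp]: "fps_cong n f f"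
  by (simp add: fps_cong_def)

lemma fps_cong_trans [trans]: "fps_cong n f g \<Longrightarrow> fps_cong n g h \<Longrightarrow> fps_cong n f h"
  by (simp add: fps_cong_def)

lemma fps_cong_le: "fps_cong n f g \<Longrightarrow> m \<le> n \<Longrightarrow> fps_cong m f g"
  by (simp add: fps_cong_def)

lemma fps_cong_add: "fps_cong n f g \<Longrightarrow> fps_cong n f' g' \<Longrightarrow> fps_cong n (f + f') (g + g')"
  by (simp add: fps_cong_def)

lemma fps_cong_diff: "fps_cong n f g \<Longrightarrow> fps_cong n f' g' \<Longrightarrow> fps_cong n (f - f') (g - g')"
  by (simp add: fps_cong_def)

lemma fps_cong_mult: "fps_cong n f g \<Longrightarrow> fps_cong n f' g' \<Longrightarrow> fps_cong n (f * f') (g * g')"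
  by (simp add: fps_cong_def fps_mult_nth)

lemma fps_cong_X_power: "fps_cong n f g \<Longrightarrow> fps_cong (m + n) (fps_X ^ m * f) (fps_X ^ m * g)"
  by (auto simp: fps_cong_def fps_X_power_mult_nth)

lemma fps_cong_0_iff: "fps_cong n f g \<longleftrightarrow> fps_cong n (f - g) 0"
  by (auto simp: fps_cong_def)

section \<open>Unipotent maps on power series and their multiplicative defect\<close>

locale hasse_schmidt_setting =
  fixes p :: nat and C :: "'a::comm_ring_1 set" and e :: 'a
  assumes prime_p: "normalization_semidom_class.prime p" and e_idem: "e * e = e" and p_e: "of_nat p * e = 0"
begin



definition lin :: "('a \<Rightarrow> 'a) \<Rightarrow> bool"
  where "lin g \<longleftrightarrow> (\<forall>x y. g (x + y) = g x + g y) \<and> (\<forall>c\<in>C. \<forall>x. g (c * x) = c * g x) \<and>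
    (\<forall>x. e * g x = g x)"

text \<open>A Hasse-Schmidt derivation \<open>D\<close> is encoded by the \<open>X\<close>-linear map \<open>f \<mapsto> \<Sum>\<^sub>i\<^sub>,\<^sub>j D\<^sub>j(f\<^sub>i) X\<^bsup>i+j\<^esup>\<close> on power
  series, so that composition of maps is the group law. \<open>C\<close> is a set of scalars, and the components \<open>D\<^sub>j\<close>
  with \<open>j > 0\<close> take values in the direct factor \<open>e\<close> of the ring, the only one assumed to have
  characteristic \<open>p\<close>.\<close>

definition unip :: "('a fps \<Rightarrow> 'a fps) \<Rightarrow> bool"
  where "unip \<Phi> \<longleftrightarrow> (\<forall>f g. \<Phi> (f + g) = \<Phi> f + \<Phi> g) \<and> (\<forall>f. \<Phi> (fps_X * f) = fps_X * \<Phi> f) \<and>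
    (\<forall>f. \<Phi> f $ 0 = f $ 0) \<and> (\<forall>c\<in>C. \<forall>f. \<Phi> (fps_const c * f) = fps_const c * \<Phi> f) \<and>
    (\<forall>f. fps_const e * (\<Phi> f - f) = \<Phi> f - f)"

definition defect :: "('a fps \<Rightarrow> 'a fps) \<Rightarrow> 'a fps \<Rightarrow> 'a fps \<Rightarrow> 'a fps"
  where "defect \<Phi> f g = \<Phi> f * \<Phi> g - \<Phi> (f * g)"

text \<open>\<open>HS n\<close> is multiplicativity modulo \<open>X\<^sup>n\<close>, that is, length \<open>n - 1\<close>.\<close>

definition HS :: "nat \<Rightarrow> ('a fps \<Rightarrow> 'a fps) \<Rightarrow> bool"
  where "HS n \<Phi> \<longleftrightarrow> unip \<Phi> \<and> (\<forall>x y. fps_cong n (defect \<Phi> (fps_const x) (fps_const y)) 0)"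

definition comp_at :: "('a fps \<Rightarrow> 'a fps) \<Rightarrow> nat \<Rightarrow> 'a \<Rightarrow> 'a"
  where "comp_at \<Phi> i x = \<Phi> (fps_const x) $ i"

definition obstr :: "nat \<Rightarrow> ('a fps \<Rightarrow> 'a fps) \<Rightarrow> 'a \<Rightarrow> 'a \<Rightarrow> 'a"
  where "obstr n \<Phi> x y = defect \<Phi> (fps_const x) (fps_const y) $ n"

definition agree :: "nat \<Rightarrow> ('a fps \<Rightarrow> 'a fps) \<Rightarrow> ('a fps \<Rightarrow> 'a fps) \<Rightarrow> bool"
  where "agree r \<Phi> \<Psi> \<longleftrightarrow> (\<forall>x. fps_cong r (\<Phi> (fps_const x)) (\<Psi> (fps_const x)))"

lemma unip_add: "unip \<Phi> \<Longrightarrow> \<Phi> (f + g) = \<Phi> f + \<Phi> g"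
  and unip_X: "unip \<Phi> \<Longrightarrow> \<Phi> (fps_X * f) = fps_X * \<Phi> f"
  and unip_nth_0: "unip \<Phi> \<Longrightarrow> \<Phi> f $ 0 = f $ 0"
  and unip_C: "unip \<Phi> \<Longrightarrow> c \<in> C \<Longrightarrow> \<Phi> (fps_const c * f) = fps_const c * \<Phi> f"
  and unip_e: "unip \<Phi> \<Longrightarrow> fps_const e * (\<Phi> f - f) = \<Phi> f - f"
  by (auto simp: unip_def)

lemma unip_0: "unip \<Phi> \<Longrightarrow> \<Phi> 0 = 0"
  using unip_add[of \<Phi> 0 0] by simp

lemma unip_minus: "unip \<Phi> \<Longrightarrow> \<Phi> (- f) = - \<Phi> f"
  using unip_add[of \<Phi> f "- f"] unip_0[of \<Phi>] by (simp add: eq_neg_iff_add_eq_0 add.commute)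

lemma unip_diff: "unip \<Phi> \<Longrightarrow> \<Phi> (f - g) = \<Phi> f - \<Phi> g"
  using unip_add[of \<Phi> f "- g"] unip_minus[of \<Phi> g] by simp

lemma unip_X_power: "unip \<Phi> \<Longrightarrow> \<Phi> (fps_X ^ n * f) = fps_X ^ n * \<Phi> f"
  by (induction n arbitrary: f) (simp_all add: unip_X mult.assoc)

text \<open>Commuting with \<open>fps_X\<close> and preserving constant terms amounts to preserving
  the order and the leading coefficient of a series.\<close>

lemma unip_cong_0:
  assumes "unip \<Phi>" "fps_cong n f 0"
  shows "fps_cong n (\<Phi> f) 0" "\<Phi> f $ n = f $ n"
proof -
  have f: "f = fps_X ^ n * fps_shift n f"
    by (rule fps_decompose_power) (use assms(2) in \<open>simp add: fps_cong_def\<close>)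
  have "\<Phi> f = fps_X ^ n * \<Phi> (fps_shift n f)"
    by (subst f) (simp add: unip_X_power assms)
  then show "fps_cong n (\<Phi> f) 0" "\<Phi> f $ n = f $ n"
    by (simp_all add: fps_cong_def fps_X_power_mult_nth unip_nth_0 assms)
qed

lemma unip_cong: "unip \<Phi> \<Longrightarrow> fps_cong n f g \<Longrightarrow> fps_cong n (\<Phi> f) (\<Phi> g)"
  using unip_cong_0(1)[of \<Phi> n "f - g"] by (simp add: unip_diff flip: fps_cong_0_iff)

lemma unip_cong_0_iff:
  assumes "unip \<Phi>"
  shows "fps_cong n (\<Phi> f) 0 \<longleftrightarrow> fps_cong n f 0"
proof
  assume "fps_cong n (\<Phi> f) 0"
  then show "fps_cong n f 0"
  proof (induction n)
    case (Suc n)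
    then have "fps_cong n f 0"
      by (meson fps_cong_le le_SucI order_refl)
    then show ?case
      using unip_cong_0(2)[OF assms] Suc.prems by (auto simp: fps_cong_def less_Suc_eq)
  qed (simp add: fps_cong_def)
qed (rule unip_cong_0[OF assms])

lemma unip_id: "unip id"
  by (simp add: unip_def)

lemma unip_comp:
  assumes "unip \<Psi>" "unip \<Phi>"
  shows "unip (\<Psi> \<circ> \<Phi>)"
proof -
  have "fps_const e * (\<Psi> (\<Phi> f) - f) = \<Psi> (\<Phi> f) - f" for f
  proof -
    have "\<Psi> (\<Phi> f) - f = (\<Psi> (\<Phi> f) - \<Phi> f) + (\<Phi> f - f)"
      by simp
    then show ?thesis
      by (simp only: distrib_left unip_e assms)
  qed
  then show ?thesis
    using assms by (simp add: unip_def)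
qed

lemma defect_add_left: "unip \<Phi> \<Longrightarrow> defect \<Phi> (f + f') g = defect \<Phi> f g + defect \<Phi> f' g"
  and defect_add_right: "unip \<Phi> \<Longrightarrow> defect \<Phi> f (g + g') = defect \<Phi> f g + defect \<Phi> f g'"
  and defect_X_left: "unip \<Phi> \<Longrightarrow> defect \<Phi> (fps_X * f) g = fps_X * defect \<Phi> f g"
  and defect_X_right: "unip \<Phi> \<Longrightarrow> defect \<Phi> f (fps_X * g) = fps_X * defect \<Phi> f g"
  by (simp_all add: defect_def algebra_simps unip_add unip_X)

lemma defect_decompose:
  assumes "unip \<Phi>"
  shows "defect \<Phi> f g = defect \<Phi> (fps_const (f $ 0)) (fps_const (g $ 0)) +
    fps_X * (defect \<Phi> (fps_const (f $ 0)) (fps_shift 1 g) + defect \<Phi> (fps_shift 1 f) g)"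
proof -
  have "defect \<Phi> f g = defect \<Phi> (fps_const (f $ 0)) g + fps_X * defect \<Phi> (fps_shift 1 f) g"
    by (metis assms defect_add_left defect_X_left fps_decompose)
  also have "defect \<Phi> (fps_const (f $ 0)) g = defect \<Phi> (fps_const (f $ 0)) (fps_const (g $ 0)) +
      fps_X * defect \<Phi> (fps_const (f $ 0)) (fps_shift 1 g)"
    by (metis assms defect_add_right defect_X_right fps_decompose)
  finally show ?thesis
    by (simp add: algebra_simps)
qed

lemma HS_unip: "HS n \<Phi> \<Longrightarrow> unip \<Phi>"
  by (simp add: HS_def)

lemma HS_le: "HS n \<Phi> \<Longrightarrow> m \<le> n \<Longrightarrow> HS m \<Phi>"
  by (auto simp: HS_def intro: fps_cong_le)

text \<open>\<open>HS\<close> tests constants only. The defect is bilinear over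
  \<open>fps_X\<close>, so \<open>defect_decompose\<close> spreads its vanishing to all series; at
  index \<open>n\<close> everything beyond the constant terms carries a factor \<open>fps_X\<close>
  and hence a coefficient already known to be zero.\<close>

lemma HS_defect:
  assumes "HS n \<Phi>"
  shows "fps_cong n (defect \<Phi> f g) 0" "defect \<Phi> f g $ n = obstr n \<Phi> (f $ 0) (g $ 0)"
proof -
  note u = HS_unip[OF assms]
  have c: "defect \<Phi> (fps_const x) (fps_const y) $ i = 0" if "i < n" for x y i
    using assms that by (simp add: HS_def fps_cong_def)
  have "\<forall>f g. i \<le> n \<longrightarrow> defect \<Phi> f g $ i = (if i < n then 0 else obstr n \<Phi> (f $ 0) (g $ 0))" for i
  proof (induction i)
    case 0
    show ?case
      by (subst defect_decompose[OF u]) (auto simp: c obstr_def)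
  next
    case (Suc i)
    then show ?case
      by (subst defect_decompose[OF u]) (auto simp: c obstr_def)
  qed
  then show "fps_cong n (defect \<Phi> f g) 0" "defect \<Phi> f g $ n = obstr n \<Phi> (f $ 0) (g $ 0)"
    by (simp_all add: fps_cong_def)
qed

lemma HS_Suc_iff: "HS (Suc n) \<Phi> \<longleftrightarrow> HS n \<Phi> \<and> (\<forall>x y. obstr n \<Phi> x y = 0)"
  by (auto simp: HS_def fps_cong_def obstr_def less_Suc_eq)

lemma defect_comp:
  "unip \<Psi> \<Longrightarrow> defect (\<Psi> \<circ> \<Phi>) f g = defect \<Psi> (\<Phi> f) (\<Phi> g) + \<Psi> (defect \<Phi> f g)"
  by (simp add: defect_def unip_diff)

lemma HS_id: "HS n id"
  by (simp add: HS_def unip_id defect_def)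

lemma obstr_id: "obstr n id x y = 0"
  by (simp add: obstr_def defect_def)

text \<open>The defect of a composite is a sum of two defects of order at least \<open>n\<close>,
  and the outer map does not alter the coefficient at \<open>n\<close>. So the obstruction is
  additive although the group is not commutative.\<close>

lemma HS_comp:
  assumes "HS n \<Psi>" "HS n \<Phi>"
  shows "HS n (\<Psi> \<circ> \<Phi>)" "obstr n (\<Psi> \<circ> \<Phi>) x y = obstr n \<Psi> x y + obstr n \<Phi> x y"
proof -
  note u = HS_unip[OF assms(1)] HS_unip[OF assms(2)]
  show "HS n (\<Psi> \<circ> \<Phi>)"
    unfolding HS_def
  proof (intro conjI allI)
    fix x y
    have "fps_cong n (defect \<Psi> (\<Phi> (fps_const x)) (\<Phi> (fps_const y)) +
        \<Psi> (defect \<Phi> (fps_const x) (fps_const y))) (0 + 0)"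
      using HS_defect(1) assms u unip_cong_0(1) by (intro fps_cong_add) auto
    then show "fps_cong n (defect (\<Psi> \<circ> \<Phi>) (fps_const x) (fps_const y)) 0"
      by (simp add: defect_comp u)
  qed (simp add: unip_comp u)
  have "\<Psi> (defect \<Phi> (fps_const x) (fps_const y)) $ n = defect \<Phi> (fps_const x) (fps_const y) $ n"
    by (rule unip_cong_0(2)[OF u(1) HS_defect(1)[OF assms(2)]])
  then show "obstr n (\<Psi> \<circ> \<Phi>) x y = obstr n \<Psi> x y + obstr n \<Phi> x y"
    by (simp add: obstr_def[of n "\<Psi> \<circ> \<Phi>"] defect_comp u HS_defect(2)[OF assms(1)] unip_nth_0)
      (simp add: obstr_def)
qed

text \<open>Truncated Neumann series: \<open>N = id - \<Phi>\<close> raises the order of a series by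
  one, so the sum of the \<open>N ^^ i\<close> with \<open>i \<le> n\<close> telescopes to an
  inverse up to terms of order above \<open>n\<close>.\<close>

lemma unip_inverse:
  assumes "unip \<Phi>"
  obtains \<Psi> where "unip \<Psi>" "\<forall>f. fps_cong n (\<Psi> (\<Phi> f)) f" "\<forall>f. fps_cong n (\<Phi> (\<Psi> f)) f"
proof -
  define N where "N f = f - \<Phi> f" for f
  define \<Psi> where "\<Psi> f = (\<Sum>i\<le>n. (N ^^ i) f)" for f
  have N_add: "N (f + g) = N f + N g" for f g
    by (simp add: N_def unip_add assms)
  have N_sum: "N (sum h I) = (\<Sum>i\<in>I. N (h i))" for h and I :: "nat set"
    by (induction I rule: infinite_finite_induct) (simp_all add: N_add, simp_all add: N_def unip_0 assms)
  have pow_add: "(N ^^ i) (f + g) = (N ^^ i) f + (N ^^ i) g" for i f g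
    by (induction i) (simp_all add: N_add)
  have pow_X: "(N ^^ i) (fps_X * f) = fps_X * (N ^^ i) f" for i f
    by (induction i) (simp_all add: N_def unip_X assms algebra_simps)
  have pow_C: "(N ^^ i) (fps_const c * f) = fps_const c * (N ^^ i) f" if "c \<in> C" for i f c
    by (induction i) (simp_all add: N_def unip_C that assms algebra_simps)
  have N_cong: "fps_cong (Suc i) (N f) 0" if "fps_cong i f 0" for i f
    using that unip_cong_0[OF assms that] by (auto simp: fps_cong_def N_def less_Suc_eq)
  have pow_cong: "fps_cong i ((N ^^ i) f) 0" for i f
    by (induction i) (simp_all add: N_cong fps_cong_def[of 0])
  have N_e: "fps_const e * N f = N f" for f
    using unip_e[OF assms, of f] by (simp add: N_def algebra_simps)
  have pow_e: "fps_const e * (N ^^ Suc i) f = (N ^^ Suc i) f" for i f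
    by (simp add: N_e)
  have \<Psi>_split: "\<Psi> f = f + (\<Sum>i<n. (N ^^ Suc i) f)" for f
    by (simp add: \<Psi>_def sum.atMost_shift)
  have "unip \<Psi>"
    unfolding unip_def
  proof (intro conjI allI ballI)
    fix f
    show "\<Psi> f $ 0 = f $ 0"
      using fps_cong_le[OF pow_cong[of "Suc _" f], of 1]
      by (simp add: \<Psi>_split fps_sum_nth fps_cong_def)
    show "fps_const e * (\<Psi> f - f) = \<Psi> f - f"
      by (simp add: \<Psi>_split sum_distrib_left pow_e N_e)
  qed (simp_all add: \<Psi>_def pow_add pow_X pow_C sum.distrib sum_distrib_left)
  moreover have "fps_cong n (\<Phi> (\<Psi> f)) f" for f
  proof -
    have "\<Phi> (\<Psi> f) = \<Psi> f - N (\<Psi> f)"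
      by (simp add: N_def)
    also have "\<dots> = (\<Sum>i\<le>n. (N ^^ i) f - (N ^^ Suc i) f)"
      by (simp add: \<Psi>_def N_sum sum_subtractf)
    also have "\<dots> = f - (N ^^ Suc n) f"
      by (subst sum_telescope) simp
    finally show ?thesis
      using fps_cong_le[OF pow_cong[of "Suc n" f], of n] by (simp add: fps_cong_def)
  qed
  moreover have "fps_cong n (\<Psi> (\<Phi> f)) f" for f
  proof -
    have "\<Psi> (\<Phi> f) = (\<Sum>i\<le>n. (N ^^ i) f - (N ^^ Suc i) f)"
      unfolding \<Psi>_def
    proof (rule sum.cong[OF refl])
      fix i
      have "(N ^^ i) (N f + \<Phi> f) = (N ^^ i) f"
        by (simp add: N_def)
      then show "(N ^^ i) (\<Phi> f) = (N ^^ i) f - (N ^^ Suc i) f"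
        unfolding pow_add by (simp add: funpow_swap1 eq_diff_eq add.commute)
    qed
    also have "\<dots> = f - (N ^^ Suc n) f"
      by (subst sum_telescope) simp
    finally show ?thesis
      using fps_cong_le[OF pow_cong[of "Suc n" f], of n] by (simp add: fps_cong_def)
  qed
  ultimately show thesis
    using that by blast
qed

text \<open>The identity has no defect, so the defects of \<open>\<Phi>\<close> and
  \<open>\<Psi>\<close> cancel up to index \<open>n\<close>. The precision \<open>Suc n\<close> is
  what makes the coefficient at \<open>n\<close>, the obstruction, readable.\<close>

lemma HS_inverse:
  assumes "HS n \<Phi>" "unip \<Psi>" "\<And>f. fps_cong (Suc n) (\<Phi> (\<Psi> f)) f"
  shows "HS n \<Psi>" "obstr n \<Psi> x y = - obstr n \<Phi> x y"
proof -
  note u = HS_unip[OF assms(1)]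
  have eq: "fps_cong (Suc n) (defect \<Phi> (\<Psi> f) (\<Psi> g) + \<Phi> (defect \<Psi> f g)) 0" for f g
  proof -
    have "fps_cong (Suc n) (\<Phi> (\<Psi> f) * \<Phi> (\<Psi> g) - \<Phi> (\<Psi> (f * g))) (f * g - f * g)"
      by (intro fps_cong_diff fps_cong_mult assms)
    then show ?thesis
      by (simp add: defect_def unip_diff u)
  qed
  have "fps_cong n (\<Phi> (defect \<Psi> f g)) 0" for f g
    using fps_cong_le[OF eq[of f g], of n] HS_defect(1)[OF assms(1), of "\<Psi> f" "\<Psi> g"]
    by (simp add: fps_cong_def)
  then have c: "fps_cong n (defect \<Psi> f g) 0" for f g
    using unip_cong_0_iff[OF u] by blast
  then show "HS n \<Psi>"
    using assms(2) by (simp add: HS_def)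
  have "(defect \<Phi> (\<Psi> (fps_const x)) (\<Psi> (fps_const y)) + \<Phi> (defect \<Psi> (fps_const x) (fps_const y))) $ n = 0"
    using eq[of "fps_const x" "fps_const y"] by (simp only: fps_cong_def fps_zero_nth lessI)
  then show "obstr n \<Psi> x y = - obstr n \<Phi> x y"
    using unip_cong_0(2)[OF u c] HS_defect(2)[OF assms(1), of "\<Psi> (fps_const x)" "\<Psi> (fps_const y)"]
    by (simp add: unip_nth_0 assms(2) obstr_def eq_neg_iff_add_eq_0 add.commute)
qed

lemma lin_add: "lin g \<Longrightarrow> g (x + y) = g x + g y"
  and lin_C: "lin g \<Longrightarrow> c \<in> C \<Longrightarrow> g (c * x) = c * g x"
  and lin_e: "lin g \<Longrightarrow> e * g x = g x"
  by (auto simp: lin_def)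

lemma lin_0: "lin g \<Longrightarrow> g 0 = 0"
  using lin_add[of g 0 0] by simp

lemma comp_at_0: "unip \<Phi> \<Longrightarrow> comp_at \<Phi> 0 x = x"
  by (simp add: comp_at_def unip_nth_0)

lemma lin_comp_at:
  assumes "unip \<Phi>" "i > 0"
  shows "lin (comp_at \<Phi> i)"
  unfolding lin_def
proof (intro conjI allI ballI)
  fix x y c
  show "comp_at \<Phi> i (x + y) = comp_at \<Phi> i x + comp_at \<Phi> i y"
    using unip_add[OF assms(1), of "fps_const x" "fps_const y"]
    by (simp add: comp_at_def flip: fps_add_nth)
  show "comp_at \<Phi> i (c * x) = c * comp_at \<Phi> i x" if "c \<in> C"
    using unip_C[OF assms(1) that, of "fps_const x"] by (simp add: comp_at_def)
  have "(fps_const e * (\<Phi> (fps_const x) - fps_const x)) $ i = (\<Phi> (fps_const x) - fps_const x) $ i"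
    by (simp add: unip_e[OF assms(1)])
  then show "e * comp_at \<Phi> i x = comp_at \<Phi> i x"
    using assms(2) by (simp add: comp_at_def)
qed

text \<open>The extension of a map on constants that commutes with \<open>fps_X\<close>, as a
  convolution.\<close>

definition lin_ext :: "('a \<Rightarrow> 'a fps) \<Rightarrow> 'a fps \<Rightarrow> 'a fps"
  where "lin_ext u f = Abs_fps (\<lambda>n. \<Sum>i\<le>n. u (f $ i) $ (n - i))"

lemma lin_ext_const: "u 0 = 0 \<Longrightarrow> lin_ext u (fps_const x) = u x"
proof (rule fps_ext)
  fix n assume "u 0 = 0"
  then have "(\<Sum>i\<le>n. u (fps_const x $ i) $ (n - i)) = (\<Sum>i\<le>n. if i = 0 then u x $ n else 0)"
    by (intro sum.cong) auto
  then show "lin_ext u (fps_const x) $ n = u x $ n"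
    by (simp add: lin_ext_def)
qed

lemma unip_lin_ext:
  assumes "\<And>x. u x $ 0 = x" "\<And>i. i > 0 \<Longrightarrow> lin (\<lambda>x. u x $ i)"
  shows "unip (lin_ext u)"
  unfolding unip_def
proof (intro conjI allI ballI)
  fix f g c
  have add: "u (x + y) $ i = u x $ i + u y $ i" for x y i
    by (cases "i = 0") (auto simp: assms lin_add[OF assms(2)])
  have z: "u 0 $ i = 0" for i
    using add[of 0 0 i] by simp
  have C: "u (c * x) $ i = c * u x $ i" if "c \<in> C" for x i
    by (cases "i = 0") (auto simp: assms that lin_C[OF assms(2)])
  show "lin_ext u (f + g) = lin_ext u f + lin_ext u g"
    by (rule fps_ext) (simp add: lin_ext_def add sum.distrib)
  show "lin_ext u (fps_const c * f) = fps_const c * lin_ext u f" if "c \<in> C"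
    by (rule fps_ext) (simp add: lin_ext_def C[OF that] sum_distrib_left)
  show "lin_ext u (fps_X * f) = fps_X * lin_ext u f"
  proof (rule fps_ext)
    fix n
    show "lin_ext u (fps_X * f) $ n = (fps_X * lin_ext u f) $ n"
      by (cases n) (simp_all add: lin_ext_def z sum.atMost_Suc_shift del: sum.atMost_Suc)
  qed
  show "lin_ext u f $ 0 = f $ 0"
    by (simp add: lin_ext_def assms)
  show "fps_const e * (lin_ext u f - f) = lin_ext u f - f"
  proof (rule fps_ext)
    fix n
    have "lin_ext u f $ n = (\<Sum>i<n. u (f $ i) $ (n - i)) + f $ n"
      by (simp add: lin_ext_def lessThan_Suc_atMost[symmetric] assms)
    moreover have "e * (\<Sum>i<n. u (f $ i) $ (n - i)) = (\<Sum>i<n. u (f $ i) $ (n - i))"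
      by (simp add: sum_distrib_left lin_e[OF assms(2)])
    ultimately show "(fps_const e * (lin_ext u f - f)) $ n = (lin_ext u f - f) $ n"
      by simp
  qed
qed

text \<open>Every linear map \<open>g\<close> gives \<open>id + X\<^sup>n g\<close>, whose obstruction at \<open>n\<close> is the
  (Harrison) coboundary of \<open>g\<close>.\<close>

definition twist :: "nat \<Rightarrow> ('a \<Rightarrow> 'a) \<Rightarrow> 'a fps \<Rightarrow> 'a fps"
  where "twist n g = lin_ext (\<lambda>x. fps_const x + fps_X ^ n * fps_const (g x))"

lemma twist:
  assumes "n > 0" "lin g"
  shows "HS n (twist n g)" "obstr n (twist n g) x y = x * g y + g x * y - g (x * y)"
    "comp_at (twist n g) i x = (if i = 0 then x else if i = n then g x else 0)"
proof -
  let ?u = "\<lambda>x. fps_const x + fps_X ^ n * fps_const (g x)"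
  have lin0: "lin (\<lambda>x. 0)"
    by (simp add: lin_def)
  have nth: "?u x $ i = (if i = 0 then x else if i = n then g x else 0)" for i x
    using assms(1) by (auto simp: fps_X_power_mult_nth)
  have "lin (\<lambda>x. ?u x $ i)" if "i > 0" for i
    unfolding nth using that assms(2) lin0 by (cases "i = n") simp_all
  then have u: "unip (twist n g)"
    unfolding twist_def by (rule unip_lin_ext[rotated]) (simp_all only: nth if_True refl)
  have c: "twist n g (fps_const x) = ?u x" for x
    unfolding twist_def by (rule lin_ext_const) (simp add: lin_0 assms)
  have d: "defect (twist n g) (fps_const x) (fps_const y) = fps_X ^ n *
      (fps_const (x * g y + g x * y - g (x * y)) + fps_X ^ n * fps_const (g x * g y))" for x y
    unfolding defect_def fps_const_mult c
    by (simp add: algebra_simps flip: fps_const_mult fps_const_add fps_const_sub)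
  show "HS n (twist n g)"
    by (simp add: HS_def u d fps_cong_def fps_X_power_mult_nth)
  show "obstr n (twist n g) x y = x * g y + g x * y - g (x * y)"
    using assms(1) by (simp add: obstr_def d fps_X_power_mult_nth)
  show "comp_at (twist n g) i x = (if i = 0 then x else if i = n then g x else 0)"
    by (simp only: comp_at_def c nth)
qed

text \<open>The series \<open>h\<close> is substituted only into the values on constants, and the
  result is extended again. Composing every value with \<open>h\<close> would turn the factor
  \<open>fps_X\<close> into \<open>h\<close> and leave the unipotent maps.\<close>

definition subst :: "'a fps \<Rightarrow> ('a fps \<Rightarrow> 'a fps) \<Rightarrow> 'a fps \<Rightarrow> 'a fps"
  where "subst h \<Phi> = lin_ext (\<lambda>x. \<Phi> (fps_const x) oo h)"

lemma lin_sum_scaled: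
  "(\<And>i. i \<in> I \<Longrightarrow> lin (g i)) \<Longrightarrow> lin (\<lambda>x. \<Sum>i\<in>I. g i x * b i)"
  unfolding lin_def
  by (safe; simp add: sum.distrib distrib_right sum_distrib_left flip: mult.assoc cong: sum.cong)

lemma subst:
  assumes "unip \<Phi>" "h $ 0 = 0"
  shows "unip (subst h \<Phi>)" "subst h \<Phi> (fps_const x) = \<Phi> (fps_const x) oo h"
    "defect (subst h \<Phi>) (fps_const x) (fps_const y) = defect \<Phi> (fps_const x) (fps_const y) oo h"
proof -
  have z: "(h ^ i) $ j = 0" if "j < i" for i j
    using startsby_zero_power_prefix[OF assms(2)] that by blast
  have "lin (\<lambda>x. (\<Phi> (fps_const x) oo h) $ n)" if "n > 0" for n
  proof -
    \<comment> \<open>The absence of the index \<open>0\<close> matters: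
      \<open>comp_at \<Phi> 0\<close> is the identity, which in general does not take values in the
      factor \<open>e\<close>. It drops out because \<open>h ^ 0\<close> has no coefficient at
      \<open>n > 0\<close>.\<close>
    have "(\<Phi> (fps_const x) oo h) $ n = (\<Sum>i\<in>{1..n}. comp_at \<Phi> i x * (h ^ i $ n))" for x
      using that by (simp add: fps_compose_nth sum.atLeast_Suc_atMost comp_at_def)
    moreover have "lin (\<lambda>x. \<Sum>i\<in>{1..n}. comp_at \<Phi> i x * (h ^ i $ n))"
      by (rule lin_sum_scaled) (simp add: lin_comp_at assms)
    ultimately show ?thesis
      by (simp only:)
  qed
  then show "unip (subst h \<Phi>)"
    unfolding subst_def by (intro unip_lin_ext) (simp_all add: unip_nth_0 assms)
  show c: "subst h \<Phi> (fps_const x) = \<Phi> (fps_const x) oo h" for x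
    unfolding subst_def by (rule lin_ext_const) (simp add: unip_0 assms fps_compose_0)
  show "defect (subst h \<Phi>) (fps_const x) (fps_const y) = defect \<Phi> (fps_const x) (fps_const y) oo h"
    by (simp add: defect_def c fps_compose_sub_distrib fps_compose_mult_distrib_ring assms)
qed

end

lemma fps_compose_monom_nth:
  fixes f :: "'a::comm_ring_1 fps"
  assumes "r > 0"
  shows "(f oo (fps_const a * fps_X ^ r)) $ n = (if r dvd n then f $ (n div r) * a ^ (n div r) else 0)"
proof -
  have pow: "(fps_const a * fps_X ^ r) ^ i $ n = (if n = r * i then a ^ i else 0)" for i
    by (simp add: power_mult_distrib fps_const_power fps_X_power_nth flip: power_mult)
  have "(f oo (fps_const a * fps_X ^ r)) $ n = (\<Sum>i\<in>{0..n}. if n = r * i then f $ i * a ^ i else 0)"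
    by (simp add: fps_compose_nth pow if_distrib cong: if_cong)
  also have "\<dots> = (\<Sum>i\<in>{0..n}. if i = n div r \<and> r dvd n then f $ i * a ^ i else 0)"
    using assms by (intro sum.cong refl if_cong) (auto simp: mult.commute)
  finally show ?thesis
    by (simp add: if_bool_eq_conj)
qed

lemma one_plus_fps_X_power_nth: "((1 + fps_X) ^ m :: 'a::comm_ring_1 fps) $ i = of_nat (m choose i)"
proof (induction m arbitrary: i)
  case (Suc m)
  then show ?case
    by (cases i) (simp_all add: distrib_right)
qed (simp add: fps_one_nth binomial_eq_0)

section \<open>Groups of obstructions in characteristic p\<close>

context hasse_schmidt_setting
begin

lemma prime_gt_1: "p > 1" and p_pos: "p > 0"
  using prime_p prime_gt_1_nat prime_gt_0_nat by auto

text \<open>Write \<open>\<Phi> = id + N\<close> with \<open>N\<close> valued in the factor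
  \<open>e\<close>: the contribution of \<open>id\<close> alone cancels and every remaining term
  contains a value of \<open>N\<close>. Thus obstructions are killed by \<open>p\<close>
  (\<open>p_obstr\<close>) even if the ring is not.\<close>

lemma defect_e: "unip \<Phi> \<Longrightarrow> fps_const e * defect \<Phi> (fps_const x) (fps_const y) = defect \<Phi> (fps_const x) (fps_const y)"
proof -
  assume u: "unip \<Phi>"
  define N where "N f = \<Phi> f - f" for f
  have N: "fps_const e * N f = N f" for f
    using unip_e[OF u, of f] by (simp add: N_def)
  have "defect \<Phi> (fps_const x) (fps_const y) = N (fps_const x) * fps_const y + 
      N (fps_const y) * \<Phi> (fps_const x) - N (fps_const x * fps_const y)"
    by (simp add: defect_def N_def algebra_simps)
  then show ?thesis
    by (simp only: right_diff_distrib distrib_left N flip: mult.assoc)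
qed

lemma obstr_e: "unip \<Phi> \<Longrightarrow> e * obstr n \<Phi> x y = obstr n \<Phi> x y"
  using defect_e[of \<Phi> x y] by (metis fps_mult_left_const_nth obstr_def)

lemma p_obstr: "unip \<Phi> \<Longrightarrow> of_nat p * obstr n \<Phi> x y = 0"
  using obstr_e[of \<Phi> n x y] p_e by (metis mult.assoc mult_zero_left)

lemma agree_cong:
  assumes "unip \<Phi>" "unip \<Psi>" "agree r \<Phi> \<Psi>"
  shows "fps_cong r (\<Phi> f) (\<Psi> f)"
proof -
  have "i < r \<longrightarrow> \<Phi> f $ i = \<Psi> f $ i" for i
  proof (induction i arbitrary: f)
    case 0
    then show ?case
      by (simp add: unip_nth_0 assms)
  next
    case (Suc i)
    have "\<Phi> f = \<Phi> (fps_const (f $ 0)) + fps_X * \<Phi> (fps_shift 1 f)"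
      "\<Psi> f = \<Psi> (fps_const (f $ 0)) + fps_X * \<Psi> (fps_shift 1 f)"
      by (metis fps_decompose unip_X unip_add assms(1,2))+
    then show ?case
      using assms(3) Suc[of "fps_shift 1 f"] by (auto simp: agree_def fps_cong_def)
  qed
  then show ?thesis
    by (simp add: fps_cong_def)
qed

lemma comp_at_comp:
  assumes "unip \<Phi>" "unip \<Psi>"
  shows "comp_at (\<Psi> \<circ> \<Phi>) 1 x = comp_at \<Psi> 1 x + comp_at \<Phi> 1 x"
proof -
  have "\<Psi> (\<Phi> (fps_const x)) = \<Psi> (fps_const x) + fps_X * \<Psi> (fps_shift 1 (\<Phi> (fps_const x)))"
    by (metis fps_decompose unip_X unip_add assms fps_nth_fps_const unip_nth_0)
  then show ?thesis
    by (simp add: comp_at_def unip_nth_0 assms)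
qed

text \<open>Left division by \<open>K\<close>. It is the tool that strips a known leading component
  off \<open>\<Phi>\<close> while keeping track of the obstruction.\<close>

lemma HS_quotient:
  assumes "HS n \<Phi>" "HS n K" "agree r \<Phi> K"
  obtains F where "HS n F" "agree r F id" "\<And>x y. obstr n F x y = obstr n \<Phi> x y - obstr n K x y"
proof -
  note u = HS_unip[OF assms(1)] HS_unip[OF assms(2)]
  \<comment> \<open>The inverse of \<open>K\<close> has to be correct modulo
    \<open>fps_X ^ r\<close> to compare low components and modulo \<open>fps_X ^ Suc n\<close> to
    read off the obstruction.\<close>
  obtain \<Psi> where "unip \<Psi>" "\<forall>f. fps_cong (max r (Suc n)) (\<Psi> (K f)) f"
      "\<forall>f. fps_cong (max r (Suc n)) (K (\<Psi> f)) f"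
    by (rule unip_inverse[OF u(2), where n = "max r (Suc n)"]) (rule that)
  note \<Psi> = this(1) this(2,3)[rule_format]
  have *: "fps_cong (Suc n) (K (\<Psi> f)) f" for f
    by (rule fps_cong_le[OF \<Psi>(3)]) simp
  have inv: "HS n \<Psi>" "obstr n \<Psi> x y = - obstr n K x y" for x y
    by (rule HS_inverse[where \<Phi> = K and \<Psi> = \<Psi>]; fact assms(2) \<Psi>(1) *)+
  have "fps_cong r ((\<Psi> \<circ> \<Phi>) (fps_const x)) (fps_const x)" for x
  proof -
    have "fps_cong r (\<Psi> (\<Phi> (fps_const x))) (\<Psi> (K (fps_const x)))"
      by (rule unip_cong[OF \<Psi>(1)]) (use assms(3) in \<open>simp add: agree_def\<close>)
    also have "fps_cong r \<dots> (fps_const x)"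
      by (rule fps_cong_le[OF \<Psi>(2)]) simp
    finally show ?thesis
      by simp
  qed
  then have "agree r (\<Psi> \<circ> \<Phi>) id"
    by (simp add: agree_def)
  moreover have "obstr n (\<Psi> \<circ> \<Phi>) x y = obstr n \<Phi> x y - obstr n K x y" for x y
    using HS_comp(2)[OF inv(1) assms(1), of x y] inv(2)[of x y] by (metis add.commute diff_conv_add_uminus)
  ultimately show thesis
    by (rule that[OF HS_comp(1)[OF inv(1) assms(1)]])
qed

definition scale :: "'a \<Rightarrow> nat \<Rightarrow> ('a fps \<Rightarrow> 'a fps) \<Rightarrow> 'a fps \<Rightarrow> 'a fps"
  where "scale a r = subst (fps_const a * fps_X ^ r)"

lemma scale:
  assumes "HS n \<Phi>" "r > 0"
  shows "HS (n * r) (scale a r \<Phi>)" "obstr (n * r) (scale a r \<Phi>) x y = a ^ n * obstr n \<Phi> x y"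
    "comp_at (scale a r \<Phi>) i x = (if r dvd i then comp_at \<Phi> (i div r) x * a ^ (i div r) else 0)"
proof -
  note u = HS_unip[OF assms(1)]
  have h: "(fps_const a * fps_X ^ r) $ 0 = 0"
    using assms(2) by (simp add: fps_X_power_nth)
  note s = subst[OF u h, folded scale_def]
  have "i div r < n" if "i < n * r" for i
    using that assms(2) by (simp add: less_mult_imp_div_less)
  then show "HS (n * r) (scale a r \<Phi>)"
    using assms s(1,3) by (simp add: HS_def fps_cong_def fps_compose_monom_nth)
  show "obstr (n * r) (scale a r \<Phi>) x y = a ^ n * obstr n \<Phi> x y"
    using assms(2) by (simp add: obstr_def s(3) fps_compose_monom_nth)
  show "comp_at (scale a r \<Phi>) i x = (if r dvd i then comp_at \<Phi> (i div r) x * a ^ (i div r) else 0)"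
    using assms(2) by (simp add: comp_at_def s(2) fps_compose_monom_nth)
qed

text \<open>Cochains rather than classes: for \<open>n > 0\<close> every coboundary is itself the
  obstruction of a \<open>twist\<close>, so passing to the quotient would gain nothing.\<close>

definition obstructions :: "nat \<Rightarrow> ('a \<Rightarrow> 'a \<Rightarrow> 'a) set"
  where "obstructions n = {d. \<exists>\<Phi>. HS n \<Phi> \<and> d = obstr n \<Phi>}"

lemma obstructionsI: "HS n \<Phi> \<Longrightarrow> obstr n \<Phi> \<in> obstructions n"
  by (auto simp: obstructions_def)

lemma obstructions_0: "(\<lambda>x y. 0) \<in> obstructions n"
  using obstructionsI[OF HS_id[of n]] by (simp add: obstr_id[abs_def])

lemma obstructions_add:
  assumes "d \<in> obstructions n" "d' \<in> obstructions n"
  shows "(\<lambda>x y. d x y + d' x y) \<in> obstructions n"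
proof -
  obtain \<Phi> \<Psi> where "HS n \<Phi>" "d = obstr n \<Phi>" "HS n \<Psi>" "d' = obstr n \<Psi>"
    using assms by (auto simp: obstructions_def)
  then show ?thesis
    using obstructionsI[of n "\<Phi> \<circ> \<Psi>"] HS_comp[of n \<Phi> \<Psi>] by (simp add: fun_eq_iff)
      (metis (no_types, lifting) ext)
qed

lemma obstructions_uminus:
  assumes "d \<in> obstructions n"
  shows "(\<lambda>x y. - d x y) \<in> obstructions n"
proof -
  obtain \<Phi> where \<Phi>: "HS n \<Phi>" "d = obstr n \<Phi>"
    using assms by (auto simp: obstructions_def)
  obtain F where "HS n F" "\<And>x y. obstr n F x y = obstr n id x y - obstr n \<Phi> x y"
    using HS_quotient[OF HS_id \<Phi>(1), of 0] by (auto simp: agree_def fps_cong_def)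
  then have "obstr n F = (\<lambda>x y. - d x y)"
    by (simp add: fun_eq_iff obstr_id \<Phi>)
  then show ?thesis
    using obstructionsI[OF \<open>HS n F\<close>] by simp
qed

lemma obstructions_of_nat:
  assumes "d \<in> obstructions n"
  shows "(\<lambda>x y. of_nat k * d x y) \<in> obstructions n"
proof (induction k)
  case (Suc k)
  then show ?case
    using obstructions_add[OF assms Suc] by (simp add: algebra_simps)
qed (simp add: obstructions_0)

text \<open>Substituting \<open>fps_X ^ r\<close> moves an obstruction from \<open>n\<close> to
  \<open>n * r\<close> without changing the cochain.\<close>

lemma obstructions_mult:
  assumes "r > 0"
  shows "obstructions n \<subseteq> obstructions (n * r)"
proof
  fix d assume "d \<in> obstructions n"
  then obtain \<Phi> where \<Phi>: "HS n \<Phi>" "d = obstr n \<Phi>"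
    by (auto simp: obstructions_def)
  show "d \<in> obstructions (n * r)"
    using scale(1,2)[OF \<Phi>(1) assms, of 1] 
    by (auto simp: obstructions_def \<Phi>(2) fun_eq_iff intro!: exI[of _ "scale 1 r \<Phi>"])
qed

lemma obstructions_power_mono: "s \<le> t \<Longrightarrow> obstructions (p ^ s) \<subseteq> obstructions (p ^ t)"
  using obstructions_mult[of "p ^ (t - s)" "p ^ s"] p_pos by (simp flip: power_add)

lemma obstructions_coboundary:
  assumes "lin g" "n > 0"
  shows "(\<lambda>x y. x * g y + g x * y - g (x * y)) \<in> obstructions n"
  using twist[OF assms(2,1)] by (auto simp: obstructions_def fun_eq_iff intro!: exI[of _ "twist n g"])

text \<open>An obstruction that already occurs at the proper divisor \<open>l\<close> is cancelled
  by a map \<open>\<Psi>\<close> with the negative obstruction there, stretched by \<open>r\<close>.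
  As \<open>r > 1\<close>, the stretched map has no component at \<open>1\<close>, so the first
  component of \<open>\<Phi>\<close> survives.\<close>

lemma HS_extend:
  assumes "HS n \<Phi>" "obstr n \<Phi> \<in> obstructions l" "n = l * r" "r > 1"
  obtains \<Phi>' where "HS (Suc n) \<Phi>'" "comp_at \<Phi>' 1 = comp_at \<Phi> 1"
proof -
  obtain \<Psi> where \<Psi>: "HS l \<Psi>" "(\<lambda>x y. - obstr n \<Phi> x y) = obstr l \<Psi>"
    using obstructions_uminus[OF assms(2)] by (auto simp: obstructions_def)
  have r: "r > 0"
    using assms by simp
  let ?K = "scale 1 r \<Psi>"
  note s = scale[OF \<Psi>(1) r, of 1]
  have K: "HS n ?K" "obstr n ?K x y = - obstr n \<Phi> x y" for x y
    using s(1) s(2)[of x y] fun_cong[OF fun_cong[OF \<Psi>(2)], of x y] assms(3) by simp_all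
  have "HS (Suc n) (\<Phi> \<circ> ?K)"
    using HS_comp[OF assms(1) K(1)] by (simp add: HS_Suc_iff K(2))
  moreover have "comp_at (\<Phi> \<circ> ?K) 1 = comp_at \<Phi> 1"
  proof
    fix x
    have "comp_at ?K 1 x = 0"
      using assms(4) s(3)[of 1 x] by simp
    then show "comp_at (\<Phi> \<circ> ?K) 1 x = comp_at \<Phi> 1 x"
      using comp_at_comp[OF HS_unip[OF K(1)] HS_unip[OF assms(1)], of x] by simp
  qed
  ultimately show thesis
    by (rule that)
qed

text \<open>If all components strictly between \<open>0\<close> and \<open>n\<close> vanish, only
  the two extreme terms of the Leibniz sum remain, and the obstruction is the coboundary of
  component \<open>n\<close>.\<close>

lemma obstr_low:
  assumes "unip \<Phi>" "agree n \<Phi> id" "n > 0"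
  shows "obstr n \<Phi> x y = x * comp_at \<Phi> n y + comp_at \<Phi> n x * y - comp_at \<Phi> n (x * y)"
proof -
  have c: "\<Phi> (fps_const x) $ i = (if i = 0 then x else 0)" if "i < n" for x i
    using assms(2) that by (auto simp: agree_def fps_cong_def)
  have "(\<Phi> (fps_const x) * \<Phi> (fps_const y)) $ n =
      (\<Sum>i\<in>{0..n}. (if i = 0 then x * comp_at \<Phi> n y else 0) + (if i = n then comp_at \<Phi> n x * y else 0))"
    unfolding fps_mult_nth
    by (rule sum.cong) (use assms(3) in \<open>auto simp: c comp_at_def\<close>)
  also have "\<dots> = x * comp_at \<Phi> n y + comp_at \<Phi> n x * y"
    by (simp add: sum.distrib)
  finally show ?thesis
    by (simp add: obstr_def defect_def comp_at_def)
qed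

lemma agree_id_Suc_iff:
  assumes "agree r \<Phi> id" "agree r \<Psi> id" "comp_at \<Phi> r = comp_at \<Psi> r"
  shows "agree (Suc r) \<Phi> \<Psi>"
  unfolding agree_def fps_cong_def
proof (intro allI impI)
  fix x i assume "i < Suc r"
  then show "\<Phi> (fps_const x) $ i = \<Psi> (fps_const x) $ i"
    using assms(1,2) fun_cong[OF assms(3), of x]
    by (cases "i = r") (auto simp: agree_def fps_cong_def comp_at_def)
qed

lemma agree_scale_id:
  assumes "HS n \<Phi>" "r > 0"
  shows "agree r (scale 1 r \<Phi>) id"
  using scale(3)[OF assms, of 1] HS_unip[OF assms(1)]
  by (auto simp: agree_def fps_cong_def comp_at_def unip_nth_0)

text \<open>In the next two definitions the bound \<open>M\<close> only serves the simultaneous induction; both hold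
  for all \<open>M\<close> in the end.\<close>

definition leading_integrable :: "nat \<Rightarrow> nat \<Rightarrow> bool"
  where "leading_integrable M n \<longleftrightarrow> (\<forall>\<Phi> r. r > 0 \<longrightarrow> n < M * r \<longrightarrow> HS (Suc n) \<Phi> \<longrightarrow> agree r \<Phi> id \<longrightarrow>
    (\<exists>\<Delta>. HS (Suc (n div r)) \<Delta> \<and> comp_at \<Delta> 1 = comp_at \<Phi> r))"

definition p_part_obstructions :: "nat \<Rightarrow> bool"
  where "p_part_obstructions M \<longleftrightarrow> (\<forall>l s. 0 < l \<longrightarrow> l < M \<longrightarrow> \<not> p ^ Suc s dvd l \<longrightarrow>
    obstructions l \<subseteq> obstructions (p ^ s))"

text \<open>Induction upwards on \<open>r\<close>. The leading component at \<open>r\<close> is the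
  first component of some \<open>\<Delta>\<close>; dividing \<open>\<Phi>\<close> by the stretched
  \<open>\<Delta>\<close> moves the start to \<open>r + 1\<close>. The stretched map has an
  obstruction at \<open>n\<close> only if \<open>r\<close> divides \<open>n\<close>, and then it is
  that of \<open>\<Delta>\<close> at \<open>l = n / r\<close>, whose \<open>p\<close>-part the last
  hypothesis bounds. Once \<open>r \<ge> n\<close>, a coboundary is left.\<close>

lemma obstr_low_mem:
  assumes "p_part_obstructions M" "leading_integrable M (n - 1)" "n > 0"
    and "HS n \<Phi>" "agree r \<Phi> id" "r > 0" "n < M * r"
    and "\<And>l. l dvd n \<Longrightarrow> l * r \<le> n \<Longrightarrow> \<not> p ^ Suc s dvd l"
  shows "obstr n \<Phi> \<in> obstructions (p ^ s)"
  using assms(4-)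
proof (induction "n - r" arbitrary: r \<Phi> rule: less_induct)
  case (less r \<Phi>)
  note u = HS_unip[OF less.prems(1)]
  show ?case
  proof (cases "r \<ge> n")
    case True
    then have "agree n \<Phi> id"
      using less.prems(2) by (auto simp: agree_def intro: fps_cong_le)
    then have "obstr n \<Phi> = (\<lambda>x y. x * comp_at \<Phi> n y + comp_at \<Phi> n x * y - comp_at \<Phi> n (x * y))"
      using obstr_low[OF u _ assms(3)] by (simp add: fun_eq_iff)
    then show ?thesis
      using obstructions_coboundary[OF lin_comp_at[OF u assms(3)]] p_pos by simp
  next
    case False
    have "HS (Suc (n - 1)) \<Phi>" "n - 1 < M * r"
      using less.prems assms(3) by simp_all
    then obtain \<Delta> where \<Delta>: "HS (Suc ((n - 1) div r)) \<Delta>" "comp_at \<Delta> 1 = comp_at \<Phi> r"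
      using assms(2) less.prems(2,3) unfolding leading_integrable_def by blast
    \<comment> \<open>\<open>?l\<close> is \<open>n / r\<close> rounded up. Hence the stretched
      \<open>\<Delta>\<close> is multiplicative at least modulo \<open>fps_X ^ n\<close>, and
      \<open>?l * r = n\<close> exactly when \<open>r\<close> divides \<open>n\<close>.\<close>
    let ?l = "Suc ((n - 1) div r)"
    let ?K = "scale 1 r \<Delta>"
    note s = scale[OF \<Delta>(1) less.prems(3), of 1]
    have "n - 1 < ?l * r"
      using less.prems(3) by (simp add: dividend_less_div_times)
    then have le: "n \<le> ?l * r"
      by simp
    then have K: "HS n ?K"
      by (rule HS_le[OF s(1)])
    have "comp_at ?K r = comp_at \<Phi> r"
      using s(3)[of r] less.prems(3) by (auto simp flip: \<Delta>(2))
    then have "agree (Suc r) \<Phi> ?K"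
      using less.prems agree_scale_id[OF \<Delta>(1) less.prems(3)] by (intro agree_id_Suc_iff) auto
    then obtain F where F: "HS n F" "agree (Suc r) F id" "\<And>x y. obstr n F x y = obstr n \<Phi> x y - obstr n ?K x y"
      using HS_quotient[OF less.prems(1) K] by metis
    have "obstr n F \<in> obstructions (p ^ s)"
    proof (rule less.hyps[OF _ F(1,2)])
      show "n - Suc r < n - r" "n < M * Suc r" "0 < Suc r"
        using False less.prems by simp_all
      show "\<not> p ^ Suc s dvd l" if "l dvd n" "l * Suc r \<le> n" for l
        using less.prems(5) that by simp
    qed
    moreover have "obstr n ?K \<in> obstructions (p ^ s)"
    proof (cases "n = ?l * r")
      case True
      have "?l < M"
        using less.prems(4) True by (metis mult_less_cancel2)
      moreover have "\<not> p ^ Suc s dvd ?l"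
        by (rule less.prems(5)) (use True in \<open>metis dvd_triv_left\<close>, use True in simp)
      ultimately have "obstructions ?l \<subseteq> obstructions (p ^ s)"
        using assms(1) unfolding p_part_obstructions_def by blast
      moreover have "obstr n ?K = obstr ?l \<Delta>"
        using s(2) True by (simp add: fun_eq_iff)
      ultimately show ?thesis
        using obstructionsI[OF \<Delta>(1)] by auto
    next
      case False
      then have "HS (Suc n) ?K"
        using le by (intro HS_le[OF s(1)]) simp
      then have "obstr n ?K = (\<lambda>x y. 0)"
        by (simp add: HS_Suc_iff fun_eq_iff)
      then show ?thesis
        by (simp add: obstructions_0)
    qed
    ultimately have "(\<lambda>x y. obstr n F x y + obstr n ?K x y) \<in> obstructions (p ^ s)"
      by (rule obstructions_add)
    then show ?thesis
      by (simp add: F(3))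
  qed
qed

lemma prime_power_factor:
  assumes "(n::nat) > 0"
  obtains s q where "n = p ^ s * q" "\<not> p dvd q" "q > 0"
proof -
  have "\<not> is_unit p"
    using prime_gt_1 by simp
  then obtain q where "n = p ^ multiplicity p n * q" "\<not> p dvd q"
    using multiplicity_decompose'[of n p] assms by auto
  then show thesis
    using that assms by (metis mult_0_right not_gr_zero)
qed

text \<open>Here \<open>n\<close> is \<open>p ^ s * q\<close> with \<open>q > 1\<close> prime to
  \<open>p\<close>, so its obstruction already occurs at the proper divisor \<open>p ^ s\<close> and
  \<open>HS_extend\<close> applies.\<close>

lemma HS_extend_not_prime_power:
  assumes "p_part_obstructions M" "0 < n" "n < M" "\<And>s. n \<noteq> p ^ s" "HS n \<Phi>"
  obtains \<Phi>' where "HS (Suc n) \<Phi>'" "comp_at \<Phi>' 1 = comp_at \<Phi> 1"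
proof -
  obtain s q where q: "n = p ^ s * q" "\<not> p dvd q" "q > 0"
    using prime_power_factor[OF assms(2)] by metis
  have "\<not> p ^ Suc s dvd n"
    using q p_pos by simp
  then have "obstr n \<Phi> \<in> obstructions (p ^ s)"
    using assms(1-3) obstructionsI[OF assms(5)] unfolding p_part_obstructions_def by blast
  moreover have "q > 1"
    using q assms(4)[of s] by (cases "q = 1") auto
  ultimately show thesis
    using HS_extend[OF assms(5) _ q(1)] that by blast
qed

text \<open>The required length \<open>n div r\<close> grows only when \<open>r\<close> divides the
  new index, say \<open>q * r\<close>. If \<open>q\<close> is not a power of \<open>p\<close>,
  \<open>\<Delta>\<close> extends by itself; if it is, the missing information comes from
  \<open>\<Phi>\<close>, which is multiplicative one step further.\<close>

lemma leading_integrable: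
  assumes "p_part_obstructions M"
  shows "leading_integrable M n"
proof (induction n)
  case 0
  show ?case
    unfolding leading_integrable_def
  proof (intro allI impI)
    fix \<Phi> and r :: nat
    assume r: "r > 0" and \<Phi>: "HS (Suc 0) \<Phi>"
    have "lin (comp_at \<Phi> r)"
      using lin_comp_at HS_unip \<Phi> r by blast
    then have "HS 1 (twist 1 (comp_at \<Phi> r))" "comp_at (twist 1 (comp_at \<Phi> r)) 1 = comp_at \<Phi> r"
      using twist(1)[of 1] twist(3)[of 1 _ 1] by (simp_all add: fun_eq_iff)
    then show "\<exists>\<Delta>. HS (Suc (0 div r)) \<Delta> \<and> comp_at \<Delta> 1 = comp_at \<Phi> r"
      by auto
  qed
next
  case (Suc n)
  show ?case
    unfolding leading_integrable_def
  proof (intro allI impI)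
    fix \<Phi> and r :: nat
    assume r: "r > 0" and bd: "Suc n < M * r" and \<Phi>: "HS (Suc (Suc n)) \<Phi>" and low: "agree r \<Phi> id"
    have \<Phi>n: "HS (Suc n) \<Phi>"
      by (rule HS_le[OF \<Phi>]) simp
    moreover have "n < M * r"
      using bd by simp
    ultimately obtain \<Delta> where \<Delta>: "HS (Suc (n div r)) \<Delta>" "comp_at \<Delta> 1 = comp_at \<Phi> r"
      using Suc low r unfolding leading_integrable_def by blast
    note u = HS_unip[OF \<Phi>]
    show "\<exists>\<Delta>. HS (Suc (Suc n div r)) \<Delta> \<and> comp_at \<Delta> 1 = comp_at \<Phi> r"
    proof (cases "r dvd Suc n")
      case False
      then have "Suc n div r = n div r"
        by (simp add: div_Suc dvd_eq_mod_eq_0)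
      then show ?thesis
        using \<Delta> by auto
    next
      case True
      then obtain q where q: "Suc n = q * r"
        by (metis dvd_def mult.commute)
      have div: "Suc n div r = q" "Suc (n div r) = q"
        using True q r div_Suc[of n r] by (simp_all add: dvd_eq_mod_eq_0 split: if_splits)
      have qM: "q < M" and q0: "q > 0"
        using bd q r by (metis mult_less_cancel2, metis div(2) zero_less_Suc)
      have \<Delta>q: "HS q \<Delta>"
        using \<Delta>(1) div by simp
      have "\<exists>\<Delta>'. HS (Suc q) \<Delta>' \<and> comp_at \<Delta>' 1 = comp_at \<Delta> 1"
      proof (cases "\<exists>s. q = p ^ s")
        case False
        then show ?thesis
          using HS_extend_not_prime_power[OF assms q0 qM _ \<Delta>q] by metis
      next
        case True
        then obtain s where s: "q = p ^ s"
          by blast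
        show ?thesis
        proof (cases s)
          case 0
          \<comment> \<open>Now \<open>\<Phi>\<close> starts exactly at the index where it is
            unobstructed. Its obstruction there is the coboundary of the leading component, so that
            component is a derivation and \<open>twist 1\<close> reaches the required
            length.\<close>
          then have rn: "r = Suc n"
            using s q by simp
          have lin: "lin (comp_at \<Phi> r)"
            by (rule lin_comp_at[OF u r])
          have "obstr r \<Phi> x y = 0" for x y
            using \<Phi> by (simp add: HS_Suc_iff rn)
          then have "x * comp_at \<Phi> r y + comp_at \<Phi> r x * y - comp_at \<Phi> r (x * y) = 0" for x y
            using obstr_low[OF u low r] by simp
          then have "HS (Suc 1) (twist 1 (comp_at \<Phi> r))"
            using twist(1,2)[OF _ lin, of 1] unfolding HS_Suc_iff[of 1] by simp
          moreover have "comp_at (twist 1 (comp_at \<Phi> r)) 1 = comp_at \<Delta> 1"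
            unfolding \<Delta>(2) using twist(3)[OF _ lin, of 1 1] by (simp add: fun_eq_iff)
          ultimately show ?thesis
            using s 0 by auto
        next
          case (Suc t)
          let ?K = "scale 1 r \<Delta>"
          note sc = scale[OF \<Delta>q r, of 1]
          have K: "HS (Suc n) ?K"
            using sc(1) q by simp
          have "comp_at ?K r = comp_at \<Phi> r"
            using sc(3)[of r] r by (auto simp flip: \<Delta>(2))
          then have "agree (Suc r) \<Phi> ?K"
            using low agree_scale_id[OF \<Delta>q r] by (intro agree_id_Suc_iff) auto
          then obtain F where F: "HS (Suc n) F" "agree (Suc r) F id"
              "\<And>x y. obstr (Suc n) F x y = obstr (Suc n) \<Phi> x y - obstr (Suc n) ?K x y"
            using HS_quotient[OF \<Phi>n K] by metis
          \<comment> \<open>Since \<open>\<Phi>\<close> is unobstructed at \<open>Suc n\<close>, the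
            obstruction of \<open>\<Delta>\<close> at \<open>q\<close> is minus that of
            \<open>F\<close>. As \<open>F\<close> starts at \<open>r + 1\<close>, only
            \<open>l\<close> with \<open>l * (r + 1) \<le> q * r\<close> occur; these are smaller
            than \<open>q = p ^ Suc t\<close>, so \<open>p ^ Suc t\<close> cannot divide
            them.\<close>
          have "obstr (Suc n) F \<in> obstructions (p ^ t)"
          proof (rule obstr_low_mem[OF assms _ _ F(1,2)])
            show "leading_integrable M (Suc n - 1)"
              using Suc.IH by simp
            show "Suc n < M * Suc r"
              using bd by simp
            fix l assume l: "l dvd Suc n" "l * Suc r \<le> Suc n"
            have "l \<noteq> 0"
              using l(1) by (metis dvd_0_left_iff Suc_not_Zero)
            moreover have "l * r + l \<le> q * r"
              using l(2) by (simp add: q)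
            ultimately have "l * r < q * r"
              by linarith
            then have "l < p ^ Suc t" "l \<noteq> 0"
              using s Suc \<open>l \<noteq> 0\<close> by auto
            then show "\<not> p ^ Suc t dvd l"
              using dvd_imp_le by force
          qed simp_all
          moreover have "obstr q \<Delta> = (\<lambda>x y. - obstr (Suc n) F x y)"
            using \<Phi> sc(2) by (simp add: F(3) HS_Suc_iff fun_eq_iff flip: q)
          ultimately have "obstr q \<Delta> \<in> obstructions (p ^ t)"
            using obstructions_uminus by metis
          moreover have "q = p ^ t * p"
            using s Suc by simp
          ultimately show ?thesis
            using HS_extend[OF \<Delta>q _ _ prime_gt_1] by metis
        qed
      qed
      then show ?thesis
        using div \<Delta>(2) by auto
    qed
  qed
qed

text \<open>By the absorption identity, \<open>i\<close> times the binomial coefficient is a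
  multiple of \<open>p ^ s\<close>. If \<open>p\<close> did not divide the coefficient,
  \<open>p ^ s\<close> would divide \<open>i\<close>, which is positive and smaller.\<close>

lemma p_dvd_choose:
  assumes "\<not> p dvd (q::nat)" "0 < i" "i < p ^ s"
  shows "p dvd (p ^ s * q choose i)"
proof (rule ccontr)
  assume "\<not> p dvd (p ^ s * q choose i)"
  moreover have "i * (p ^ s * q choose i) = (p ^ s * q) * ((p ^ s * q - 1) choose (i - 1))"
    using times_binomial_minus1_eq[OF assms(2)] .
  then have "p ^ s dvd i * (p ^ s * q choose i)"
    by (simp add: mult.assoc)
  ultimately have "p ^ s dvd i"
    using prime_p by (metis coprime_commute coprime_dvd_mult_left_iff prime_imp_coprime coprime_power_right_iff)
  then show False
    using assms dvd_imp_le by force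
qed

text \<open>\<open>const_p_fac\<close>, the count behind Sylow's theorem, equates the multiplicity
  of \<open>p\<close> in this coefficient with the one in \<open>q\<close>.\<close>

lemma p_not_dvd_choose:
  assumes "\<not> p dvd (q::nat)"
  shows "\<not> p dvd (p ^ s * q choose p ^ s)"
proof -
  have q: "q > 0"
    using assms by (metis dvd_0_right gr_zeroI)
  then have "(p ^ s * q choose p ^ s) > 0"
    by simp
  moreover have "multiplicity p (p ^ s * q choose p ^ s) = 0"
    using const_p_fac[OF q prime_p] not_dvd_imp_multiplicity_0[OF assms] by simp
  ultimately show ?thesis
    using prime_gt_1 multiplicity_gt_zero_iff[of "p ^ s * q choose p ^ s" p] by auto
qed

end

section \<open>Obstructions depend only on the p-part of the length\<close>

context hasse_schmidt_setting
begin

text \<open>The substituted series has order at least \<open>a\<close>, so terms of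
  \<open>\<delta>\<close> beyond \<open>n\<close> land in order at least \<open>a * (n + 1)\<close>;
  below that bound only the leading term is visible.\<close>

lemma fps_compose_low_terms:
  fixes h \<delta> :: "'a fps"
  assumes "fps_cong n \<delta> 0" "a > 0"
  shows "fps_cong (a * n + a) (\<delta> oo (fps_X ^ a * h)) (fps_X ^ (a * n) * (fps_const (\<delta> $ n) * h ^ n))"
  unfolding fps_cong_def
proof (intro allI impI)
  fix i assume i: "i < a * n + a"
  have pow: "(fps_X ^ a * h) ^ j $ i = (if i < a * j then 0 else (h ^ j) $ (i - a * j))" for j
    by (simp add: power_mult_distrib fps_X_power_mult_nth flip: power_mult)
  have z: "\<delta> $ j * (fps_X ^ a * h) ^ j $ i = 0" if "j \<noteq> n" for j
  proof (cases "j < n")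
    case True
    then show ?thesis
      using assms by (simp add: fps_cong_def)
  next
    case False
    then have "a * Suc n \<le> a * j"
      using that by (intro mult_le_mono) auto
    then show ?thesis
      using i by (simp add: pow)
  qed
  have "(\<delta> oo (fps_X ^ a * h)) $ i = (\<Sum>j\<in>{0..i}. if j = n then \<delta> $ n * (fps_X ^ a * h) ^ n $ i else 0)"
    unfolding fps_compose_nth by (rule sum.cong) (auto simp: z)
  also have "\<dots> = (if i < a * n then 0 else \<delta> $ n * (h ^ n) $ (i - a * n))"
    using assms(2) by (auto simp: pow) (metis le_trans linorder_not_less mult_le_cancel1 mult_1 nat_mult_1 One_nat_def Suc_leI mult_le_mono1)
  finally show "(\<delta> oo (fps_X ^ a * h)) $ i = (fps_X ^ (a * n) * (fps_const (\<delta> $ n) * h ^ n)) $ i"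
    by (simp add: fps_X_power_mult_nth)
qed

text \<open>If \<open>\<Phi>\<close> has obstruction \<open>d\<close> at \<open>m\<close>, substituting \<open>X\<^sup>a + X\<^bsup>a+1\<^esup>\<close> and dividing by the substitution
  of \<open>X\<^sup>a\<close> leaves the obstruction \<open>((1 + X)\<^sup>m - 1) X\<^bsup>am\<^esup> d\<close>, whose first coefficient not divisible
  by \<open>p\<close> is the one of \<open>X\<^bsup>am + p^t\<^esup>\<close>. Taking \<open>p\<close> to divide \<open>a\<close> makes \<open>p^t\<close> the \<open>p\<close>-part of
  \<open>am + p^t\<close>.\<close>

lemma obstructions_p_part_step:
  assumes "p_part_obstructions m" "m = p ^ t * q" "\<not> p dvd q" "q > 1"
  shows "obstructions m \<subseteq> obstructions (p ^ t)"
proof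
  fix d assume "d \<in> obstructions m"
  then obtain \<Phi> where \<Phi>: "HS m \<Phi>" and d: "d = obstr m \<Phi>"
    by (auto simp: obstructions_def)
  have pt: "p ^ t < m" "p ^ t > 0" "m > 0"
    using assms(2,4) p_pos by simp_all
  \<comment> \<open>Besides the divisibility by \<open>p\<close>, \<open>a\<close> must exceed
    \<open>p ^ t\<close>: then \<open>a * m + p ^ t\<close> lies below \<open>T = a * m + a\<close>,
    the range in which only leading terms of the substituted defects are seen.\<close>
  define a where "a = p * m"
  have a: "m < a" "a > 0"
    using prime_gt_1 pt by (simp_all add: a_def)
  define h where "h = fps_X ^ a * (1 + fps_X :: 'a fps)"
  define k where "k = fps_X ^ a * (1 :: 'a fps)"
  have hk0: "h $ 0 = 0" "k $ 0 = 0"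
    using a by (simp_all add: h_def k_def fps_X_power_nth)
  note u = HS_unip[OF \<Phi>]
  define H where "H = subst h \<Phi>"
  define K where "K = subst k \<Phi>"
  note sH = subst[OF u hk0(1), folded H_def]
  note sK = subst[OF u hk0(2), folded K_def]
  define T where "T = a * m + a"
  obtain \<Psi> where "unip \<Psi>" "\<forall>f. fps_cong T (\<Psi> (K f)) f" "\<forall>f. fps_cong T (K (\<Psi> f)) f"
    by (rule unip_inverse[OF sK(1), where n = T]) (rule that)
  note \<Psi> = this(1) this(2,3)[rule_format]
  define G where "G = H \<circ> \<Psi>"
  have uG: "unip G"
    by (simp add: G_def unip_comp sH(1) \<Psi>(1))
  have GK: "fps_cong T (G (K f)) (H f)" for f
    unfolding G_def o_apply by (rule unip_cong[OF sH(1)]) (rule \<Psi>(2))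
  have aT: "Suc a \<le> T"
    using a pt by (simp add: T_def)
  \<comment> \<open>The two substituted series \<open>h\<close> and \<open>k\<close> differ only
    from \<open>fps_X ^ (a + 1)\<close> on, so \<open>G\<close> has no component between
    \<open>0\<close> and \<open>a + 1\<close>.\<close>
  have "agree (Suc a) H K"
    unfolding agree_def fps_cong_def
  proof (intro allI impI)
    fix x i assume i: "i < Suc a"
    let ?f = "\<Phi> (fps_const x) - fps_const x"
    have f: "fps_cong 1 ?f 0"
      by (simp add: fps_cong_def unip_nth_0 u)
    have "i < a * 1 + a"
      using i a by simp
    then have "(?f oo h) $ i = (fps_X ^ (a * 1) * (fps_const (?f $ 1) * (1 + fps_X) ^ 1)) $ i"
      "(?f oo k) $ i = (fps_X ^ (a * 1) * (fps_const (?f $ 1) * 1 ^ 1)) $ i"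
      using fps_compose_low_terms[OF f a(2), of "1 + fps_X"] fps_compose_low_terms[OF f a(2), of 1]
      unfolding fps_cong_def h_def k_def by blast+
    moreover have "(fps_X ^ (a * 1) * (fps_const (?f $ 1) * (1 + fps_X) ^ 1)) $ i =
        (fps_X ^ (a * 1) * (fps_const (?f $ 1) * 1 ^ 1)) $ i"
      using i by (auto simp: fps_X_power_mult_nth less_Suc_eq)
    ultimately have "(?f oo h) $ i = (?f oo k) $ i"
      by (simp only:)
    then show "H (fps_const x) $ i = K (fps_const x) $ i"
      unfolding sH(2) sK(2) fps_compose_sub_distrib by simp
  qed
  note HK = agree_cong[OF sH(1) sK(1) this]
  have G_low: "fps_cong (Suc a) (G f) f" for f
  proof -
    have "fps_cong (Suc a) (G f) (K (\<Psi> f))"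
      unfolding G_def o_apply by (rule HK)
    also have "fps_cong (Suc a) \<dots> f"
      by (rule fps_cong_le[OF \<Psi>(3) aT])
    finally show ?thesis .
  qed
  have defect_GK: "fps_cong T (defect G (K (fps_const x)) (K (fps_const y)))
      (fps_X ^ (a * m) * (fps_const (d x y) * ((1 + fps_X) ^ m - 1)))" for x y
  proof -
    let ?\<delta> = "defect \<Phi> (fps_const x) (fps_const y)"
    have \<delta>: "fps_cong m ?\<delta> 0" "?\<delta> $ m = d x y"
      using HS_defect(1)[OF \<Phi>] by (simp_all add: d obstr_def)
    have dH: "fps_cong T (defect H (fps_const x) (fps_const y))
        (fps_X ^ (a * m) * (fps_const (d x y) * (1 + fps_X) ^ m))"
      using fps_compose_low_terms[OF \<delta>(1) a(2), of "1 + fps_X"] by (simp only: T_def sH(3) h_def \<delta>(2))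
    have dK: "fps_cong T (defect K (fps_const x) (fps_const y)) (fps_X ^ (a * m) * fps_const (d x y))"
      using fps_compose_low_terms[OF \<delta>(1) a(2), of 1] by (simp add: T_def sK(3) k_def \<delta>(2))
    have "fps_cong T (G (defect K (fps_const x) (fps_const y))) (G (fps_X ^ (a * m) * fps_const (d x y)))"
      by (rule unip_cong[OF uG dK])
    also have "G (fps_X ^ (a * m) * fps_const (d x y)) = fps_X ^ (a * m) * G (fps_const (d x y))"
      by (rule unip_X_power[OF uG])
    also have "fps_cong T \<dots> (fps_X ^ (a * m) * fps_const (d x y))"
      using fps_cong_X_power[OF fps_cong_le[OF G_low, of a], of "a * m"] by (simp add: T_def)
    finally have GdK: "fps_cong T (G (defect K (fps_const x) (fps_const y))) (fps_X ^ (a * m) * fps_const (d x y))" .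
    have "fps_cong T (defect (G \<circ> K) (fps_const x) (fps_const y)) (defect H (fps_const x) (fps_const y))"
      unfolding defect_def o_apply by (intro fps_cong_diff fps_cong_mult GK)
    then have "fps_cong T (defect (G \<circ> K) (fps_const x) (fps_const y) - G (defect K (fps_const x) (fps_const y)))
        (fps_X ^ (a * m) * (fps_const (d x y) * (1 + fps_X) ^ m) - fps_X ^ (a * m) * fps_const (d x y))"
      by (intro fps_cong_diff GdK) (rule fps_cong_trans[OF _ dH])
    then show ?thesis
      by (simp add: defect_comp[OF uG] algebra_simps)
  qed
  have choose0: "of_nat (m choose i) * d x y = 0" if "0 < i" "i < p ^ t" for i x y
  proof -
    have "p dvd (m choose i)"
      using p_dvd_choose[OF assms(3) \<open>0 < i\<close> \<open>i < p ^ t\<close>] assms(2) by simp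
    then obtain c where "(m choose i) = p * c" ..
    then show ?thesis
      using p_obstr[OF u, of m x y] by (simp add: d mult.commute[of "of_nat p"] mult.assoc)
  qed
  define N where "N = a * m + p ^ t"
  have NT: "N < T"
    using pt a by (simp add: N_def T_def)
  have G_nth: "defect G (K (fps_const x)) (K (fps_const y)) $ n =
      (if n < a * m then 0 else d x y * ((1 + fps_X) ^ m - 1) $ (n - a * m))" if "n < T" for n x y
    using defect_GK[of x y] that by (simp add: fps_cong_def fps_X_power_mult_nth)
  have obs: "obstr n G x y = defect G (K (fps_const x)) (K (fps_const y)) $ n" if "HS n G" for n x y
    using HS_defect(2)[OF that] by (simp add: unip_nth_0 sK(1))
  have HSG: "n \<le> N \<Longrightarrow> HS n G" for n
  proof (induction n)
    case 0
    then show ?case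
      by (simp add: HS_def uG fps_cong_def)
  next
    case (Suc n)
    then have n: "n < N" "HS n G"
      by simp_all
    have "obstr n G x y = 0" for x y
    proof (cases "n < a * m")
      case False
      then have "n - a * m < p ^ t"
        using n by (simp add: N_def)
      then show ?thesis
        using choose0[of "n - a * m" x y] False n NT
        by (cases "n = a * m") (simp_all add: obs G_nth one_plus_fps_X_power_nth mult.commute)
    qed (use n NT in \<open>simp add: obs G_nth\<close>)
    then show ?case
      using n(2) by (simp add: HS_Suc_iff)
  qed
  have "obstr N G x y = of_nat (m choose p ^ t) * d x y" for x y
    using p_pos by (simp add: obs[OF HSG] G_nth[OF NT] one_plus_fps_X_power_nth mult.commute) (simp add: N_def)
  then have obsN: "obstr N G = (\<lambda>x y. of_nat (m choose p ^ t) * d x y)"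
    by (simp add: fun_eq_iff)
  have "obstr N G \<in> obstructions (p ^ t)"
  proof (rule obstr_low_mem[OF assms(1) leading_integrable[OF assms(1)] _ HSG])
    show "agree (Suc a) G id"
      by (simp add: agree_def G_low)
    \<comment> \<open>Starting at \<open>a + 1\<close> instead of \<open>a\<close> is decisive: any
      \<open>l\<close> with \<open>l * (a + 1) \<le> N\<close> is then smaller than
      \<open>m\<close>, where the induction hypothesis is available.\<close>
    show "N < m * Suc a"
      using pt by (simp add: N_def mult.commute)
    have "N = p ^ t * (a * q + 1)"
      by (simp add: N_def assms(2) algebra_simps)
    moreover have "\<not> p dvd a * q + 1"
      using prime_gt_1 dvd_add_right_iff[of p "a * q" 1] by (simp add: a_def)
    ultimately have "\<not> p ^ Suc t dvd N"
      using p_pos by (simp only: power_Suc2 nat_mult_dvd_cancel_disj) simp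
    then show "\<not> p ^ Suc t dvd l" if "l dvd N" for l
      using that dvd_trans by blast
  qed (use pt in \<open>simp_all add: N_def\<close>)
  \<comment> \<open>The binomial coefficient is invertible modulo \<open>p\<close>, and
    \<open>p\<close> kills obstructions, so \<open>d\<close> is recovered as an integer multiple of
    the obstruction of \<open>G\<close>.\<close>
  moreover obtain b c where *: "(m choose p ^ t) * c = p * b + 1"
  proof -
    have "coprime (m choose p ^ t) p"
      using p_not_dvd_choose[OF assms(3), of t] prime_imp_coprime[OF prime_p]
      by (metis assms(2) coprime_commute)
    moreover have "(m choose p ^ t) \<noteq> 0"
      using pt by simp
    ultimately show thesis
      using that bezout_nat[of "m choose p ^ t" p] by auto
  qed
  have "of_nat c * (of_nat (m choose p ^ t) * d x y) = d x y" for x y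
  proof -
    have "of_nat c * (of_nat (m choose p ^ t) * d x y) = of_nat ((m choose p ^ t) * c) * d x y"
      by (simp add: ac_simps)
    also have "\<dots> = d x y + of_nat b * (of_nat p * d x y)"
      unfolding * by (simp add: algebra_simps)
    finally show ?thesis
      using p_obstr[OF u, of m x y] by (simp add: d)
  qed
  ultimately show "d \<in> obstructions (p ^ t)"
    using obstructions_of_nat[of "obstr N G" "p ^ t" c] by (simp add: obsN)
qed

text \<open>Only \<open>l = m\<close> is new when the bound grows to \<open>Suc m\<close>. If
  \<open>m\<close> is a power of \<open>p\<close> there is nothing to reduce; otherwise the
  preceding step lemma applies, and \<open>obstructions_power_mono\<close> passes from the
  \<open>p\<close>-part \<open>p ^ t\<close> to \<open>p ^ s\<close>.\<close>

theorem p_part_obstructions: "p_part_obstructions M"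
proof (induction M)
  case (Suc m)
  have "obstructions m \<subseteq> obstructions (p ^ s)" if "m > 0" "\<not> p ^ Suc s dvd m" for s
  proof -
    obtain t q where q: "m = p ^ t * q" "\<not> p dvd q" "q > 0"
      using prime_power_factor[OF \<open>m > 0\<close>] by metis
    have "t \<le> s"
    proof (rule ccontr)
      assume "\<not> t \<le> s"
      then have "p ^ Suc s dvd p ^ t"
        by (intro le_imp_power_dvd) simp
      then show False
        using that(2) q(1) by simp
    qed
    have "obstructions m \<subseteq> obstructions (p ^ t)"
    proof (cases "q = 1")
      case False
      then show ?thesis
        using obstructions_p_part_step[OF Suc q(1,2)] q(3) by linarith
    qed (simp add: q)
    then show ?thesis
      using obstructions_power_mono[OF \<open>t \<le> s\<close>] by blast
  qed
  then show ?case
    using Suc by (auto simp: p_part_obstructions_def less_Suc_eq)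
qed (simp add: p_part_obstructions_def)

text \<open>The case \<open>r = 2\<close> of \<open>obstr_low_mem\<close>: a divisor
  \<open>l\<close> of \<open>p ^ Suc s\<close> with \<open>l * 2 \<le> p ^ Suc s\<close> is a proper
  one, so \<open>p ^ Suc s\<close> does not divide it.\<close>

lemma obstr_low_prime_power:
  assumes "HS (p ^ Suc s) \<Phi>" "agree 2 \<Phi> id"
  shows "obstr (p ^ Suc s) \<Phi> \<in> obstructions (p ^ s)"
proof (rule obstr_low_mem[OF p_part_obstructions leading_integrable[OF p_part_obstructions] _ assms])
  show "p ^ Suc s < Suc (p ^ Suc s) * 2"
    by simp
  fix l assume "l dvd p ^ Suc s" "l * 2 \<le> p ^ Suc s"
  moreover have "l \<noteq> 0"
    using \<open>l dvd p ^ Suc s\<close> p_pos by (metis dvd_0_left_iff power_not_zero less_numeral_extra(3))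
  ultimately have "0 < l" "l < p ^ Suc s"
    by simp_all
  then show "\<not> p ^ Suc s dvd l"
    using dvd_imp_le by force
qed (use p_pos in simp_all)

lemma HS_extend_not_p_power:
  assumes "n > 0" "\<And>s. n \<noteq> p ^ s" "HS n \<Phi>"
  obtains \<Phi>' where "HS (Suc n) \<Phi>'" "comp_at \<Phi>' 1 = comp_at \<Phi> 1"
  using HS_extend_not_prime_power[OF p_part_obstructions assms(1) lessI assms(2,3)] by metis

end

section \<open>Descent along a separable base change\<close>

context hasse_schmidt_setting
begin

lemma comp_at_mult:
  assumes "HS n \<Phi>" "i < n"
  shows "comp_at \<Phi> i (x * y) = (\<Sum>j\<in>{0..i}. comp_at \<Phi> j x * comp_at \<Phi> (i - j) y)"
  using assms HS_defect(1)[OF assms(1), of "fps_const x" "fps_const y"]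
  by (simp add: fps_cong_def defect_def comp_at_def fps_mult_nth)

lemma obstr_comp_at:
  "obstr n \<Phi> x y = (\<Sum>j\<in>{0..n}. comp_at \<Phi> j x * comp_at \<Phi> (n - j) y) - comp_at \<Phi> n (x * y)"
  by (simp add: obstr_def defect_def comp_at_def fps_mult_nth)

lemma agree_iff_comp_at: "agree r \<Phi> \<Psi> \<longleftrightarrow> (\<forall>i<r. comp_at \<Phi> i = comp_at \<Psi> i)"
  by (auto simp: agree_def fps_cong_def comp_at_def fun_eq_iff)

lemma obstr_1:
  assumes "unip \<Phi>"
  shows "obstr 1 \<Phi> x y = x * comp_at \<Phi> 1 y + comp_at \<Phi> 1 x * y - comp_at \<Phi> 1 (x * y)"
  by (rule obstr_low[OF assms]) (auto simp: agree_def fps_cong_def unip_nth_0 assms)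

lemma comp_at_1_Leibniz:
  assumes "HS n \<Phi>" "n \<ge> 2"
  shows "comp_at \<Phi> 1 (x * y) = x * comp_at \<Phi> 1 y + comp_at \<Phi> 1 x * y"
proof -
  have "obstr 1 \<Phi> x y = 0"
    using HS_le[OF assms(1), of "Suc 1"] assms(2) unfolding HS_Suc_iff by simp
  then show ?thesis
    using obstr_1[OF HS_unip[OF assms(1)], of x y] by simp
qed

text \<open>Rescaling by coefficients and composing realises a linear combination of first
  components, and the obstructions then combine with the \<open>n\<close>-th powers of the same
  coefficients. This is where the Frobenius powers come from.\<close>

lemma HS_product:
  assumes "\<forall>(a, \<Phi>)\<in>set cs. HS n \<Phi>"
  obtains R where "HS n R" "\<forall>x. comp_at R 1 x = (\<Sum>(a, \<Phi>)\<leftarrow>cs. a * comp_at \<Phi> 1 x)"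
    "\<forall>x y. obstr n R x y = (\<Sum>(a, \<Phi>)\<leftarrow>cs. a ^ n * obstr n \<Phi> x y)"
proof -
  have "\<exists>R. HS n R \<and> (\<forall>x. comp_at R 1 x = (\<Sum>(a, \<Phi>)\<leftarrow>cs. a * comp_at \<Phi> 1 x)) \<and>
    (\<forall>x y. obstr n R x y = (\<Sum>(a, \<Phi>)\<leftarrow>cs. a ^ n * obstr n \<Phi> x y))"
    using assms
  proof (induction cs)
    case Nil
    have "comp_at id 1 x = 0" for x
      by (simp add: comp_at_def)
    then show ?case
      using HS_id obstr_id by (intro exI[of _ id]) (simp del: id_apply)
  next
    case (Cons c cs)
    obtain a \<Phi> where c: "c = (a, \<Phi>)"
      by force
    have "HS n \<Phi>"
      using Cons.prems c by simp
    note s = scale[OF this, of 1 a, simplified]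
    obtain R where R: "HS n R" "\<forall>x. comp_at R 1 x = (\<Sum>(a, \<Phi>)\<leftarrow>cs. a * comp_at \<Phi> 1 x)"
      "\<forall>x y. obstr n R x y = (\<Sum>(a, \<Phi>)\<leftarrow>cs. a ^ n * obstr n \<Phi> x y)"
      using Cons by auto
    show ?case
    proof (intro exI conjI allI)
      show "HS n (scale a 1 \<Phi> \<circ> R)"
        using HS_comp(1)[OF s(1) R(1)] by simp
      show "obstr n (scale a 1 \<Phi> \<circ> R) x y = (\<Sum>(a, \<Phi>)\<leftarrow>c # cs. a ^ n * obstr n \<Phi> x y)" for x y
        using HS_comp(2)[OF s(1) R(1), of x y] s(2) R(3) by (simp add: c)
      show "comp_at (scale a 1 \<Phi> \<circ> R) 1 x = (\<Sum>(a, \<Phi>)\<leftarrow>c # cs. a * comp_at \<Phi> 1 x)" for x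
        using comp_at_comp[OF HS_unip[OF R(1)] HS_unip[OF s(1)], of x] s(3)[of 1 x] R(2)
        by (simp add: c mult.commute)
    qed
  qed
  then show thesis
    using that by blast
qed

end

text \<open>The abstract form of the base change \<open>A \<rightarrow> L \<otimes> A = B\<close>: \<open>S\<close> are the scalars from \<open>L\<close> and the elements
  of \<open>functionals\<close> are the maps \<open>\<phi> \<otimes> id : L \<otimes> A \<rightarrow> A\<close> for \<open>k\<close>-linear \<open>\<phi> : L \<rightarrow> k\<close>. Separability
  enters through \<open>frobenius_lift\<close>.\<close>

locale base_change_setting =
  A: hasse_schmidt_setting p C e + B: hasse_schmidt_setting p C' e'
  for p and C :: "'a::comm_ring_1 set" and e and C' :: "'b::comm_ring_1 set" and e' +
  fixes \<iota> :: "'a \<Rightarrow> 'b" and S :: "'b set" and functionals :: "('b \<Rightarrow> 'a) set"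
  assumes iota_add: "\<iota> (x + y) = \<iota> x + \<iota> y"
    and iota_mult: "\<iota> (x * y) = \<iota> x * \<iota> y"
    and iota_C: "c \<in> C \<Longrightarrow> \<iota> c \<in> C'"
    and S_power: "b \<in> S \<Longrightarrow> b ^ p \<in> S"
    and functional_add: "\<pi> \<in> functionals \<Longrightarrow> \<pi> (x' + y') = \<pi> x' + \<pi> y'"
    and functional_iota: "\<pi> \<in> functionals \<Longrightarrow> \<pi> (\<iota> x * y') = x * \<pi> y'"
    and functional_e: "\<pi> \<in> functionals \<Longrightarrow> e * \<pi> y' = \<pi> y'"
    and frobenius_lift: "\<pi> \<in> functionals \<Longrightarrow> \<exists>\<pi>'\<in>functionals. \<forall>c\<in>S. \<pi>' (c ^ p) = \<pi> c ^ p"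
    and decompose: "B.lin E \<Longrightarrow> (\<And>x y. E (x * y) = x * E y + E x * y) \<Longrightarrow>
      \<exists>bs. set bs \<subseteq> S \<times> functionals \<and> (\<forall>x. E (\<iota> x) = (\<Sum>(b, \<pi>)\<leftarrow>bs. b * \<iota> (\<pi> (E (\<iota> x)))))"
    and lin_eqI: "B.lin g \<Longrightarrow> B.lin h \<Longrightarrow> (\<And>x. g (\<iota> x) = h (\<iota> x)) \<Longrightarrow> g = h"
    and extend: "A.HS n \<Phi> \<Longrightarrow> \<exists>\<Psi>. B.HS n \<Psi> \<and> (\<forall>i x. B.comp_at \<Psi> i (\<iota> x) = \<iota> (A.comp_at \<Phi> i x))"
begin

lemma iota_0: "\<iota> 0 = 0"
  using iota_add[of 0 0] by simp

lemma iota_minus: "\<iota> (- x) = - \<iota> x"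
  using iota_add[of x "- x"] by (simp add: iota_0 eq_neg_iff_add_eq_0 add.commute)

lemma iota_diff: "\<iota> (x - y) = \<iota> x - \<iota> y"
  using iota_add[of x "- y"] iota_minus[of y] by simp

lemma iota_sum: "\<iota> (sum f I) = (\<Sum>i\<in>I. \<iota> (f i))"
  by (induction I rule: infinite_finite_induct) (simp_all add: iota_0 iota_add)

lemma functional_0: "\<pi> \<in> functionals \<Longrightarrow> \<pi> 0 = 0"
  using functional_add[of \<pi> 0 0] by simp

lemma functional_minus: "\<pi> \<in> functionals \<Longrightarrow> \<pi> (- x) = - \<pi> x"
  using functional_add[of \<pi> x "- x"] by (simp add: functional_0 eq_neg_iff_add_eq_0 add.commute)

lemma functional_diff: "\<pi> \<in> functionals \<Longrightarrow> \<pi> (x - y) = \<pi> x - \<pi> y"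
  using functional_add[of \<pi> x "- y"] functional_minus[of \<pi> y] by simp

lemma functional_iota': "\<pi> \<in> functionals \<Longrightarrow> \<pi> (y' * \<iota> x) = \<pi> y' * x"
  using functional_iota[of \<pi> x y'] by (simp add: mult.commute)

lemma functional_sum_list:
  "\<pi> \<in> functionals \<Longrightarrow> \<pi> (\<Sum>(b, c)\<leftarrow>bs. b ^ n * \<iota> (f b c)) = (\<Sum>(b, c)\<leftarrow>bs. \<pi> (b ^ n) * f b c)"
  by (induction bs) (auto simp: functional_0 functional_add functional_iota')

lemma lin_functional:
  assumes "B.lin g" "\<pi> \<in> functionals"
  shows "A.lin (\<lambda>x. \<pi> (g (\<iota> x)))"
  using assms
  by (auto simp: A.lin_def iota_add iota_mult B.lin_add B.lin_C iota_C functional_add functional_iota functional_e)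

lemma extend_obstr:
  assumes "A.HS n \<Phi>"
  obtains \<Psi> where "B.HS n \<Psi>" "\<forall>x. B.comp_at \<Psi> 1 (\<iota> x) = \<iota> (A.comp_at \<Phi> 1 x)"
    "\<forall>x y. B.obstr n \<Psi> (\<iota> x) (\<iota> y) = \<iota> (A.obstr n \<Phi> x y)"
proof -
  obtain \<Psi> where \<Psi>: "B.HS n \<Psi>" "\<forall>i x. B.comp_at \<Psi> i (\<iota> x) = \<iota> (A.comp_at \<Phi> i x)"
    using extend[OF assms] by blast
  moreover have "B.obstr n \<Psi> (\<iota> x) (\<iota> y) = \<iota> (A.obstr n \<Phi> x y)" for x y
    unfolding B.obstr_comp_at A.obstr_comp_at
    by (simp only: \<Psi>(2)[rule_format] flip: iota_mult iota_sum iota_diff)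
  ultimately show thesis
    using that by blast
qed

text \<open>Only the first component of \<open>D\<close> is tied to \<open>\<Psi>\<close>:
  functionals are not multiplicative, so the higher components cannot simply be contracted.\<close>

definition descends :: "nat \<Rightarrow> bool"
  where "descends m \<longleftrightarrow> (\<forall>\<Psi> \<pi>. B.HS (Suc m) \<Psi> \<longrightarrow> \<pi> \<in> functionals \<longrightarrow>
    (\<exists>D. A.HS (Suc m) D \<and> (\<forall>x. A.comp_at D 1 x = \<pi> (B.comp_at \<Psi> 1 (\<iota> x)))))"

text \<open>The contraction of the first component of \<open>\<Psi>\<close> with
  \<open>\<pi>\<close> is integrated over the small ring by \<open>D \<pi>\<close>. Extending these
  maps, rescaling them by the \<open>b\<close> and composing gives \<open>Q\<close> with the same
  first component as \<open>\<Psi>\<close>; \<open>F\<close> is the quotient, so its first component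
  vanishes.\<close>

lemma HS_split:
  assumes "B.HS m \<Psi>" "m \<ge> 2" "descends (m - 1)"
  obtains bs D F where "set bs \<subseteq> S \<times> functionals"
    "\<forall>\<pi>\<in>functionals. A.HS m (D \<pi>) \<and> (\<forall>x. A.comp_at (D \<pi>) 1 x = \<pi> (B.comp_at \<Psi> 1 (\<iota> x)))"
    "\<forall>x. B.comp_at \<Psi> 1 (\<iota> x) = (\<Sum>(b, \<pi>)\<leftarrow>bs. b * \<iota> (A.comp_at (D \<pi>) 1 x))"
    "B.HS m F" "B.agree 2 F id"
    "\<forall>x y. B.obstr m \<Psi> (\<iota> x) (\<iota> y) =
      (\<Sum>(b, \<pi>)\<leftarrow>bs. b ^ m * \<iota> (A.obstr m (D \<pi>) x y)) + B.obstr m F (\<iota> x) (\<iota> y)"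
proof -
  note u = B.HS_unip[OF assms(1)]
  let ?E = "B.comp_at \<Psi> 1"
  have linE: "B.lin ?E"
    by (rule B.lin_comp_at[OF u]) simp
  obtain bs where bs: "set bs \<subseteq> S \<times> functionals" "\<forall>x. ?E (\<iota> x) = (\<Sum>(b, \<pi>)\<leftarrow>bs. b * \<iota> (\<pi> (?E (\<iota> x))))"
    using decompose[OF linE] B.comp_at_1_Leibniz[OF assms(1,2)] by blast
  have "\<forall>\<pi>. \<exists>D. \<pi> \<in> functionals \<longrightarrow> A.HS m D \<and> (\<forall>x. A.comp_at D 1 x = \<pi> (?E (\<iota> x)))"
    using assms by (simp add: descends_def)
  then obtain D where D: "\<And>\<pi>. \<pi> \<in> functionals \<Longrightarrow> A.HS m (D \<pi>) \<and> (\<forall>x. A.comp_at (D \<pi>) 1 x = \<pi> (?E (\<iota> x)))"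
    by metis
  have "\<forall>\<pi>. \<exists>G. \<pi> \<in> functionals \<longrightarrow> B.HS m G \<and> (\<forall>x. B.comp_at G 1 (\<iota> x) = \<iota> (A.comp_at (D \<pi>) 1 x)) \<and>
      (\<forall>x y. B.obstr m G (\<iota> x) (\<iota> y) = \<iota> (A.obstr m (D \<pi>) x y))"
    using D extend_obstr by metis
  then obtain G where G: "\<And>\<pi>. \<pi> \<in> functionals \<Longrightarrow> B.HS m (G \<pi>) \<and>
      (\<forall>x. B.comp_at (G \<pi>) 1 (\<iota> x) = \<iota> (A.comp_at (D \<pi>) 1 x)) \<and>
      (\<forall>x y. B.obstr m (G \<pi>) (\<iota> x) (\<iota> y) = \<iota> (A.obstr m (D \<pi>) x y))"
    by metis
  have "\<forall>(b, \<Phi>)\<in>set (map (\<lambda>(b, \<pi>). (b, G \<pi>)) bs). B.HS m \<Phi>"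
    using bs(1) G by auto
  then obtain Q where Q: "B.HS m Q"
      "\<forall>x. B.comp_at Q 1 x = (\<Sum>(b, \<Phi>)\<leftarrow>map (\<lambda>(b, \<pi>). (b, G \<pi>)) bs. b * B.comp_at \<Phi> 1 x)"
      "\<forall>x y. B.obstr m Q x y = (\<Sum>(b, \<Phi>)\<leftarrow>map (\<lambda>(b, \<pi>). (b, G \<pi>)) bs. b ^ m * B.obstr m \<Phi> x y)"
    by (rule B.HS_product)
  have Q1: "B.comp_at Q 1 (\<iota> x) = (\<Sum>(b, \<pi>)\<leftarrow>bs. b * \<iota> (A.comp_at (D \<pi>) 1 x))" for x
    unfolding Q(2)[rule_format] map_map
    by (intro arg_cong[where f = sum_list] map_cong) (use bs(1) G in auto)
  have Qo: "B.obstr m Q (\<iota> x) (\<iota> y) = (\<Sum>(b, \<pi>)\<leftarrow>bs. b ^ m * \<iota> (A.obstr m (D \<pi>) x y))" for x y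
    unfolding Q(3)[rule_format] map_map
    by (intro arg_cong[where f = sum_list] map_cong) (use bs(1) G in auto)
  have E: "?E (\<iota> x) = (\<Sum>(b, \<pi>)\<leftarrow>bs. b * \<iota> (A.comp_at (D \<pi>) 1 x))" for x
    by (rule trans[OF bs(2)[rule_format]], intro arg_cong[where f = sum_list] map_cong)
      (use bs(1) D in auto)
  have "?E = B.comp_at Q 1"
    by (rule lin_eqI[OF linE B.lin_comp_at[OF B.HS_unip[OF Q(1)]]]) (simp_all only: E Q1 zero_less_one)
  then have "B.agree 2 \<Psi> Q"
    using u B.HS_unip[OF Q(1)] by (auto simp: B.agree_iff_comp_at less_2_cases_iff B.comp_at_0 fun_eq_iff)
  then obtain F where F: "B.HS m F" "B.agree 2 F id" "\<And>x y. B.obstr m F x y = B.obstr m \<Psi> x y - B.obstr m Q x y"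
    using B.HS_quotient[OF assms(1) Q(1)] by metis
  have "B.obstr m \<Psi> (\<iota> x) (\<iota> y) =
      (\<Sum>(b, \<pi>)\<leftarrow>bs. b ^ m * \<iota> (A.obstr m (D \<pi>) x y)) + B.obstr m F (\<iota> x) (\<iota> y)" for x y
    by (simp add: F(3) Qo)
  then show thesis
    using that[of bs D F] bs(1) D E F(1,2) by blast
qed

text \<open>All levels \<open>u \<le> s\<close> are required of one functional, because the residual
  obstruction sinks to ever lower powers of \<open>p\<close> and the same functional is applied at
  each of them.\<close>

definition iterated_lift :: "nat \<Rightarrow> ('b \<Rightarrow> 'a) \<Rightarrow> bool"
  where "iterated_lift s \<pi> \<longleftrightarrow> \<pi> \<in> functionals \<and>
    (\<forall>u\<le>s. \<exists>\<pi>'\<in>functionals. \<forall>c\<in>S. \<pi> (c ^ (p ^ u)) = \<pi>' c ^ (p ^ u))"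

lemma S_power_power: "c \<in> S \<Longrightarrow> c ^ (p ^ u) \<in> S"
  by (induction u) (auto simp: power_mult mult.commute[of p] dest: S_power)

lemma iterated_lift_exists:
  assumes "\<pi> \<in> functionals"
  obtains \<rho> where "iterated_lift s \<rho>" "\<forall>c\<in>S. \<rho> (c ^ (p ^ s)) = \<pi> c ^ (p ^ s)"
proof -
  have "\<exists>\<rho>. iterated_lift s \<rho> \<and> (\<forall>c\<in>S. \<rho> (c ^ (p ^ s)) = \<pi> c ^ (p ^ s))"
  proof (induction s)
    case 0
    then show ?case
      using assms by (auto simp: iterated_lift_def)
  next
    case (Suc s)
    then obtain \<rho> where \<rho>: "iterated_lift s \<rho>" "\<forall>c\<in>S. \<rho> (c ^ (p ^ s)) = \<pi> c ^ (p ^ s)"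
      by blast
    obtain \<sigma> where \<sigma>: "\<sigma> \<in> functionals" "\<forall>c\<in>S. \<sigma> (c ^ p) = \<rho> c ^ p"
      using frobenius_lift[of \<rho>] \<rho>(1) by (auto simp: iterated_lift_def)
    \<comment> \<open>One more Frobenius lift shifts each relation that \<open>\<rho>\<close>
      satisfies up by one level; level \<open>0\<close> is served by \<open>\<sigma>\<close>
      itself.\<close>
    have *: "\<sigma> (c ^ (p ^ Suc u)) = \<tau> c ^ (p ^ Suc u)"
      if "c \<in> S" "\<rho> (c ^ (p ^ u)) = \<tau> c ^ (p ^ u)" for c u \<tau>
      using \<sigma>(2) S_power_power[OF that(1), of u] that(2)
      by (simp add: mult.commute[of p] power_mult)
    have "\<exists>\<pi>'\<in>functionals. \<forall>c\<in>S. \<sigma> (c ^ (p ^ u)) = \<pi>' c ^ (p ^ u)" if u: "u \<le> Suc s" for u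
    proof (cases u)
      case (Suc v)
      then obtain \<pi>' where "\<pi>' \<in> functionals" "\<forall>c\<in>S. \<rho> (c ^ (p ^ v)) = \<pi>' c ^ (p ^ v)"
        using \<rho>(1) u unfolding iterated_lift_def by (metis Suc_le_mono)
      then show ?thesis
        using * Suc by blast
    qed (use \<sigma>(1) in auto)
    then have "iterated_lift (Suc s) \<sigma>"
      using \<sigma>(1) by (simp add: iterated_lift_def)
    then show ?case
      using * \<rho>(2) by blast
  qed
  then show thesis
    using that by blast
qed

text \<open>At level \<open>0\<close> a cochain is a coboundary, and functionals preserve those. At
  level \<open>Suc t\<close>, \<open>HS_split\<close> yields a combination with
  \<open>p\<close>-power coefficients, which \<open>\<pi>\<close> turns into the obstruction of a
  product over the small ring with coefficients \<open>\<pi>' b\<close>, and a remainder of level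
  \<open>t\<close>, to which the induction applies with the same \<open>\<pi>\<close>.\<close>

lemma obstructions_descend:
  assumes "\<And>m. 0 < m \<Longrightarrow> m < p ^ t \<Longrightarrow> descends m" "f \<in> B.obstructions (p ^ t)" "iterated_lift t \<pi>"
  shows "(\<lambda>x y. \<pi> (f (\<iota> x) (\<iota> y))) \<in> A.obstructions (p ^ t)"
  using assms
proof (induction t arbitrary: f)
  case 0
  have \<pi>: "\<pi> \<in> functionals"
    using "0.prems" by (simp add: iterated_lift_def)
  obtain \<Psi> where \<Psi>: "B.HS 1 \<Psi>" "f = B.obstr 1 \<Psi>"
    using "0.prems" by (auto simp: B.obstructions_def)
  note u = B.HS_unip[OF \<Psi>(1)]
  let ?g = "\<lambda>x. \<pi> (B.comp_at \<Psi> 1 (\<iota> x))"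
  have "\<pi> (f (\<iota> x) (\<iota> y)) = x * ?g y + ?g x * y - ?g (x * y)" for x y
    unfolding \<Psi>(2) B.obstr_1[OF u] iota_mult
    by (simp only: functional_diff[OF \<pi>] functional_add[OF \<pi>] functional_iota[OF \<pi>] functional_iota'[OF \<pi>])
  then show ?case
    using A.obstructions_coboundary[OF lin_functional[OF B.lin_comp_at[OF u] \<pi>], of 1 1] by simp
next
  case (Suc t)
  let ?m = "p ^ Suc t"
  have \<pi>: "\<pi> \<in> functionals" and lift: "iterated_lift t \<pi>"
    using Suc.prems by (auto simp: iterated_lift_def)
  obtain \<Psi> where \<Psi>: "B.HS ?m \<Psi>" "f = B.obstr ?m \<Psi>"
    using Suc.prems by (auto simp: B.obstructions_def)
  have m: "?m \<ge> 2"
    using power_gt1[OF A.prime_gt_1, of t] by simp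
  have desc: "descends (?m - 1)"
    using m by (intro Suc.prems) auto
  obtain bs D F where split: "set bs \<subseteq> S \<times> functionals"
    "\<forall>\<pi>\<in>functionals. A.HS ?m (D \<pi>) \<and> (\<forall>x. A.comp_at (D \<pi>) 1 x = \<pi> (B.comp_at \<Psi> 1 (\<iota> x)))"
    "\<forall>x. B.comp_at \<Psi> 1 (\<iota> x) = (\<Sum>(b, \<pi>)\<leftarrow>bs. b * \<iota> (A.comp_at (D \<pi>) 1 x))"
    "B.HS ?m F" "B.agree 2 F id"
    "\<forall>x y. B.obstr ?m \<Psi> (\<iota> x) (\<iota> y) =
      (\<Sum>(b, \<pi>)\<leftarrow>bs. b ^ ?m * \<iota> (A.obstr ?m (D \<pi>) x y)) + B.obstr ?m F (\<iota> x) (\<iota> y)"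
    by (rule HS_split[OF \<Psi>(1) m desc])
  obtain \<pi>' where \<pi>': "\<forall>c\<in>S. \<pi> (c ^ ?m) = \<pi>' c ^ ?m"
    using Suc.prems(3) unfolding iterated_lift_def by blast
  have "\<forall>(a, \<Phi>)\<in>set (map (\<lambda>(b, c). (\<pi>' b, D c)) bs). A.HS ?m \<Phi>"
    using split(1,2) by auto
  then obtain R where R: "A.HS ?m R"
      "\<forall>x y. A.obstr ?m R x y = (\<Sum>(a, \<Phi>)\<leftarrow>map (\<lambda>(b, c). (\<pi>' b, D c)) bs. a ^ ?m * A.obstr ?m \<Phi> x y)"
    by (rule A.HS_product)
  have "A.obstr ?m R x y = (\<Sum>(b, c)\<leftarrow>bs. \<pi> (b ^ ?m) * A.obstr ?m (D c) x y)" for x y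
    unfolding R(2)[rule_format] map_map
    by (intro arg_cong[where f = sum_list] map_cong) (use split(1) \<pi>' in auto)
  then have "\<pi> (f (\<iota> x) (\<iota> y)) = A.obstr ?m R x y + \<pi> (B.obstr ?m F (\<iota> x) (\<iota> y))" for x y
    unfolding \<Psi>(2) split(6)[rule_format] functional_add[OF \<pi>] functional_sum_list[OF \<pi>] by simp
  moreover have "(\<lambda>x y. \<pi> (B.obstr ?m F (\<iota> x) (\<iota> y))) \<in> A.obstructions ?m"
  proof -
    have "descends m" if "0 < m" "m < p ^ t" for m
    proof (rule Suc.prems(1)[OF that(1)])
      show "m < ?m"
        using that(2) A.prime_gt_1 power_strict_increasing_iff[of p t "Suc t"] by linarith
    qed
    then have "(\<lambda>x y. \<pi> (B.obstr ?m F (\<iota> x) (\<iota> y))) \<in> A.obstructions (p ^ t)"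
      by (intro Suc.IH B.obstr_low_prime_power split lift)
    then show ?thesis
      using A.obstructions_power_mono[of t "Suc t"] by auto
  qed
  ultimately show ?case
    using A.obstructions_add[OF A.obstructionsI[OF R(1)]] by simp
qed

theorem descends: "m > 0 \<Longrightarrow> descends m"
proof (induction m rule: less_induct)
  case (less m)
  show ?case
    unfolding descends_def
  proof (intro allI impI)
    fix \<Psi> \<pi> assume \<Psi>: "B.HS (Suc m) \<Psi>" and \<pi>: "\<pi> \<in> functionals"
    note u = B.HS_unip[OF \<Psi>]
    let ?g = "\<lambda>x. \<pi> (B.comp_at \<Psi> 1 (\<iota> x))"
    have lin: "A.lin ?g"
      by (rule lin_functional[OF B.lin_comp_at[OF u] \<pi>]) simp
    show "\<exists>D. A.HS (Suc m) D \<and> (\<forall>x. A.comp_at D 1 x = ?g x)"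
    proof (cases "m = 1")
      case True
      have "x * ?g y + ?g x * y - ?g (x * y) = 0" for x y
        using B.comp_at_1_Leibniz[OF \<Psi>, of "\<iota> x" "\<iota> y"] True
        by (simp add: iota_mult functional_add[OF \<pi>] functional_iota[OF \<pi>] functional_iota'[OF \<pi>])
      then have "A.HS (Suc 1) (A.twist 1 ?g)"
        using A.twist(1,2)[OF _ lin, of 1] unfolding A.HS_Suc_iff[of 1] by simp
      moreover have "A.comp_at (A.twist 1 ?g) 1 x = ?g x" for x
        using A.twist(3)[OF _ lin, of 1 1 x] by simp
      ultimately show ?thesis
        using True by blast
    next
      case False
      then have m: "m \<ge> 2"
        using less.prems by simp
      have \<Psi>m: "B.HS m \<Psi>"
        by (rule B.HS_le[OF \<Psi>]) simp
      have desc: "descends (m - 1)"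
        using m by (intro less.IH) auto
      show ?thesis
      proof (cases "\<exists>s. m = p ^ s")
        case False
        \<comment> \<open>Away from powers of \<open>p\<close>, the map \<open>D\<close> obtained by
          descent at length \<open>m - 1\<close> extends over the small ring by itself.\<close>
        have "B.HS (Suc (m - 1)) \<Psi>"
          using \<Psi>m m by simp
        then obtain D where D: "A.HS m D" "\<forall>x. A.comp_at D 1 x = ?g x"
          using desc \<pi> m unfolding descends_def by fastforce
        obtain D' where "A.HS (Suc m) D'" "A.comp_at D' 1 = A.comp_at D 1"
          using A.HS_extend_not_p_power[OF less.prems _ D(1)] False by metis
        then show ?thesis
          using D(2) by metis
      next
        case True
        then obtain s' where "m = p ^ s'"
          by blast
        then obtain s where s: "m = p ^ Suc s"
          using m by (cases s') auto
        obtain bs D F where split: "set bs \<subseteq> S \<times> functionals"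
          "\<forall>\<pi>\<in>functionals. A.HS m (D \<pi>) \<and> (\<forall>x. A.comp_at (D \<pi>) 1 x = \<pi> (B.comp_at \<Psi> 1 (\<iota> x)))"
          "\<forall>x. B.comp_at \<Psi> 1 (\<iota> x) = (\<Sum>(b, \<pi>)\<leftarrow>bs. b * \<iota> (A.comp_at (D \<pi>) 1 x))"
          "B.HS m F" "B.agree 2 F id"
          "\<forall>x y. B.obstr m \<Psi> (\<iota> x) (\<iota> y) =
            (\<Sum>(b, \<pi>)\<leftarrow>bs. b ^ m * \<iota> (A.obstr m (D \<pi>) x y)) + B.obstr m F (\<iota> x) (\<iota> y)"
          by (rule HS_split[OF \<Psi>m m desc])
        \<comment> \<open>Two functionals cooperate: \<open>\<pi>\<close> supplies the coefficients
          of \<open>R\<close>, while \<open>\<rho>\<close> is applied to the vanishing obstruction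
          of \<open>\<Psi>\<close>. They meet in
          \<open>\<rho> (b ^ m) = \<pi> b ^ m\<close>.\<close>
        obtain \<rho> where \<rho>: "iterated_lift (Suc s) \<rho>" "\<forall>c\<in>S. \<rho> (c ^ m) = \<pi> c ^ m"
          using iterated_lift_exists[OF \<pi>, of "Suc s"] s by metis
        have \<rho>F: "\<rho> \<in> functionals" and lift: "iterated_lift s \<rho>"
          using \<rho>(1) by (auto simp: iterated_lift_def)
        have "\<forall>(a, \<Phi>)\<in>set (map (\<lambda>(b, c). (\<pi> b, D c)) bs). A.HS m \<Phi>"
          using split(1,2) by auto
        then obtain R where R: "A.HS m R"
            "\<forall>x. A.comp_at R 1 x = (\<Sum>(a, \<Phi>)\<leftarrow>map (\<lambda>(b, c). (\<pi> b, D c)) bs. a * A.comp_at \<Phi> 1 x)"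
            "\<forall>x y. A.obstr m R x y = (\<Sum>(a, \<Phi>)\<leftarrow>map (\<lambda>(b, c). (\<pi> b, D c)) bs. a ^ m * A.obstr m \<Phi> x y)"
          by (rule A.HS_product)
        have R1: "A.comp_at R 1 x = ?g x" for x
          using functional_sum_list[OF \<pi>, of 1 "\<lambda>b c. A.comp_at (D c) 1 x" bs]
          unfolding R(2)[rule_format] map_map split(3)[rule_format]
          by (simp add: case_prod_unfold o_def)
        have Ro: "A.obstr m R x y = (\<Sum>(b, c)\<leftarrow>bs. \<rho> (b ^ m) * A.obstr m (D c) x y)" for x y
          unfolding R(3)[rule_format] map_map
          by (intro arg_cong[where f = sum_list] map_cong) (use split(1) \<rho>(2) in auto)
        have "A.obstr m R x y = - \<rho> (B.obstr m F (\<iota> x) (\<iota> y))" for x y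
        proof -
          have "B.obstr m \<Psi> (\<iota> x) (\<iota> y) = 0"
            using \<Psi> by (simp add: B.HS_Suc_iff)
          then have "\<rho> ((\<Sum>(b, \<pi>)\<leftarrow>bs. b ^ m * \<iota> (A.obstr m (D \<pi>) x y)) + B.obstr m F (\<iota> x) (\<iota> y)) = 0"
            using split(6) functional_0[OF \<rho>F] by simp
          then show ?thesis
            unfolding functional_add[OF \<rho>F] functional_sum_list[OF \<rho>F] Ro by (simp add: eq_neg_iff_add_eq_0)
        qed
        then have "A.obstr m R = (\<lambda>x y. - \<rho> (B.obstr m F (\<iota> x) (\<iota> y)))"
          by (simp add: fun_eq_iff)
        moreover have "(\<lambda>x y. \<rho> (B.obstr m F (\<iota> x) (\<iota> y))) \<in> A.obstructions (p ^ s)"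
        proof (rule obstructions_descend[OF _ _ lift])
          show "B.obstr m F \<in> B.obstructions (p ^ s)"
            using B.obstr_low_prime_power split(4,5) s by simp
          fix l assume "0 < l" "l < p ^ s"
          moreover have "p ^ s \<le> m"
            using s A.p_pos by simp
          ultimately show "descends l"
            by (intro less.IH) auto
        qed
        ultimately have "A.obstr m R \<in> A.obstructions (p ^ s)"
          using A.obstructions_uminus by simp
        moreover have "m = p ^ s * p"
          using s by simp
        ultimately obtain R' where "A.HS (Suc m) R'" "A.comp_at R' 1 = A.comp_at R 1"
          using A.HS_extend[OF R(1) _ _ A.prime_gt_1] by metis
        then show ?thesis
          using R1 by metis
      qed
    qed
  qed
qed

end

section \<open>Tensor products\<close>

definition balanced ::
    "('k, 'x) ring_scheme \<Rightarrow> ('k, 'm, 'y) module_scheme \<Rightarrow> ('k, 'n, 'z) module_scheme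
      \<Rightarrow> ('g, 'w) monoid_scheme \<Rightarrow> ('m \<Rightarrow> 'n \<Rightarrow> 'g) \<Rightarrow> bool"
  where "balanced k M N G b \<longleftrightarrow>
    (\<forall>x\<in>carrier M. \<forall>y\<in>carrier N. b x y \<in> carrier G) \<and>
    (\<forall>x\<in>carrier M. \<forall>x'\<in>carrier M. \<forall>y\<in>carrier N. b (x \<oplus>\<^bsub>M\<^esub> x') y = b x y \<otimes>\<^bsub>G\<^esub> b x' y) \<and>
    (\<forall>x\<in>carrier M. \<forall>y\<in>carrier N. \<forall>y'\<in>carrier N. b x (y \<oplus>\<^bsub>N\<^esub> y') = b x y \<otimes>\<^bsub>G\<^esub> b x y') \<and>
    (\<forall>r\<in>carrier k. \<forall>x\<in>carrier M. \<forall>y\<in>carrier N. b (r \<odot>\<^bsub>M\<^esub> x) y = b x (r \<odot>\<^bsub>N\<^esub> y))"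

locale tensor_product =
  M: module k M + N: module k N
  for k :: "('k, 'x) ring_scheme" and M :: "('k, 'm, 'y) module_scheme" and N :: "('k, 'n, 'z) module_scheme"
begin

abbreviation "F \<equiv> free_Abelian_group (carrier M \<times> carrier N)"
abbreviation "N0 \<equiv> tensor_null k M N"
abbreviation "T \<equiv> tensor_group k M N"
abbreviation "pt \<equiv> pure_tensor k M N"

sublocale F: comm_group F
  by (rule abelian_free_Abelian_group)

lemma relators_subset: "tensor_relators k M N \<subseteq> carrier F"
  unfolding tensor_relators_def by (auto dest!: subsetD[OF keys_diff])

lemma null_subgroup: "subgroup N0 F"
  unfolding tensor_null_def by (rule F.generate_is_subgroup[OF relators_subset])

lemma null_normal: "N0 \<lhd> F"
  using F.subgroup_imp_normal[OF null_subgroup] .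

sublocale T: comm_group T
  unfolding tensor_group_def using F.abelian_FactGroup[OF null_subgroup] .

lemma coset_hom: "(\<lambda>u. N0 #>\<^bsub>F\<^esub> u) \<in> hom F T"
  unfolding tensor_group_def by (rule normal.r_coset_hom_Mod[OF null_normal])

lemma coset_closed: "u \<in> carrier F \<Longrightarrow> N0 #>\<^bsub>F\<^esub> u \<in> carrier T"
  using coset_hom by (rule hom_in_carrier)

lemma coset_add: "u \<in> carrier F \<Longrightarrow> v \<in> carrier F \<Longrightarrow> N0 #>\<^bsub>F\<^esub> (u + v) = (N0 #>\<^bsub>F\<^esub> u) \<otimes>\<^bsub>T\<^esub> (N0 #>\<^bsub>F\<^esub> v)"
  using hom_mult[OF coset_hom, of u v] by simp

lemma coset_surj: "z \<in> carrier T \<Longrightarrow> \<exists>u\<in>carrier F. z = N0 #>\<^bsub>F\<^esub> u"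
  by (auto simp: tensor_group_def carrier_FactGroup)

lemma coset_eqI: "u \<in> carrier F \<Longrightarrow> v \<in> carrier F \<Longrightarrow> u - v \<in> N0 \<Longrightarrow> N0 #>\<^bsub>F\<^esub> u = N0 #>\<^bsub>F\<^esub> v"
proof -
  assume u: "u \<in> carrier F" and v: "v \<in> carrier F" and d: "u - v \<in> N0"
  have "u \<in> N0 #>\<^bsub>F\<^esub> v"
    unfolding r_coset_def using d by (auto intro!: bexI[of _ "u - v"])
  then show ?thesis
    using F.repr_independence[OF _ v null_subgroup] by metis
qed

lemma pure_closed [simp, intro]: "x \<in> carrier M \<Longrightarrow> y \<in> carrier N \<Longrightarrow> pt x y \<in> carrier T"
  unfolding pure_tensor_def by (rule coset_closed) simp

lemma relators_in_null:
  "x \<in> carrier M \<Longrightarrow> x' \<in> carrier M \<Longrightarrow> y \<in> carrier N \<Longrightarrow>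
    frag_of (x \<oplus>\<^bsub>M\<^esub> x', y) - frag_of (x, y) - frag_of (x', y) \<in> N0"
  "x \<in> carrier M \<Longrightarrow> y \<in> carrier N \<Longrightarrow> y' \<in> carrier N \<Longrightarrow>
    frag_of (x, y \<oplus>\<^bsub>N\<^esub> y') - frag_of (x, y) - frag_of (x, y') \<in> N0"
  "r \<in> carrier k \<Longrightarrow> x \<in> carrier M \<Longrightarrow> y \<in> carrier N \<Longrightarrow>
    frag_of (r \<odot>\<^bsub>M\<^esub> x, y) - frag_of (x, r \<odot>\<^bsub>N\<^esub> y) \<in> N0"
  unfolding tensor_null_def tensor_relators_def
  by (rule generate.incl, rule UnI1, rule UnI1, rule CollectI, rule exI[of _ x], rule exI[of _ x'], rule exI[of _ y], simp)
    (rule generate.incl, rule UnI1, rule UnI2, rule CollectI, rule exI[of _ x], rule exI[of _ y], rule exI[of _ y'], simp,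
     rule generate.incl, rule UnI2, rule CollectI, rule exI[of _ r], rule exI[of _ x], rule exI[of _ y], simp)

lemma pure_add_left:
  assumes "x \<in> carrier M" "x' \<in> carrier M" "y \<in> carrier N"
  shows "pt (x \<oplus>\<^bsub>M\<^esub> x') y = pt x y \<otimes>\<^bsub>T\<^esub> pt x' y"
proof -
  have F: "frag_of (x \<oplus>\<^bsub>M\<^esub> x', y) \<in> carrier F" "frag_of (x, y) \<in> carrier F" "frag_of (x', y) \<in> carrier F"
    using assms by simp_all
  then have "frag_of (x, y) + frag_of (x', y) \<in> carrier F"
    using F.m_closed by fastforce
  moreover have "frag_of (x \<oplus>\<^bsub>M\<^esub> x', y) - (frag_of (x, y) + frag_of (x', y)) \<in> N0"
    using relators_in_null(1)[OF assms] by (simp only: diff_diff_add)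
  ultimately show ?thesis
    unfolding pure_tensor_def using F coset_add coset_eqI by metis
qed

lemma pure_add_right:
  assumes "x \<in> carrier M" "y \<in> carrier N" "y' \<in> carrier N"
  shows "pt x (y \<oplus>\<^bsub>N\<^esub> y') = pt x y \<otimes>\<^bsub>T\<^esub> pt x y'"
proof -
  have F: "frag_of (x, y \<oplus>\<^bsub>N\<^esub> y') \<in> carrier F" "frag_of (x, y) \<in> carrier F" "frag_of (x, y') \<in> carrier F"
    using assms by simp_all
  then have "frag_of (x, y) + frag_of (x, y') \<in> carrier F"
    using F.m_closed by fastforce
  moreover have "frag_of (x, y \<oplus>\<^bsub>N\<^esub> y') - (frag_of (x, y) + frag_of (x, y')) \<in> N0"
    using relators_in_null(2)[OF assms] by (simp only: diff_diff_add)
  ultimately show ?thesis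
    unfolding pure_tensor_def using F coset_add coset_eqI by metis
qed

lemma pure_smult:
  assumes "r \<in> carrier k" "x \<in> carrier M" "y \<in> carrier N"
  shows "pt (r \<odot>\<^bsub>M\<^esub> x) y = pt x (r \<odot>\<^bsub>N\<^esub> y)"
  unfolding pure_tensor_def by (rule coset_eqI[OF _ _ relators_in_null(3)[OF assms]]) (use assms in simp_all)

lemma pure_zero_left [simp]: "y \<in> carrier N \<Longrightarrow> pt \<zero>\<^bsub>M\<^esub> y = \<one>\<^bsub>T\<^esub>"
  using pure_add_left[of "\<zero>\<^bsub>M\<^esub>" "\<zero>\<^bsub>M\<^esub>" y] T.l_cancel_one'[of "pt \<zero>\<^bsub>M\<^esub> y" "pt \<zero>\<^bsub>M\<^esub> y"] by simp

lemma pure_zero_right [simp]: "x \<in> carrier M \<Longrightarrow> pt x \<zero>\<^bsub>N\<^esub> = \<one>\<^bsub>T\<^esub>"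
  using pure_add_right[of x "\<zero>\<^bsub>N\<^esub>" "\<zero>\<^bsub>N\<^esub>"] T.l_cancel_one'[of "pt x \<zero>\<^bsub>N\<^esub>" "pt x \<zero>\<^bsub>N\<^esub>"] by simp

lemma pure_minus_left: "x \<in> carrier M \<Longrightarrow> y \<in> carrier N \<Longrightarrow> pt (\<ominus>\<^bsub>M\<^esub> x) y = inv\<^bsub>T\<^esub> pt x y"
  using pure_add_left[of "\<ominus>\<^bsub>M\<^esub> x" x y] by (intro T.inv_equality[symmetric]) (auto simp: M.l_neg)

text \<open>Sums suffice because the inverse of a pure tensor is pure. The proof carries
  \<open>- u\<close> along with \<open>u\<close> since \<open>free_Abelian_group_induct\<close>
  builds elements by differences.\<close>

lemma tensor_induct [consumes 1, case_names pure add]: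
  assumes "z \<in> carrier T"
    and pure: "\<And>x y. x \<in> carrier M \<Longrightarrow> y \<in> carrier N \<Longrightarrow> P (pt x y)"
    and add: "\<And>u v. u \<in> carrier T \<Longrightarrow> v \<in> carrier T \<Longrightarrow> P u \<Longrightarrow> P v \<Longrightarrow> P (u \<otimes>\<^bsub>T\<^esub> v)"
  shows "P z"
proof -
  obtain u where u: "u \<in> carrier F" "z = N0 #>\<^bsub>F\<^esub> u"
    using coset_surj[OF assms(1)] by blast
  have one: "N0 #>\<^bsub>F\<^esub> 0 = \<one>\<^bsub>T\<^esub>"
    using hom_one[OF coset_hom] F.is_group T.is_group by simp
  have P1: "P \<one>\<^bsub>T\<^esub>"
    using pure[of "\<zero>\<^bsub>M\<^esub>" "\<zero>\<^bsub>N\<^esub>"] by simp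
  have neg_closed: "- v \<in> carrier F" if "v \<in> carrier F" for v
    using that by simp
  have "Poly_Mapping.keys u \<subseteq> carrier M \<times> carrier N"
    using u by simp
  then have "P (N0 #>\<^bsub>F\<^esub> u) \<and> P (N0 #>\<^bsub>F\<^esub> (- u))"
  proof (rule free_Abelian_group_induct)
    show "P (N0 #>\<^bsub>F\<^esub> 0) \<and> P (N0 #>\<^bsub>F\<^esub> (- 0))"
      by (simp add: one P1)
  next
    fix v w
    assume "Poly_Mapping.keys v \<subseteq> carrier M \<times> carrier N" "Poly_Mapping.keys w \<subseteq> carrier M \<times> carrier N"
      and P: "P (N0 #>\<^bsub>F\<^esub> v) \<and> P (N0 #>\<^bsub>F\<^esub> (- v))" "P (N0 #>\<^bsub>F\<^esub> w) \<and> P (N0 #>\<^bsub>F\<^esub> (- w))"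
    then have F: "v \<in> carrier F" "w \<in> carrier F" "- v \<in> carrier F" "- w \<in> carrier F"
      by simp_all
    have "P (N0 #>\<^bsub>F\<^esub> (v + - w))" "P (N0 #>\<^bsub>F\<^esub> (w + - v))"
      using P F by (simp_all only: coset_add add coset_closed)
    then show "P (N0 #>\<^bsub>F\<^esub> (v - w)) \<and> P (N0 #>\<^bsub>F\<^esub> (- (v - w)))"
      by simp
  next
    fix a assume "a \<in> carrier M \<times> carrier N"
    then obtain x y where a: "a = (x, y)" "x \<in> carrier M" "y \<in> carrier N"
      by auto
    have "frag_of (\<ominus>\<^bsub>M\<^esub> x, y) \<in> carrier F" "frag_of a \<in> carrier F"
      using a by auto
    have F: "frag_of (x, y) \<in> carrier F" "- frag_of (x, y) \<in> carrier F"
      using a by simp_all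
    have "(N0 #>\<^bsub>F\<^esub> (- frag_of (x, y))) \<otimes>\<^bsub>T\<^esub> pt x y = \<one>\<^bsub>T\<^esub>"
      unfolding pure_tensor_def coset_add[OF F(2,1), symmetric] by (simp add: one)
    then have "N0 #>\<^bsub>F\<^esub> (- frag_of (x, y)) = inv\<^bsub>T\<^esub> pt x y"
      using T.inv_equality[OF _ pure_closed[OF a(2,3)] coset_closed[OF F(2)]] by metis
    then have "N0 #>\<^bsub>F\<^esub> (- frag_of (x, y)) = pt (\<ominus>\<^bsub>M\<^esub> x) y"
      using a by (simp add: pure_minus_left)
    then show "P (N0 #>\<^bsub>F\<^esub> frag_of a) \<and> P (N0 #>\<^bsub>F\<^esub> (- frag_of a))"
      using pure[of x y] pure[of "\<ominus>\<^bsub>M\<^esub> x" y] a by (simp add: pure_tensor_def)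
  qed
  then show ?thesis
    by (simp add: u)
qed

text \<open>Universal property. The extension \<open>h\<close> to the free abelian group kills the
  relators, so it is constant on each coset; this gives the \<open>the_elem\<close> in the
  definition its value.\<close>

lemma tensor_lift:
  assumes "comm_group G" "balanced k M N G b"
  shows "tensor_lift k M N G b \<in> hom T G"
    "x \<in> carrier M \<Longrightarrow> y \<in> carrier N \<Longrightarrow> tensor_lift k M N G b (pt x y) = b x y"
proof -
  interpret G: comm_group G
    by fact
  define S where "S = carrier M \<times> carrier N"
  define h where "h u = finprod G (\<lambda>(x, y). b x y [^]\<^bsub>G\<^esub> Poly_Mapping.lookup u (x, y)) (Poly_Mapping.keys u)"
    for u :: "'m \<times> 'n \<Rightarrow>\<^sub>0 int"
  have b: "case_prod b z \<in> carrier G" if "z \<in> S" for z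
    using assms(2) that by (auto simp: S_def balanced_def)
  \<comment> \<open>Enlarging the index set allows \<open>h u\<close>, \<open>h v\<close> and
    \<open>h (u + v)\<close> to be compared over one common finite set.\<close>
  have h_eq: "h u = finprod G (\<lambda>z. case_prod b z [^]\<^bsub>G\<^esub> Poly_Mapping.lookup u z) K"
    if "finite K" "Poly_Mapping.keys u \<subseteq> K" "K \<subseteq> S" for u K
  proof -
    have "h u = finprod G (\<lambda>z. case_prod b z [^]\<^bsub>G\<^esub> Poly_Mapping.lookup u z) (Poly_Mapping.keys u)"
      unfolding h_def by (rule arg_cong2[where f = "finprod G"]) (auto simp: fun_eq_iff)
    also have "\<dots> = finprod G (\<lambda>z. case_prod b z [^]\<^bsub>G\<^esub> Poly_Mapping.lookup u z) K"
    proof (rule G.finprod_mono_neutral_cong_left)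
      have "case_prod b z \<in> carrier G" if "z \<in> K" for z
        using b \<open>K \<subseteq> S\<close> that by blast
      then show "(\<lambda>z. case_prod b z [^]\<^bsub>G\<^esub> Poly_Mapping.lookup u z) \<in> K \<rightarrow> carrier G"
        by (intro Pi_I G.int_pow_closed)
      fix z assume "z \<in> K - Poly_Mapping.keys u"
      then have "Poly_Mapping.lookup u z = 0"
        by (simp add: in_keys_iff)
      then show "case_prod b z [^]\<^bsub>G\<^esub> Poly_Mapping.lookup u z = \<one>\<^bsub>G\<^esub>"
        by (simp add: int_pow_def2)
    qed (use that in auto)
    finally show ?thesis .
  qed
  have h_closed: "h u \<in> carrier G" if "u \<in> carrier F" for u
    using that b by (subst h_eq[OF _ order_refl]) (auto simp: S_def intro!: G.finprod_closed G.int_pow_closed)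
  have h_add: "h (u + v) = h u \<otimes>\<^bsub>G\<^esub> h v" if "u \<in> carrier F" "v \<in> carrier F" for u v
  proof -
    let ?K = "Poly_Mapping.keys u \<union> Poly_Mapping.keys v"
    have K: "finite ?K" "?K \<subseteq> S"
      using that by (auto simp: S_def)
    have "h (u + v) = finprod G (\<lambda>z. case_prod b z [^]\<^bsub>G\<^esub> Poly_Mapping.lookup (u + v) z) ?K"
      using K keys_add[of u v] by (intro h_eq) auto
    also have "\<dots> = finprod G (\<lambda>z. (case_prod b z [^]\<^bsub>G\<^esub> Poly_Mapping.lookup u z) \<otimes>\<^bsub>G\<^esub>
        (case_prod b z [^]\<^bsub>G\<^esub> Poly_Mapping.lookup v z)) ?K"
      using K b by (intro G.finprod_cong') (auto simp: lookup_add G.int_pow_mult subset_iff simp del: split_paired_All)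
    also have "\<dots> = h u \<otimes>\<^bsub>G\<^esub> h v"
      using K b by (subst G.finprod_multf) (auto simp: h_eq[of ?K] subset_iff simp del: split_paired_All)
    finally show ?thesis .
  qed
  have h_hom: "h \<in> hom F G"
    using h_closed h_add by (intro homI) auto
  interpret h: group_hom F G h
    by unfold_locales (rule h_hom)
  have h_frag: "h (frag_of (x, y)) = b x y" if "x \<in> carrier M" "y \<in> carrier N" for x y
    using that b[of "(x, y)"] by (simp add: h_def S_def)
  have h_minus: "h (u - v) = h u \<otimes>\<^bsub>G\<^esub> inv\<^bsub>G\<^esub> h v" if "u \<in> carrier F" "v \<in> carrier F" for u v
  proof -
    have "h (u + - v) = h u \<otimes>\<^bsub>G\<^esub> h (- v)"
      using that by (intro h_add) auto
    then show ?thesis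
      using h.hom_inv[of v] that by simp
  qed
  have "h u = \<one>\<^bsub>G\<^esub>" if "u \<in> tensor_relators k M N" for u
  proof -
    have closed: "b x y \<in> carrier G" if "x \<in> carrier M" "y \<in> carrier N" for x y
      using assms(2) that by (auto simp: balanced_def)
    have diff_F: "frag_of z - frag_of z' \<in> carrier F" if "z \<in> S" "z' \<in> S" for z z'
      using keys_diff[of "frag_of z" "frag_of z'"] that by (auto simp: S_def)
    have tri: "h (frag_of z - frag_of z' - frag_of z'') = h (frag_of z) \<otimes>\<^bsub>G\<^esub> inv\<^bsub>G\<^esub> h (frag_of z') \<otimes>\<^bsub>G\<^esub> inv\<^bsub>G\<^esub> h (frag_of z'')"
      if "z \<in> S" "z' \<in> S" "z'' \<in> S" for z z' z''
      using that diff_F by (subst h_minus; (subst h_minus)?) (auto simp: S_def)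
    have canc: "g \<otimes>\<^bsub>G\<^esub> g' \<otimes>\<^bsub>G\<^esub> inv\<^bsub>G\<^esub> g \<otimes>\<^bsub>G\<^esub> inv\<^bsub>G\<^esub> g' = \<one>\<^bsub>G\<^esub>" if "g \<in> carrier G" "g' \<in> carrier G" for g g'
      using that by (metis G.inv_closed G.m_assoc G.m_comm G.m_closed G.r_inv G.r_one)
    from that consider
      (1) x x' y where "u = frag_of (x \<oplus>\<^bsub>M\<^esub> x', y) - frag_of (x, y) - frag_of (x', y)"
        "x \<in> carrier M" "x' \<in> carrier M" "y \<in> carrier N"
      | (2) x y y' where "u = frag_of (x, y \<oplus>\<^bsub>N\<^esub> y') - frag_of (x, y) - frag_of (x, y')"
        "x \<in> carrier M" "y \<in> carrier N" "y' \<in> carrier N"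
      | (3) r x y where "u = frag_of (r \<odot>\<^bsub>M\<^esub> x, y) - frag_of (x, r \<odot>\<^bsub>N\<^esub> y)"
        "r \<in> carrier k" "x \<in> carrier M" "y \<in> carrier N"
      unfolding tensor_relators_def by blast
    then show ?thesis
    proof cases
      case 1
      then have "b (x \<oplus>\<^bsub>M\<^esub> x') y = b x y \<otimes>\<^bsub>G\<^esub> b x' y"
        using assms(2) by (simp add: balanced_def)
      then show ?thesis
        using 1 by (simp add: tri S_def h_frag canc closed)
    next
      case 2
      then have "b x (y \<oplus>\<^bsub>N\<^esub> y') = b x y \<otimes>\<^bsub>G\<^esub> b x y'"
        using assms(2) by (simp add: balanced_def)
      then show ?thesis
        using 2 by (simp add: tri S_def h_frag canc closed)
    next
      case 3
      then have "b (r \<odot>\<^bsub>M\<^esub> x) y = b x (r \<odot>\<^bsub>N\<^esub> y)"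
        using assms(2) by (simp add: balanced_def)
      then show ?thesis
        using 3 by (simp add: h_minus h_frag closed)
    qed
  qed
  then have "tensor_relators k M N \<subseteq> kernel F G h"
    using relators_subset unfolding kernel_def by blast
  then have "N0 \<subseteq> kernel F G h"
    unfolding tensor_null_def by (rule F.generate_subgroup_incl[OF _ h.subgroup_kernel])
  then have null: "h v = \<one>\<^bsub>G\<^esub>" if "v \<in> N0" for v
    using that by (auto simp: kernel_def)
  have coset: "h ` (N0 #>\<^bsub>F\<^esub> u) = {h u}" if "u \<in> carrier F" for u
  proof -
    have "h (v + u) = h u" if "v \<in> N0" for v
      using h_add[of v u] that \<open>u \<in> carrier F\<close> null h_closed subgroup.subset[OF null_subgroup] by auto
    moreover have "0 \<in> N0"
      using subgroup.one_closed[OF null_subgroup] by simp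
    ultimately show ?thesis
      by (force simp: r_coset_def)
  qed
  have lift: "tensor_lift k M N G b (N0 #>\<^bsub>F\<^esub> u) = h u" if "u \<in> carrier F" for u
    using coset[OF that] coset_closed[OF that] unfolding tensor_lift_def h_def[abs_def] by simp
  show "tensor_lift k M N G b \<in> hom T G"
  proof (rule homI)
    fix z assume "z \<in> carrier T"
    then show "tensor_lift k M N G b z \<in> carrier G"
      using coset_surj lift h_closed by metis
  next
    fix z w assume "z \<in> carrier T" "w \<in> carrier T"
    then obtain u v where uv: "u \<in> carrier F" "z = N0 #>\<^bsub>F\<^esub> u" "v \<in> carrier F" "w = N0 #>\<^bsub>F\<^esub> v"
      using coset_surj by metis
    moreover have "u + v \<in> carrier F"
      using F.m_closed[OF uv(1,3)] by simp
    ultimately show "tensor_lift k M N G b (z \<otimes>\<^bsub>T\<^esub> w) = tensor_lift k M N G b z \<otimes>\<^bsub>G\<^esub> tensor_lift k M N G b w"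
      using lift h_add coset_add by metis
  qed
  show "x \<in> carrier M \<Longrightarrow> y \<in> carrier N \<Longrightarrow> tensor_lift k M N G b (pt x y) = b x y"
    unfolding pure_tensor_def by (subst lift) (simp_all add: h_frag)
qed

lemma tensor_lift_extensional: "tensor_lift k M N G b \<in> extensional (carrier T)"
  by (simp add: tensor_lift_def)

end

lemma balancedI:
  assumes "\<And>x y. x \<in> carrier M \<Longrightarrow> y \<in> carrier N \<Longrightarrow> b x y \<in> carrier G"
    and "\<And>x x' y. x \<in> carrier M \<Longrightarrow> x' \<in> carrier M \<Longrightarrow> y \<in> carrier N \<Longrightarrow>
      b (x \<oplus>\<^bsub>M\<^esub> x') y = b x y \<otimes>\<^bsub>G\<^esub> b x' y"
    and "\<And>x y y'. x \<in> carrier M \<Longrightarrow> y \<in> carrier N \<Longrightarrow> y' \<in> carrier N \<Longrightarrow>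
      b x (y \<oplus>\<^bsub>N\<^esub> y') = b x y \<otimes>\<^bsub>G\<^esub> b x y'"
    and "\<And>r x y. r \<in> carrier k \<Longrightarrow> x \<in> carrier M \<Longrightarrow> y \<in> carrier N \<Longrightarrow>
      b (r \<odot>\<^bsub>M\<^esub> x) y = b x (r \<odot>\<^bsub>N\<^esub> y)"
  shows "balanced k M N G b"
  using assms unfolding balanced_def by simp

text \<open>Covers both the multiplication of \<open>L \<otimes> A\<close> and its action on
  \<open>L \<otimes> M\<close>. The action is a bare map because in the second case \<open>M\<close>
  enters only as a module over \<open>k\<close>, by restriction of scalars.\<close>

locale tensor_action =
  L: algebra k L + A: algebra k A + M: module k M
  for k :: "('k, 'x) ring_scheme" and L :: "('k, 'l, 'y) module_scheme" and A :: "('k, 'a, 'z) module_scheme"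
    and M :: "('k, 'm, 'w) module_scheme" +
  fixes act :: "'a \<Rightarrow> 'm \<Rightarrow> 'm"
  assumes act_closed: "a \<in> carrier A \<Longrightarrow> x \<in> carrier M \<Longrightarrow> act a x \<in> carrier M"
    and act_add_left: "a \<in> carrier A \<Longrightarrow> a' \<in> carrier A \<Longrightarrow> x \<in> carrier M \<Longrightarrow>
      act (a \<oplus>\<^bsub>A\<^esub> a') x = act a x \<oplus>\<^bsub>M\<^esub> act a' x"
    and act_add_right: "a \<in> carrier A \<Longrightarrow> x \<in> carrier M \<Longrightarrow> x' \<in> carrier M \<Longrightarrow>
      act a (x \<oplus>\<^bsub>M\<^esub> x') = act a x \<oplus>\<^bsub>M\<^esub> act a x'"
    and act_smult_left: "r \<in> carrier k \<Longrightarrow> a \<in> carrier A \<Longrightarrow> x \<in> carrier M \<Longrightarrow>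
      act (r \<odot>\<^bsub>A\<^esub> a) x = r \<odot>\<^bsub>M\<^esub> act a x"
    and act_smult_right: "r \<in> carrier k \<Longrightarrow> a \<in> carrier A \<Longrightarrow> x \<in> carrier M \<Longrightarrow>
      act a (r \<odot>\<^bsub>M\<^esub> x) = r \<odot>\<^bsub>M\<^esub> act a x"
begin

sublocale LA: tensor_product k L A
  by unfold_locales

sublocale LM: tensor_product k L M
  by unfold_locales

definition inner :: "'l \<Rightarrow> 'a \<Rightarrow> ('l \<times> 'm \<Rightarrow>\<^sub>0 int) set \<Rightarrow> ('l \<times> 'm \<Rightarrow>\<^sub>0 int) set"
  where "inner c a = tensor_lift k L M (tensor_group k L M) (\<lambda>d x. pure_tensor k L M (c \<otimes>\<^bsub>L\<^esub> d) (act a x))"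

definition tensor_act :: "('l \<times> 'a \<Rightarrow>\<^sub>0 int) set \<Rightarrow> ('l \<times> 'm \<Rightarrow>\<^sub>0 int) set \<Rightarrow> ('l \<times> 'm \<Rightarrow>\<^sub>0 int) set"
  where "tensor_act U V = tensor_lift k L A (tensor_group k L M) (\<lambda>c a. inner c a V) U"

lemma L_smult_left: "r \<in> carrier k \<Longrightarrow> c \<in> carrier L \<Longrightarrow> d \<in> carrier L \<Longrightarrow>
    c \<otimes>\<^bsub>L\<^esub> (r \<odot>\<^bsub>L\<^esub> d) = r \<odot>\<^bsub>L\<^esub> (c \<otimes>\<^bsub>L\<^esub> d)"
  using L.smult_assoc2[of r d c] by (simp add: L.m_comm)

lemma inner_balanced:
  assumes "c \<in> carrier L" "a \<in> carrier A"
  shows "balanced k L M LM.T (\<lambda>d x. LM.pt (c \<otimes>\<^bsub>L\<^esub> d) (act a x))"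
proof (rule balancedI)
  fix r d x assume "r \<in> carrier k" "d \<in> carrier L" "x \<in> carrier M"
  then show "LM.pt (c \<otimes>\<^bsub>L\<^esub> (r \<odot>\<^bsub>L\<^esub> d)) (act a x) = LM.pt (c \<otimes>\<^bsub>L\<^esub> d) (act a (r \<odot>\<^bsub>M\<^esub> x))"
    using assms by (simp add: L_smult_left act_smult_right LM.pure_smult act_closed)
qed (use assms in \<open>auto simp: act_closed act_add_right L.r_distr LM.pure_add_left LM.pure_add_right\<close>)

lemmas inner_hom = LM.tensor_lift(1)[OF LM.T.comm_group_axioms inner_balanced, folded inner_def]
  and inner_pure = LM.tensor_lift(2)[OF LM.T.comm_group_axioms inner_balanced, folded inner_def]

lemma inner_closed: "c \<in> carrier L \<Longrightarrow> a \<in> carrier A \<Longrightarrow> V \<in> carrier LM.T \<Longrightarrow> inner c a V \<in> carrier LM.T"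
  using inner_hom by (rule hom_in_carrier)

lemma inner_mult: "c \<in> carrier L \<Longrightarrow> a \<in> carrier A \<Longrightarrow> V \<in> carrier LM.T \<Longrightarrow> W \<in> carrier LM.T \<Longrightarrow>
    inner c a (V \<otimes>\<^bsub>LM.T\<^esub> W) = inner c a V \<otimes>\<^bsub>LM.T\<^esub> inner c a W"
  using inner_hom by (rule hom_mult)

lemma tensor_act_balanced:
  assumes V: "V \<in> carrier LM.T"
  shows "balanced k L A LM.T (\<lambda>c a. inner c a V)"
proof (rule balancedI)
  fix c c' a assume c: "c \<in> carrier L" "c' \<in> carrier L" "a \<in> carrier A"
  from V show "inner (c \<oplus>\<^bsub>L\<^esub> c') a V = inner c a V \<otimes>\<^bsub>LM.T\<^esub> inner c' a V"
  proof (induction rule: LM.tensor_induct)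
    case (pure d x)
    then show ?case
      using c by (simp add: inner_pure L.l_distr LM.pure_add_left act_closed)
  next
    case (add u v)
    then show ?case
      using c by (simp add: inner_mult inner_closed LM.T.m_ac)
  qed
next
  fix c a a' assume c: "c \<in> carrier L" "a \<in> carrier A" "a' \<in> carrier A"
  from V show "inner c (a \<oplus>\<^bsub>A\<^esub> a') V = inner c a V \<otimes>\<^bsub>LM.T\<^esub> inner c a' V"
  proof (induction rule: LM.tensor_induct)
    case (pure d x)
    then show ?case
      using c by (simp add: inner_pure act_add_left LM.pure_add_right act_closed)
  next
    case (add u v)
    then show ?case
      using c by (simp add: inner_mult inner_closed LM.T.m_ac)
  qed
next
  fix r c a assume c: "r \<in> carrier k" "c \<in> carrier L" "a \<in> carrier A"
  from V show "inner (r \<odot>\<^bsub>L\<^esub> c) a V = inner c (r \<odot>\<^bsub>A\<^esub> a) V"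
  proof (induction rule: LM.tensor_induct)
    case (pure d x)
    then show ?case
      using c by (simp add: inner_pure act_smult_left L.smult_assoc2 LM.pure_smult act_closed)
  next
    case (add u v)
    then show ?case
      using c by (simp add: inner_mult inner_closed)
  qed
qed (use V inner_closed in auto)

lemmas tensor_act_hom_left = LA.tensor_lift(1)[OF LM.T.comm_group_axioms tensor_act_balanced, folded tensor_act_def]

lemma tensor_act_pure_left:
  "V \<in> carrier LM.T \<Longrightarrow> c \<in> carrier L \<Longrightarrow> a \<in> carrier A \<Longrightarrow> tensor_act (LA.pt c a) V = inner c a V"
  unfolding tensor_act_def using LA.tensor_lift(2)[OF LM.T.comm_group_axioms tensor_act_balanced] by blast

lemma tensor_act_pure:
  "c \<in> carrier L \<Longrightarrow> a \<in> carrier A \<Longrightarrow> d \<in> carrier L \<Longrightarrow> x \<in> carrier M \<Longrightarrow>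
    tensor_act (LA.pt c a) (LM.pt d x) = LM.pt (c \<otimes>\<^bsub>L\<^esub> d) (act a x)"
  by (simp add: tensor_act_pure_left inner_pure)

lemma tensor_act_closed:
  "U \<in> carrier LA.T \<Longrightarrow> V \<in> carrier LM.T \<Longrightarrow> tensor_act U V \<in> carrier LM.T"
  using hom_in_carrier[OF tensor_act_hom_left[of V]] unfolding tensor_act_def by blast

lemma tensor_act_add_left:
  "U \<in> carrier LA.T \<Longrightarrow> U' \<in> carrier LA.T \<Longrightarrow> V \<in> carrier LM.T \<Longrightarrow>
    tensor_act (U \<otimes>\<^bsub>LA.T\<^esub> U') V = tensor_act U V \<otimes>\<^bsub>LM.T\<^esub> tensor_act U' V"
  using hom_mult[OF tensor_act_hom_left[of V]] unfolding tensor_act_def by blast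

lemma tensor_act_add_right:
  assumes "U \<in> carrier LA.T" "V \<in> carrier LM.T" "W \<in> carrier LM.T"
  shows "tensor_act U (V \<otimes>\<^bsub>LM.T\<^esub> W) = tensor_act U V \<otimes>\<^bsub>LM.T\<^esub> tensor_act U W"
  using assms(1)
proof (induction rule: LA.tensor_induct)
  case (pure c a)
  then show ?case
    using assms by (simp add: tensor_act_pure_left inner_mult)
next
  case (add u v)
  then show ?case
    using assms by (simp add: tensor_act_add_left tensor_act_closed LM.T.m_ac)
qed

end

section \<open>The algebra structure on L \<otimes> A\<close>

locale base_change_algebra =
  L: algebra k L + A: algebra k A
  for k :: "('k, 'x) ring_scheme" and L :: "('k, 'l, 'y) module_scheme" and A :: "('k, 'a, 'z) module_scheme"
begin

abbreviation "B \<equiv> base_change k L A"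

sublocale T: tensor_product k L A
  by unfold_locales

sublocale act: tensor_action k L A A "\<lambda>a b. a \<otimes>\<^bsub>A\<^esub> b"
proof unfold_locales
  fix r a x assume "r \<in> carrier k" "a \<in> carrier A" "x \<in> carrier A"
  then show "a \<otimes>\<^bsub>A\<^esub> (r \<odot>\<^bsub>A\<^esub> x) = r \<odot>\<^bsub>A\<^esub> (a \<otimes>\<^bsub>A\<^esub> x)"
    using A.smult_assoc2[of r x a] by (simp add: A.m_comm)
qed (auto simp: A.l_distr A.r_distr A.smult_assoc2)

lemma B_simps:
  "carrier B = carrier T.T" "\<one>\<^bsub>B\<^esub> = T.pt \<one>\<^bsub>L\<^esub> \<one>\<^bsub>A\<^esub>" "\<zero>\<^bsub>B\<^esub> = \<one>\<^bsub>T.T\<^esub>"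
  "U \<oplus>\<^bsub>B\<^esub> V = U \<otimes>\<^bsub>T.T\<^esub> V" "U \<otimes>\<^bsub>B\<^esub> V = act.tensor_act U V"
  "c \<odot>\<^bsub>B\<^esub> V = tensor_lift k L A T.T (\<lambda>d a. T.pt (c \<otimes>\<^bsub>L\<^esub> d) a) V"
  by (simp_all add: base_change_def Let_def act.tensor_act_def act.inner_def)

lemma smult_balanced:
  assumes "c \<in> carrier L"
  shows "balanced k L A T.T (\<lambda>d a. T.pt (c \<otimes>\<^bsub>L\<^esub> d) a)"
  by (rule balancedI)
    (use assms in \<open>auto simp: L.r_distr T.pure_add_left T.pure_add_right act.L_smult_left T.pure_smult\<close>)

lemma smult_hom: "c \<in> carrier L \<Longrightarrow> (\<lambda>V. c \<odot>\<^bsub>B\<^esub> V) \<in> hom T.T T.T"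
  unfolding B_simps using T.tensor_lift(1)[OF T.T.comm_group_axioms smult_balanced] .

lemma smult_pure: "c \<in> carrier L \<Longrightarrow> d \<in> carrier L \<Longrightarrow> a \<in> carrier A \<Longrightarrow> c \<odot>\<^bsub>B\<^esub> T.pt d a = T.pt (c \<otimes>\<^bsub>L\<^esub> d) a"
  unfolding B_simps using T.tensor_lift(2)[OF T.T.comm_group_axioms smult_balanced] .

lemma smult_closed: "c \<in> carrier L \<Longrightarrow> V \<in> carrier T.T \<Longrightarrow> c \<odot>\<^bsub>B\<^esub> V \<in> carrier T.T"
  using hom_in_carrier[OF smult_hom] .

lemma smult_add: "c \<in> carrier L \<Longrightarrow> U \<in> carrier T.T \<Longrightarrow> V \<in> carrier T.T \<Longrightarrow>
    c \<odot>\<^bsub>B\<^esub> (U \<otimes>\<^bsub>T.T\<^esub> V) = (c \<odot>\<^bsub>B\<^esub> U) \<otimes>\<^bsub>T.T\<^esub> (c \<odot>\<^bsub>B\<^esub> V)"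
  using hom_mult[OF smult_hom] .

lemma mult_pure: "c \<in> carrier L \<Longrightarrow> a \<in> carrier A \<Longrightarrow> d \<in> carrier L \<Longrightarrow> b \<in> carrier A \<Longrightarrow>
    T.pt c a \<otimes>\<^bsub>B\<^esub> T.pt d b = T.pt (c \<otimes>\<^bsub>L\<^esub> d) (a \<otimes>\<^bsub>A\<^esub> b)"
  unfolding B_simps by (rule act.tensor_act_pure)

lemma mult_closed: "U \<in> carrier T.T \<Longrightarrow> V \<in> carrier T.T \<Longrightarrow> U \<otimes>\<^bsub>B\<^esub> V \<in> carrier T.T"
  unfolding B_simps by (rule act.tensor_act_closed)

lemma mult_add_left: "U \<in> carrier T.T \<Longrightarrow> U' \<in> carrier T.T \<Longrightarrow> V \<in> carrier T.T \<Longrightarrow>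
    (U \<otimes>\<^bsub>T.T\<^esub> U') \<otimes>\<^bsub>B\<^esub> V = (U \<otimes>\<^bsub>B\<^esub> V) \<otimes>\<^bsub>T.T\<^esub> (U' \<otimes>\<^bsub>B\<^esub> V)"
  unfolding B_simps by (rule act.tensor_act_add_left)

lemma mult_add_right: "U \<in> carrier T.T \<Longrightarrow> V \<in> carrier T.T \<Longrightarrow> W \<in> carrier T.T \<Longrightarrow>
    U \<otimes>\<^bsub>B\<^esub> (V \<otimes>\<^bsub>T.T\<^esub> W) = (U \<otimes>\<^bsub>B\<^esub> V) \<otimes>\<^bsub>T.T\<^esub> (U \<otimes>\<^bsub>B\<^esub> W)"
  unfolding B_simps by (rule act.tensor_act_add_right)

lemma mult_comm:
  assumes "U \<in> carrier T.T" "V \<in> carrier T.T"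
  shows "U \<otimes>\<^bsub>B\<^esub> V = V \<otimes>\<^bsub>B\<^esub> U"
  using assms(1)
proof (induction rule: T.tensor_induct)
  case (pure c a)
  from assms(2) show ?case
  proof (induction rule: T.tensor_induct)
    case (pure d b)
    then show ?case
      using \<open>c \<in> carrier L\<close> \<open>a \<in> carrier A\<close> by (simp add: mult_pure L.m_comm A.m_comm)
  qed (simp add: mult_add_left mult_add_right pure T.pure_closed)
qed (simp add: mult_add_left mult_add_right assms)

lemma mult_assoc:
  assumes "U \<in> carrier T.T" "V \<in> carrier T.T" "W \<in> carrier T.T"
  shows "(U \<otimes>\<^bsub>B\<^esub> V) \<otimes>\<^bsub>B\<^esub> W = U \<otimes>\<^bsub>B\<^esub> (V \<otimes>\<^bsub>B\<^esub> W)"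
  using assms(1)
proof (induction rule: T.tensor_induct)
  case ca: (pure c a)
  from assms(2) show ?case
  proof (induction rule: T.tensor_induct)
    case db: (pure d b)
    from assms(3) show ?case
    proof (induction rule: T.tensor_induct)
      case (pure f g)
      then show ?case
        using ca db by (simp add: mult_pure L.m_assoc A.m_assoc)
    qed (simp add: mult_add_right mult_closed ca db T.pure_closed)
  qed (simp add: mult_add_left mult_add_right mult_closed assms ca T.pure_closed)
qed (simp add: mult_add_left mult_closed assms)

lemma mult_one: "U \<in> carrier T.T \<Longrightarrow> T.pt \<one>\<^bsub>L\<^esub> \<one>\<^bsub>A\<^esub> \<otimes>\<^bsub>B\<^esub> U = U"
  by (induction rule: T.tensor_induct) (simp_all add: mult_pure mult_add_right T.pure_closed)

lemma abelian_group_B: "abelian_group B"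
proof (rule abelian_groupI)
  fix x assume "x \<in> carrier B"
  then show "\<exists>y\<in>carrier B. y \<oplus>\<^bsub>B\<^esub> x = \<zero>\<^bsub>B\<^esub>"
    by (auto simp: B_simps intro!: bexI[of _ "inv\<^bsub>T.T\<^esub> x"])
qed (auto simp: B_simps T.T.m_ac)

lemma cring_B: "cring B"
proof (rule cringI[OF abelian_group_B])
  show "comm_monoid B"
    by (rule comm_monoidI)
      (use mult_closed mult_assoc mult_comm mult_one T.pure_closed in \<open>simp_all add: B_simps(1,2)\<close>)
qed (simp add: B_simps(1,4) mult_add_left)

lemma algebra_B: "algebra L B"
proof (rule algebraI)
  show "cring L" "cring B"
    by (rule L.is_cring cring_B)+
next
  fix c d U assume c: "c \<in> carrier L" "d \<in> carrier L" and "U \<in> carrier B"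
  from this(3) show "(c \<oplus>\<^bsub>L\<^esub> d) \<odot>\<^bsub>B\<^esub> U = (c \<odot>\<^bsub>B\<^esub> U) \<oplus>\<^bsub>B\<^esub> (d \<odot>\<^bsub>B\<^esub> U)"
    unfolding B_simps(1,4)
    by (induction rule: T.tensor_induct)
      (use c in \<open>simp_all add: smult_pure smult_add smult_closed L.l_distr T.pure_add_left T.T.m_ac\<close>)
next
  fix c d U assume c: "c \<in> carrier L" "d \<in> carrier L" and "U \<in> carrier B"
  from this(3) show "(c \<otimes>\<^bsub>L\<^esub> d) \<odot>\<^bsub>B\<^esub> U = c \<odot>\<^bsub>B\<^esub> (d \<odot>\<^bsub>B\<^esub> U)"
    unfolding B_simps(1)
    by (induction rule: T.tensor_induct)
      (use c in \<open>simp_all add: smult_pure smult_add smult_closed L.m_assoc\<close>)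
next
  fix U assume "U \<in> carrier B"
  then show "\<one>\<^bsub>L\<^esub> \<odot>\<^bsub>B\<^esub> U = U"
    unfolding B_simps(1) by (induction rule: T.tensor_induct) (simp_all add: smult_pure smult_add)
next
  fix c U V assume c: "c \<in> carrier L" and U: "U \<in> carrier B" and V: "V \<in> carrier B"
  from U show "(c \<odot>\<^bsub>B\<^esub> U) \<otimes>\<^bsub>B\<^esub> V = c \<odot>\<^bsub>B\<^esub> (U \<otimes>\<^bsub>B\<^esub> V)"
    unfolding B_simps(1)
  proof (induction rule: T.tensor_induct)
    case (pure d a)
    from V show ?case
      unfolding B_simps(1)
      by (induction rule: T.tensor_induct)
        (simp_all add: c pure smult_pure smult_add mult_pure mult_add_right L.m_assoc T.pure_closed mult_closed)
  next
    case (add u v)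
    then show ?case
      using V c by (simp add: B_simps(1) smult_add mult_add_left mult_closed smult_closed)
  qed
qed (simp_all add: B_simps(1,4) smult_closed smult_add)

end

section \<open>Rings on a carrier as factors of a type class ring\<close>

text \<open>The product of \<^emph>\<open>all\<close> commutative rings carried by subsets of \<^typ>\<open>'a\<close>, with a factor \<^typ>\<open>int\<close> that
  makes it nonzero. Every commutative ring \<open>R\<close> on \<^typ>\<open>'a\<close> is a direct factor of this type, so that
  statements about \<open>R\<close> can be proved with type class algebra.\<close>

typedef 'a ring_product =
  "{(f :: 'a ring \<Rightarrow> 'a, n :: int). \<forall>R. f R \<in> (if cring R then carrier R else {undefined})}"
  by (rule exI[of _ "(\<lambda>R. if cring R then \<zero>\<^bsub>R\<^esub> else undefined, 0)"])
    (auto simp: cring.cring_simprules)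

definition slot :: "'a ring \<Rightarrow> 'a ring_product \<Rightarrow> 'a"
  where "slot R f = fst (Rep_ring_product f) R"

definition int_slot :: "'a ring_product \<Rightarrow> int"
  where "int_slot f = snd (Rep_ring_product f)"

definition tuple :: "('a ring \<Rightarrow> 'a) \<Rightarrow> int \<Rightarrow> 'a ring_product"
  where "tuple F n = Abs_ring_product (\<lambda>R. if cring R then F R else undefined, n)"

lemma slot_closed: "cring R \<Longrightarrow> slot R f \<in> carrier R"
  using Rep_ring_product[of f] by (auto simp: slot_def split: prod.splits dest: spec[of _ R])

lemma tuple:
  assumes "\<And>R. cring R \<Longrightarrow> F R \<in> carrier R"
  shows "cring R \<Longrightarrow> slot R (tuple F n) = F R" "int_slot (tuple F n) = n"
proof -
  have "Rep_ring_product (tuple F n) = (\<lambda>R. if cring R then F R else undefined, n)"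
    unfolding tuple_def by (rule Abs_ring_product_inverse) (use assms in auto)
  then show "cring R \<Longrightarrow> slot R (tuple F n) = F R" "int_slot (tuple F n) = n"
    by (simp_all add: slot_def int_slot_def)
qed

lemma ring_product_eqI:
  fixes f g :: "'a ring_product"
  assumes "\<And>R. cring R \<Longrightarrow> slot R f = slot R g" "int_slot f = int_slot g"
  shows "f = g"
proof -
  have "slot R h = undefined" if "\<not> cring R" for R and h :: "'a ring_product"
    using Rep_ring_product[of h] that by (auto simp: slot_def split: prod.splits dest: spec[of _ R])
  then have "slot R f = slot R g" for R
    using assms(1) by (cases "cring R") auto
  then have "fst (Rep_ring_product f) = fst (Rep_ring_product g)"
    by (auto simp: slot_def fun_eq_iff)
  moreover have "snd (Rep_ring_product f) = snd (Rep_ring_product g)"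
    using assms(2) by (simp add: int_slot_def)
  ultimately show ?thesis
    by (metis Rep_ring_product_inject prod_eqI)
qed

instantiation ring_product :: (type) comm_ring_1
begin

definition "0 = tuple (\<lambda>R. \<zero>\<^bsub>R\<^esub>) 0"
definition "1 = tuple (\<lambda>R. \<one>\<^bsub>R\<^esub>) 1"
definition "f + g = tuple (\<lambda>R. slot R f \<oplus>\<^bsub>R\<^esub> slot R g) (int_slot f + int_slot g)"
definition "f * g = tuple (\<lambda>R. slot R f \<otimes>\<^bsub>R\<^esub> slot R g) (int_slot f * int_slot g)"
definition "- f = tuple (\<lambda>R. \<ominus>\<^bsub>R\<^esub> slot R f) (- int_slot f)"
definition "f - g = f + - (g :: 'a ring_product)"

lemma ring_product_slots:
  assumes "cring R"
  shows "slot R 0 = \<zero>\<^bsub>R\<^esub>" "slot R 1 = \<one>\<^bsub>R\<^esub>" "slot R (f + g) = slot R f \<oplus>\<^bsub>R\<^esub> slot R g"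
    "slot R (f * g) = slot R f \<otimes>\<^bsub>R\<^esub> slot R g" "slot R (- f) = \<ominus>\<^bsub>R\<^esub> slot R f"
  unfolding zero_ring_product_def one_ring_product_def plus_ring_product_def times_ring_product_def
    uminus_ring_product_def
  by (rule tuple(1)[OF _ assms], simp add: cring.cring_simprules slot_closed)+

lemma ring_product_int_slots:
  "int_slot 0 = 0" "int_slot 1 = 1" "int_slot (f + g) = int_slot f + int_slot g"
  "int_slot (f * g) = int_slot f * int_slot g" "int_slot (- f) = - int_slot f"
  unfolding zero_ring_product_def one_ring_product_def plus_ring_product_def times_ring_product_def
    uminus_ring_product_def
  by (rule tuple(2), simp add: cring.cring_simprules slot_closed)+

instance
proof
  show "(0 :: 'a ring_product) \<noteq> 1"
    using ring_product_int_slots(1,2) by (metis zero_neq_one)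
qed (rule ring_product_eqI; simp add: ring_product_slots ring_product_int_slots
    minus_ring_product_def cring.cring_simprules slot_closed algebra_simps)+

end

text \<open>Forgets the record extension, so that a ring or algebra of any scheme becomes an index
  of the product.\<close>

definition proper_ring :: "('a, 'x) ring_scheme \<Rightarrow> 'a ring"
  where "proper_ring A = \<lparr>carrier = carrier A, monoid.mult = monoid.mult A, monoid.one = \<one>\<^bsub>A\<^esub>,
    ring.zero = \<zero>\<^bsub>A\<^esub>, ring.add = ring.add A\<rparr>"

definition proj :: "('a, 'x) ring_scheme \<Rightarrow> 'a ring_product \<Rightarrow> 'a"
  where "proj A = slot (proper_ring A)"

text \<open>The inclusion of a direct factor. It respects sums and products, but sends the unit to
  an idempotent, which serves as the \<open>e\<close> of
  \<open>hasse_schmidt_setting\<close>.\<close>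

definition emb :: "('a, 'x) ring_scheme \<Rightarrow> 'a \<Rightarrow> 'a ring_product"
  where "emb A x = tuple (\<lambda>R. if R = proper_ring A then x else \<zero>\<^bsub>R\<^esub>) 0"

context cring
begin

lemma cring_proper_ring: "cring (proper_ring R)"
proof (rule cringI)
  show "abelian_group (proper_ring R)"
  proof (rule abelian_groupI)
    fix x assume "x \<in> carrier (proper_ring R)"
    then show "\<exists>y\<in>carrier (proper_ring R). y \<oplus>\<^bsub>proper_ring R\<^esub> x = \<zero>\<^bsub>proper_ring R\<^esub>"
      by (auto simp: proper_ring_def intro!: bexI[of _ "\<ominus> x"] l_neg)
  qed (auto simp: proper_ring_def a_ac)
  show "comm_monoid (proper_ring R)"
    by (rule comm_monoidI) (auto simp: proper_ring_def m_ac)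
qed (auto simp: proper_ring_def l_distr)

lemma proj_closed [simp, intro]: "proj R f \<in> carrier R"
  using slot_closed[OF cring_proper_ring, of f] by (simp add: proj_def) (simp add: proper_ring_def)

lemma proj_add: "proj R (f + g) = proj R f \<oplus> proj R g"
  and proj_mult: "proj R (f * g) = proj R f \<otimes> proj R g"
  and proj_0: "proj R 0 = \<zero>"
  by (simp_all add: proj_def ring_product_slots cring_proper_ring) (simp_all add: proper_ring_def)

lemma emb_tuple_closed: "x \<in> carrier R \<Longrightarrow> cring R' \<Longrightarrow> (if R' = proper_ring R then x else \<zero>\<^bsub>R'\<^esub>) \<in> carrier R'"
  by (simp add: cring.cring_simprules) (simp add: proper_ring_def)

lemma slot_emb: "x \<in> carrier R \<Longrightarrow> cring R' \<Longrightarrow> slot R' (emb R x) = (if R' = proper_ring R then x else \<zero>\<^bsub>R'\<^esub>)"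
  unfolding emb_def by (rule tuple(1)[OF emb_tuple_closed])

lemma int_slot_emb: "x \<in> carrier R \<Longrightarrow> int_slot (emb R x) = 0"
  unfolding emb_def by (rule tuple(2)[OF emb_tuple_closed])

lemma proj_emb [simp]: "x \<in> carrier R \<Longrightarrow> proj R (emb R x) = x"
  by (simp add: proj_def slot_emb cring_proper_ring)

lemma emb_add: "x \<in> carrier R \<Longrightarrow> y \<in> carrier R \<Longrightarrow> emb R (x \<oplus> y) = emb R x + emb R y"
  by (rule ring_product_eqI)
    (auto simp: slot_emb int_slot_emb ring_product_slots ring_product_int_slots cring.cring_simprules,
     auto simp: proper_ring_def)

lemma emb_mult: "x \<in> carrier R \<Longrightarrow> emb R x * f = emb R (x \<otimes> proj R f)"
  by (rule ring_product_eqI)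
    (auto simp: slot_emb int_slot_emb ring_product_slots ring_product_int_slots cring.cring_simprules slot_closed,
     auto simp: proj_def, auto simp: proper_ring_def)

lemma emb_0: "emb R \<zero> = 0"
  by (rule ring_product_eqI)
    (auto simp: slot_emb int_slot_emb ring_product_slots ring_product_int_slots, auto simp: proper_ring_def)

lemma emb_inject: "x \<in> carrier R \<Longrightarrow> y \<in> carrier R \<Longrightarrow> emb R x = emb R y \<longleftrightarrow> x = y"
  using proj_emb by metis

lemma emb_mult_emb: "x \<in> carrier R \<Longrightarrow> y \<in> carrier R \<Longrightarrow> emb R (x \<otimes> y) = emb R x * emb R y"
  by (simp add: emb_mult)

lemma emb_one_mult: "emb R \<one> * f = emb R (proj R f)"
  by (simp add: emb_mult)

lemma emb_finsum: "finite I \<Longrightarrow> f \<in> I \<rightarrow> carrier R \<Longrightarrow> emb R (finsum R f I) = (\<Sum>i\<in>I. emb R (f i))"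
  by (induction I rule: finite_induct) (auto simp: emb_0 emb_add finsum_closed Pi_def)

lemma proj_sum: "finite I \<Longrightarrow> proj R (sum f I) = finsum R (\<lambda>i. proj R (f i)) I"
  by (induction I rule: finite_induct) (auto simp: proj_0 proj_add)

text \<open>The exponent is positive because \<open>emb\<close> does not preserve the unit.\<close>

lemma emb_power: "x \<in> carrier R \<Longrightarrow> n > 0 \<Longrightarrow> emb R (x [^] n) = emb R x ^ n"
proof (induction n)
  case (Suc n)
  then show ?case
    by (cases "n = 0") (simp_all add: emb_mult_emb mult.commute)
qed simp

lemma emb_add_pow: "x \<in> carrier R \<Longrightarrow> emb R (add_pow R n x) = of_nat n * emb R x"
  by (induction n) (simp_all add: emb_0 emb_add add.nat_pow_Suc algebra_simps)

end

section \<open>Translation between carrier-based algebras and the abstract setting\<close>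

context hasse_schmidt_setting
begin

lemma HS_of_components:
  assumes "D 0 = id" "\<And>i. i > 0 \<Longrightarrow> lin (D i)"
    and "\<And>i x y. 0 < i \<Longrightarrow> i < n \<Longrightarrow> D i (x * y) = (\<Sum>j\<in>{0..i}. D j x * D (i - j) y)"
  obtains \<Phi> where "HS n \<Phi>" "\<forall>i. comp_at \<Phi> i = D i"
proof -
  define u where "u x = Abs_fps (\<lambda>i. D i x)" for x
  have u: "unip (lin_ext u)"
    by (rule unip_lin_ext) (simp_all add: u_def assms(1,2))
  have "u 0 = 0"
  proof (rule fps_ext)
    fix i show "u 0 $ i = 0 $ i"
      by (cases "i = 0") (simp_all add: u_def assms(1) lin_0[OF assms(2)])
  qed
  then have c: "comp_at (lin_ext u) i = D i" for i
    by (simp add: comp_at_def lin_ext_const fun_eq_iff) (simp add: u_def)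
  have "obstr i (lin_ext u) x y = 0" if "i < n" for i x y
    unfolding obstr_comp_at c using assms(1,3) that by (cases "i = 0") auto
  then have "i \<le> n \<Longrightarrow> HS i (lin_ext u)" for i
    by (induction i) (simp_all add: HS_Suc_iff, simp add: HS_def u fps_cong_def)
  then show thesis
    using that c by blast
qed

end

locale char_p_algebra = A: algebra k A
  for p :: nat and k :: "('k, 'x) ring_scheme" and A :: "('k, 'a, 'y) module_scheme" +
  assumes prime: "normalization_semidom_class.prime p"
    and add_pow_p: "add_pow A p \<one>\<^bsub>A\<^esub> = \<zero>\<^bsub>A\<^esub>"
begin

abbreviation "j \<equiv> emb A"
abbreviation "q \<equiv> proj A"
abbreviation "scalars \<equiv> (\<lambda>r. j (r \<odot>\<^bsub>A\<^esub> \<one>\<^bsub>A\<^esub>)) ` carrier k"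

sublocale P: hasse_schmidt_setting p scalars "j \<one>\<^bsub>A\<^esub>"
proof
  show "j \<one>\<^bsub>A\<^esub> * j \<one>\<^bsub>A\<^esub> = j \<one>\<^bsub>A\<^esub>"
    by (simp flip: A.emb_mult_emb)
  show "of_nat p * j \<one>\<^bsub>A\<^esub> = 0"
    by (simp add: add_pow_p A.emb_0 flip: A.emb_add_pow)
qed (rule prime)

lemma smult_one_mult: "r \<in> carrier k \<Longrightarrow> x \<in> carrier A \<Longrightarrow> (r \<odot>\<^bsub>A\<^esub> \<one>\<^bsub>A\<^esub>) \<otimes>\<^bsub>A\<^esub> x = r \<odot>\<^bsub>A\<^esub> x"
  by (simp add: A.smult_assoc2)

lemma lin_project: "P.lin g \<Longrightarrow> (\<lambda>x\<in>carrier A. q (g (j x))) \<in> module_homs k A A"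
proof -
  assume g: "P.lin g"
  have "q (g (j (r \<odot>\<^bsub>A\<^esub> x))) = r \<odot>\<^bsub>A\<^esub> q (g (j x))" if "r \<in> carrier k" "x \<in> carrier A" for r x
  proof -
    have "j (r \<odot>\<^bsub>A\<^esub> x) = j (r \<odot>\<^bsub>A\<^esub> \<one>\<^bsub>A\<^esub>) * j x"
      using that by (simp add: smult_one_mult flip: A.emb_mult_emb)
    then show ?thesis
      using that P.lin_C[OF g, of "j (r \<odot>\<^bsub>A\<^esub> \<one>\<^bsub>A\<^esub>)" "j x"] by (simp add: A.proj_mult smult_one_mult)
  qed
  then show ?thesis
    by (auto simp: module_homs_def A.emb_add P.lin_add[OF g] A.proj_add)
qed

lemma lin_inject:
  assumes "h \<in> module_homs k A A"
  shows "P.lin (\<lambda>f. j (h (q f)))"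
proof -
  have c: "h x \<in> carrier A" if "x \<in> carrier A" for x
    using assms that by (auto simp: module_homs_def)
  show ?thesis
    using assms c unfolding P.lin_def
    by (auto simp: module_homs_def A.proj_add A.emb_add A.proj_mult smult_one_mult A.emb_mult)
qed

text \<open>The idempotent is one of the scalars, so a linear map commutes with it and depends only
  on the component of \<open>f\<close> in the factor \<open>A\<close>.\<close>

lemma proj_lin: "P.lin g \<Longrightarrow> g f = g (j (q f))"
proof -
  assume g: "P.lin g"
  have "j \<one>\<^bsub>A\<^esub> \<in> scalars"
    by (rule image_eqI[of _ _ "\<one>\<^bsub>k\<^esub>"]) simp_all
  then show ?thesis
    using P.lin_C[OF g, of "j \<one>\<^bsub>A\<^esub>" f] P.lin_e[OF g, of f] by (simp add: A.emb_one_mult)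
qed

lemma emb_proj_lin: "P.lin g \<Longrightarrow> j (q (g f)) = g f"
  using P.lin_e[of g f] by (simp add: A.emb_one_mult)

lemma HS_of_hasse_schmidt:
  assumes "hasse_schmidt k A m D"
  obtains \<Phi> where "P.HS (Suc m) \<Phi>" "\<forall>i f. 0 < i \<longrightarrow> i \<le> m \<longrightarrow> P.comp_at \<Phi> i f = j (D i (q f))"
proof -
  \<comment> \<open>\<open>E 0\<close> has to be the identity of the whole product, whereas the
    positive components live in the factor \<open>A\<close>; those above \<open>m\<close> may be
    zero since only indices up to \<open>m\<close> are tested.\<close>
  define E where "E i f = (if i = 0 then f else if i \<le> m then j (D i (q f)) else 0)" for i f
  have D: "D i \<in> module_homs k A A" if "i \<le> m" for i
    using assms that by (simp add: hasse_schmidt_def)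
  have Dc: "D i x \<in> carrier A" if "i \<le> m" "x \<in> carrier A" for i x
    using D[OF that(1)] that(2) by (auto simp: module_homs_def)
  have "P.lin (E i)" if "i > 0" for i
  proof (cases "i \<le> m")
    case True
    then show ?thesis
      using lin_inject[OF D[OF True]] that by (simp add: E_def[abs_def])
  qed (use that in \<open>simp add: E_def[abs_def] P.lin_def\<close>)
  moreover have "E i (x * y) = (\<Sum>l\<in>{0..i}. E l x * E (i - l) y)" if "0 < i" "i < Suc m" for i x y
  proof -
    have eq: "j (D l (q x) \<otimes>\<^bsub>A\<^esub> D (i - l) (q y)) = E l x * E (i - l) y" if l: "l \<le> i" for l
    proof -
      have D0: "D 0 z = z" if "z \<in> carrier A" for z
        using assms that by (simp add: hasse_schmidt_def)
      \<comment> \<open>At the two ends one factor is an arbitrary element of the product ring. The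
        other factor lies in \<open>A\<close> and thereby projects it.\<close>
      consider "l = 0" | "l = i" | "0 < l" "l < i"
        using l by linarith
      then show ?thesis
      proof cases
        case 1
        have "x * j (D i (q y)) = j (D i (q y) \<otimes>\<^bsub>A\<^esub> q x)"
          using \<open>i < Suc m\<close> by (subst mult.commute) (simp add: A.emb_mult Dc)
        then show ?thesis
          using 1 \<open>0 < i\<close> \<open>i < Suc m\<close> by (simp add: E_def D0 A.m_comm Dc)
      next
        case 2
        then show ?thesis
          using \<open>0 < i\<close> \<open>i < Suc m\<close> by (simp add: E_def D0 A.emb_mult Dc)
      next
        case 3
        then have "0 < i - l" "i - l \<le> m" "l \<le> m"
          using \<open>i < Suc m\<close> by simp_all
        then show ?thesis
          using 3 by (simp add: E_def A.emb_mult Dc)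
      qed
    qed
    have "E i (x * y) = j (D i (q x \<otimes>\<^bsub>A\<^esub> q y))"
      using that by (simp add: E_def A.proj_mult)
    also have "D i (q x \<otimes>\<^bsub>A\<^esub> q y) = (\<Oplus>\<^bsub>A\<^esub>l\<in>{..i}. D l (q x) \<otimes>\<^bsub>A\<^esub> D (i - l) (q y))"
      using assms that by (simp add: hasse_schmidt_def)
    also have "j \<dots> = (\<Sum>l\<in>{..i}. j (D l (q x) \<otimes>\<^bsub>A\<^esub> D (i - l) (q y)))"
      using that by (intro A.emb_finsum) (auto simp: Dc)
    also have "\<dots> = (\<Sum>l\<in>{0..i}. E l x * E (i - l) y)"
      by (rule sum.cong) (auto simp: eq)
    finally show ?thesis .
  qed
  moreover have "E 0 = id"
    by (simp add: E_def fun_eq_iff)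
  ultimately obtain \<Phi> where "P.HS (Suc m) \<Phi>" "\<forall>i. P.comp_at \<Phi> i = E i"
    using P.HS_of_components[of E "Suc m"] by blast
  then show thesis
    using that by (simp add: E_def)
qed

lemma hasse_schmidt_of_HS:
  assumes "P.HS (Suc m) \<Phi>"
  shows "hasse_schmidt k A m (\<lambda>i. \<lambda>x\<in>carrier A. q (P.comp_at \<Phi> i (j x)))"
  unfolding hasse_schmidt_def
proof (intro conjI allI impI ballI)
  note u = P.HS_unip[OF assms]
  fix i assume "i \<le> m"
  show "(\<lambda>x\<in>carrier A. q (P.comp_at \<Phi> i (j x))) \<in> module_homs k A A"
  proof (cases "i = 0")
    case True
    then show ?thesis
      by (auto simp: module_homs_def P.comp_at_0[OF u])
  next
    case False
    then show ?thesis
      by (intro lin_project P.lin_comp_at[OF u]) simp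
  qed
next
  fix x assume "x \<in> carrier A"
  then show "(\<lambda>x\<in>carrier A. q (P.comp_at \<Phi> 0 (j x))) x = x"
    by (simp add: P.comp_at_0[OF P.HS_unip[OF assms]])
next
  fix n x y assume n: "n \<le> m" and c: "x \<in> carrier A" "y \<in> carrier A"
  have "q (P.comp_at \<Phi> n (j (x \<otimes>\<^bsub>A\<^esub> y))) = q (\<Sum>l\<in>{0..n}. P.comp_at \<Phi> l (j x) * P.comp_at \<Phi> (n - l) (j y))"
    using P.comp_at_mult[OF assms, of n "j x" "j y"] n c by (simp add: A.emb_mult_emb)
  also have "\<dots> = (\<Oplus>\<^bsub>A\<^esub>l\<in>{..n}. q (P.comp_at \<Phi> l (j x)) \<otimes>\<^bsub>A\<^esub> q (P.comp_at \<Phi> (n - l) (j y)))"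
    by (simp add: A.proj_sum A.proj_mult atLeast0AtMost)
  finally show "(\<lambda>x\<in>carrier A. q (P.comp_at \<Phi> n (j x))) (x \<otimes>\<^bsub>A\<^esub> y) =
      (\<Oplus>\<^bsub>A\<^esub>i\<in>{..n}. (\<lambda>x\<in>carrier A. q (P.comp_at \<Phi> i (j x))) x \<otimes>\<^bsub>A\<^esub> (\<lambda>x\<in>carrier A. q (P.comp_at \<Phi> (n - i) (j x))) y)"
    using c by simp
qed

lemma IDerE:
  assumes "\<delta> \<in> IDer k A m" "m > 0"
  obtains \<Phi> where "P.HS (Suc m) \<Phi>" "\<forall>f. P.comp_at \<Phi> 1 f = j (\<delta> (q f))"
proof -
  obtain D where D: "hasse_schmidt k A m D" "D 1 = \<delta>"
    using assms(1) by (auto simp: IDer_def)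
  show thesis
    by (rule HS_of_hasse_schmidt[OF D(1)], rule that) (use assms(2) D(2) in auto)
qed

lemma IDerI:
  assumes "P.HS (Suc m) \<Phi>" "m > 0"
  shows "(\<lambda>x\<in>carrier A. q (P.comp_at \<Phi> 1 (j x))) \<in> IDer k A m"
  unfolding IDer_def Der_def
proof (intro CollectI conjI ballI exI)
  show "hasse_schmidt k A m (\<lambda>i. \<lambda>x\<in>carrier A. q (P.comp_at \<Phi> i (j x)))"
    by (rule hasse_schmidt_of_HS[OF assms(1)])
  show "(\<lambda>x\<in>carrier A. q (P.comp_at \<Phi> 1 (j x))) \<in> module_homs k A A"
    by (rule lin_project[OF P.lin_comp_at[OF P.HS_unip[OF assms(1)]]]) simp
  fix x y assume c: "x \<in> carrier A" "y \<in> carrier A"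
  have "P.comp_at \<Phi> 1 (j (x \<otimes>\<^bsub>A\<^esub> y)) = j x * P.comp_at \<Phi> 1 (j y) + P.comp_at \<Phi> 1 (j x) * j y"
    using P.comp_at_1_Leibniz[OF assms(1), of "j x" "j y"] assms(2) c by (simp add: A.emb_mult_emb)
  then show "(\<lambda>x\<in>carrier A. q (P.comp_at \<Phi> 1 (j x))) (x \<otimes>\<^bsub>A\<^esub> y) =
      (\<lambda>x\<in>carrier A. q (P.comp_at \<Phi> 1 (j x))) x \<otimes>\<^bsub>A\<^esub> y \<oplus>\<^bsub>A\<^esub> x \<otimes>\<^bsub>A\<^esub> (\<lambda>x\<in>carrier A. q (P.comp_at \<Phi> 1 (j x))) y"
    using c by (simp add: A.proj_add A.proj_mult A.a_comm)
qed simp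

lemma IDer_closed: "\<delta> \<in> IDer k A m \<Longrightarrow> x \<in> carrier A \<Longrightarrow> \<delta> x \<in> carrier A"
  and IDer_extensional: "\<delta> \<in> IDer k A m \<Longrightarrow> \<delta> \<in> extensional (carrier A)"
  by (auto simp: IDer_def Der_def module_homs_def PiE_def)

lemma IDer_restrict: "\<delta> \<in> IDer k A m \<Longrightarrow> restrict \<delta> (carrier A) = \<delta>"
  using IDer_extensional by (rule extensional_restrict)

text \<open>Componentwise sums of Hasse-Schmidt derivations are not multiplicative in general; their
  composite is again one, and its first component is the sum.\<close>

lemma IDer_add:
  assumes "\<delta> \<in> IDer k A m" "\<epsilon> \<in> IDer k A m" "m > 0"
  shows "(\<lambda>x\<in>carrier A. \<delta> x \<oplus>\<^bsub>A\<^esub> \<epsilon> x) \<in> IDer k A m"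
proof -
  obtain \<Phi> where \<Phi>: "P.HS (Suc m) \<Phi>" "\<forall>f. P.comp_at \<Phi> 1 f = j (\<delta> (q f))"
    by (rule IDerE[OF assms(1,3)])
  obtain \<Psi> where \<Psi>: "P.HS (Suc m) \<Psi>" "\<forall>f. P.comp_at \<Psi> 1 f = j (\<epsilon> (q f))"
    by (rule IDerE[OF assms(2,3)])
  note H = \<Phi> \<Psi>
  have "q (P.comp_at (\<Phi> \<circ> \<Psi>) 1 (j x)) = \<delta> x \<oplus>\<^bsub>A\<^esub> \<epsilon> x" if "x \<in> carrier A" for x
    using P.comp_at_comp[OF P.HS_unip[OF H(3)] P.HS_unip[OF H(1)], of "j x"] that H(2,4) assms(1,2)
    by (simp add: A.proj_add IDer_closed)
  then have "(\<lambda>x\<in>carrier A. \<delta> x \<oplus>\<^bsub>A\<^esub> \<epsilon> x) = (\<lambda>x\<in>carrier A. q (P.comp_at (\<Phi> \<circ> \<Psi>) 1 (j x)))"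
    by (intro restrict_ext) simp
  then show ?thesis
    using IDerI[OF P.HS_comp(1)[OF H(1,3)] assms(3)] by metis
qed

text \<open>Rescaling the variable by \<open>a\<close> multiplies the first component by
  \<open>a\<close>.\<close>

lemma IDer_smult:
  assumes "\<delta> \<in> IDer k A m" "a \<in> carrier A" "m > 0"
  shows "(\<lambda>x\<in>carrier A. a \<otimes>\<^bsub>A\<^esub> \<delta> x) \<in> IDer k A m"
proof -
  obtain \<Phi> where H: "P.HS (Suc m) \<Phi>" "\<forall>f. P.comp_at \<Phi> 1 f = j (\<delta> (q f))"
    using IDerE[OF assms(1,3)] by metis
  note s = P.scale[OF H(1), of 1 "j a"]
  have "q (P.comp_at (P.scale (j a) 1 \<Phi>) 1 (j x)) = a \<otimes>\<^bsub>A\<^esub> \<delta> x" if "x \<in> carrier A" for x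
    using s(3)[of 1 "j x"] H(2) that assms(1,2) by (simp add: A.proj_mult IDer_closed A.m_comm)
  then have "(\<lambda>x\<in>carrier A. a \<otimes>\<^bsub>A\<^esub> \<delta> x) = (\<lambda>x\<in>carrier A. q (P.comp_at (P.scale (j a) 1 \<Phi>) 1 (j x)))"
    by (intro restrict_ext) simp
  then show ?thesis
    using IDerI[of m "P.scale (j a) 1 \<Phi>"] s(1) assms(3) by simp
qed

lemma IDer_zero: "m > 0 \<Longrightarrow> (\<lambda>x\<in>carrier A. \<zero>\<^bsub>A\<^esub>) \<in> IDer k A m"
  using IDerI[OF P.HS_id, of m] by (simp add: P.comp_at_def A.proj_0 cong: restrict_cong)

lemma IDer_module_module:
  assumes "m > 0"
  shows "module A (IDer_module k A m)"
proof (rule moduleI)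
  show "abelian_group (IDer_module k A m)"
  proof (rule abelian_groupI)
    fix \<delta> assume \<delta>: "\<delta> \<in> carrier (IDer_module k A m)"
    then have "(\<lambda>x\<in>carrier A. (\<ominus>\<^bsub>A\<^esub> \<one>\<^bsub>A\<^esub>) \<otimes>\<^bsub>A\<^esub> \<delta> x) \<in> IDer k A m"
      using assms by (intro IDer_smult) (auto simp: IDer_module_def)
    moreover have "(\<lambda>x\<in>carrier A. (\<lambda>x\<in>carrier A. (\<ominus>\<^bsub>A\<^esub> \<one>\<^bsub>A\<^esub>) \<otimes>\<^bsub>A\<^esub> \<delta> x) x \<oplus>\<^bsub>A\<^esub> \<delta> x) = (\<lambda>x\<in>carrier A. \<zero>\<^bsub>A\<^esub>)"
      using \<delta> by (intro restrict_ext) (auto simp: IDer_module_def IDer_closed A.l_minus A.l_neg)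
    ultimately show "\<exists>\<epsilon>\<in>carrier (IDer_module k A m). \<epsilon> \<oplus>\<^bsub>IDer_module k A m\<^esub> \<delta> = \<zero>\<^bsub>IDer_module k A m\<^esub>"
      unfolding IDer_module_def by (simp only: partial_object.simps ring.simps) (rule bexI)
  next
    fix \<delta> \<epsilon> \<zeta> assume "\<delta> \<in> carrier (IDer_module k A m)" "\<epsilon> \<in> carrier (IDer_module k A m)" "\<zeta> \<in> carrier (IDer_module k A m)"
    then show "\<delta> \<oplus>\<^bsub>IDer_module k A m\<^esub> \<epsilon> \<oplus>\<^bsub>IDer_module k A m\<^esub> \<zeta> =
        \<delta> \<oplus>\<^bsub>IDer_module k A m\<^esub> (\<epsilon> \<oplus>\<^bsub>IDer_module k A m\<^esub> \<zeta>)"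
      by (simp add: IDer_module_def IDer_closed A.a_assoc cong: restrict_cong)
  next
    fix \<delta> \<epsilon> assume "\<delta> \<in> carrier (IDer_module k A m)" "\<epsilon> \<in> carrier (IDer_module k A m)"
    then show "\<delta> \<oplus>\<^bsub>IDer_module k A m\<^esub> \<epsilon> = \<epsilon> \<oplus>\<^bsub>IDer_module k A m\<^esub> \<delta>"
      by (simp add: IDer_module_def IDer_closed A.a_comm cong: restrict_cong)
  next
    fix \<delta> assume \<delta>: "\<delta> \<in> carrier (IDer_module k A m)"
    then show "\<zero>\<^bsub>IDer_module k A m\<^esub> \<oplus>\<^bsub>IDer_module k A m\<^esub> \<delta> = \<delta>"
      by (simp add: IDer_module_def IDer_closed IDer_restrict cong: restrict_cong)
  qed (use assms in \<open>simp_all add: IDer_module_def IDer_add IDer_zero\<close>)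
next
  fix \<delta> assume \<delta>: "\<delta> \<in> carrier (IDer_module k A m)"
  then show "\<one>\<^bsub>A\<^esub> \<odot>\<^bsub>IDer_module k A m\<^esub> \<delta> = \<delta>"
    by (simp add: IDer_module_def IDer_closed IDer_restrict cong: restrict_cong)
qed (use assms A.is_cring in \<open>simp_all add: IDer_module_def IDer_smult IDer_closed A.l_distr A.r_distr A.m_assoc
    cong: restrict_cong\<close>)

end

section \<open>Linear functionals\<close>

text \<open>The additivity of Frobenius, proved in \<open>ring_product\<close> where
  \<open>binomial_ring\<close> is available: \<open>p\<close> divides the inner binomial
  coefficients and annihilates the factor.\<close>

lemma (in cring) add_power_prime:
  fixes p :: nat
  assumes "normalization_semidom_class.prime p" "add_pow R p \<one> = \<zero>" "x \<in> carrier R" "y \<in> carrier R"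
  shows "(x \<oplus> y) [^] p = x [^] p \<oplus> y [^] p"
proof -
  have p: "p > 0"
    using assms(1) prime_gt_0_nat by blast
  have zero: "of_nat p * emb R z = 0" if "z \<in> carrier R" for z
  proof -
    have "of_nat p * emb R z = (of_nat p * emb R \<one>) * emb R z"
      using that by (simp add: mult.assoc flip: emb_mult_emb)
    also have "of_nat p * emb R \<one> = 0"
      by (simp add: assms(2) emb_0 flip: emb_add_pow)
    finally show ?thesis
      by simp
  qed
  let ?t = "\<lambda>i. of_nat (p choose i) * emb R x ^ i * emb R y ^ (p - i)"
  have "?t i = 0" if "i \<in> {..p} - {0, p}" for i
  proof -
    have i: "0 < i" "i < p"
      using that by auto
    have "i * (p choose i) = p * ((p - 1) choose (i - 1))"
      by (rule times_binomial_minus1_eq[OF i(1)])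
    then have "p dvd i \<or> p dvd (p choose i)"
      using assms(1) by (metis dvd_triv_left prime_dvd_mult_iff)
    moreover have "\<not> p dvd i"
      using i dvd_imp_le by force
    ultimately obtain c where c: "p choose i = p * c"
      by (auto simp: dvd_def)
    have "emb R x ^ i = emb R (x [^] i)"
      using i assms(3) by (simp add: emb_power)
    then have "?t i = of_nat c * (of_nat p * emb R (x [^] i)) * emb R y ^ (p - i)"
      by (simp add: c ac_simps)
    then show ?thesis
      using zero[of "x [^] i"] assms(3) by simp
  qed
  then have "(\<Sum>i\<le>p. ?t i) = (\<Sum>i\<in>{0, p}. ?t i)"
    by (intro sum.mono_neutral_right) auto
  then have "(emb R x + emb R y) ^ p = emb R x ^ p + emb R y ^ p"
    using p by (simp add: binomial_ring)
  then have "emb R ((x \<oplus> y) [^] p) = emb R (x [^] p \<oplus> y [^] p)"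
    using p assms(3,4) by (simp add: emb_power emb_add)
  then show ?thesis
    using assms(3,4) by (subst (asm) emb_inject) auto
qed

definition linear_functional :: "('k, 'x) ring_scheme \<Rightarrow> ('k, 'm, 'y) module_scheme \<Rightarrow> ('m \<Rightarrow> 'k) \<Rightarrow> bool"
  where "linear_functional k M \<phi> \<longleftrightarrow> (\<forall>x\<in>carrier M. \<phi> x \<in> carrier k) \<and>
    (\<forall>x\<in>carrier M. \<forall>y\<in>carrier M. \<phi> (x \<oplus>\<^bsub>M\<^esub> y) = \<phi> x \<oplus>\<^bsub>k\<^esub> \<phi> y) \<and>
    (\<forall>r\<in>carrier k. \<forall>x\<in>carrier M. \<phi> (r \<odot>\<^bsub>M\<^esub> x) = r \<otimes>\<^bsub>k\<^esub> \<phi> x)"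

lemma linear_functional_simps:
  assumes "linear_functional k M \<phi>" "x \<in> carrier M"
  shows "\<phi> x \<in> carrier k" "y \<in> carrier M \<Longrightarrow> \<phi> (x \<oplus>\<^bsub>M\<^esub> y) = \<phi> x \<oplus>\<^bsub>k\<^esub> \<phi> y"
    "r \<in> carrier k \<Longrightarrow> \<phi> (r \<odot>\<^bsub>M\<^esub> x) = r \<otimes>\<^bsub>k\<^esub> \<phi> x"
  using assms by (auto simp: linear_functional_def)

text \<open>Partial functionals as graphs, so that Zorn's lemma applies to inclusion.
  Single-valuedness is imposed over zero; by linearity it then holds everywhere
  (\<open>graph_unique\<close>).\<close>

definition linear_graph :: "('k, 'x) ring_scheme \<Rightarrow> ('k, 'm, 'y) module_scheme \<Rightarrow> ('m \<times> 'k) set \<Rightarrow> bool"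
  where "linear_graph k M G \<longleftrightarrow> G \<subseteq> carrier M \<times> carrier k \<and> (\<zero>\<^bsub>M\<^esub>, \<zero>\<^bsub>k\<^esub>) \<in> G \<and>
    (\<forall>x s y t. (x, s) \<in> G \<longrightarrow> (y, t) \<in> G \<longrightarrow> (x \<oplus>\<^bsub>M\<^esub> y, s \<oplus>\<^bsub>k\<^esub> t) \<in> G) \<and>
    (\<forall>r\<in>carrier k. \<forall>x s. (x, s) \<in> G \<longrightarrow> (r \<odot>\<^bsub>M\<^esub> x, r \<otimes>\<^bsub>k\<^esub> s) \<in> G) \<and>
    (\<forall>s. (\<zero>\<^bsub>M\<^esub>, s) \<in> G \<longrightarrow> s = \<zero>\<^bsub>k\<^esub>)"

locale vector_space_over = k: field k + M: module k M
  for k :: "('k, 'x) ring_scheme" and M :: "('k, 'm, 'y) module_scheme"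
begin

lemma graph_unique:
  assumes G: "linear_graph k M G" and "(x, s) \<in> G" "(x, t) \<in> G"
  shows "s = t"
proof -
  have c: "x \<in> carrier M" "s \<in> carrier k" "t \<in> carrier k"
    using assms by (auto simp: linear_graph_def)
  have "((\<ominus>\<^bsub>k\<^esub> \<one>\<^bsub>k\<^esub>) \<odot>\<^bsub>M\<^esub> x, (\<ominus>\<^bsub>k\<^esub> \<one>\<^bsub>k\<^esub>) \<otimes>\<^bsub>k\<^esub> t) \<in> G"
    using assms unfolding linear_graph_def by simp
  then have "(x \<oplus>\<^bsub>M\<^esub> (\<ominus>\<^bsub>k\<^esub> \<one>\<^bsub>k\<^esub>) \<odot>\<^bsub>M\<^esub> x, s \<oplus>\<^bsub>k\<^esub> (\<ominus>\<^bsub>k\<^esub> \<one>\<^bsub>k\<^esub>) \<otimes>\<^bsub>k\<^esub> t) \<in> G"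
    using assms unfolding linear_graph_def by blast
  moreover have "x \<oplus>\<^bsub>M\<^esub> (\<ominus>\<^bsub>k\<^esub> \<one>\<^bsub>k\<^esub>) \<odot>\<^bsub>M\<^esub> x = \<zero>\<^bsub>M\<^esub>"
    using c M.smult_l_minus[of "\<one>\<^bsub>k\<^esub>" x] by (simp add: M.r_neg)
  ultimately have "s \<oplus>\<^bsub>k\<^esub> (\<ominus>\<^bsub>k\<^esub> \<one>\<^bsub>k\<^esub>) \<otimes>\<^bsub>k\<^esub> t = \<zero>\<^bsub>k\<^esub>"
    using G by (simp add: linear_graph_def)
  then show ?thesis
    using c by (simp add: k.l_minus flip: k.minus_eq)
qed

text \<open>The new vector receives the value zero. This is consistent because a nonzero multiple of
  \<open>c\<close> in the old domain would put \<open>c\<close> itself there.\<close>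

lemma graph_extend:
  assumes G: "linear_graph k M G" and c: "c \<in> carrier M" "c \<notin> fst ` G"
  obtains G' where "linear_graph k M G'" "G \<subset> G'"
proof -
  define G' where "G' = {(x \<oplus>\<^bsub>M\<^esub> r \<odot>\<^bsub>M\<^esub> c, s) | x s r. (x, s) \<in> G \<and> r \<in> carrier k}"
  have Gc: "x \<in> carrier M" "s \<in> carrier k" if "(x, s) \<in> G" for x s
    using G that by (auto simp: linear_graph_def)
  have G'I: "(x \<oplus>\<^bsub>M\<^esub> r \<odot>\<^bsub>M\<^esub> c, s) \<in> G'" if "(x, s) \<in> G" "r \<in> carrier k" for x s r
    using that unfolding G'_def by blast
  have "linear_graph k M G'"
    unfolding linear_graph_def
  proof (intro conjI allI impI ballI)
    show "G' \<subseteq> carrier M \<times> carrier k"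
      using Gc c by (auto simp: G'_def)
    have "(\<zero>\<^bsub>M\<^esub>, \<zero>\<^bsub>k\<^esub>) \<in> G"
      using G by (simp add: linear_graph_def)
    then show "(\<zero>\<^bsub>M\<^esub>, \<zero>\<^bsub>k\<^esub>) \<in> G'"
      using G'I[of "\<zero>\<^bsub>M\<^esub>" "\<zero>\<^bsub>k\<^esub>" "\<zero>\<^bsub>k\<^esub>"] c by simp
  next
    fix x s y t assume "(x, s) \<in> G'" "(y, t) \<in> G'"
    then obtain x' r y' r' where e: "x = x' \<oplus>\<^bsub>M\<^esub> r \<odot>\<^bsub>M\<^esub> c" "(x', s) \<in> G" "r \<in> carrier k"
        "y = y' \<oplus>\<^bsub>M\<^esub> r' \<odot>\<^bsub>M\<^esub> c" "(y', t) \<in> G" "r' \<in> carrier k"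
      unfolding G'_def by blast
    have "(x' \<oplus>\<^bsub>M\<^esub> y', s \<oplus>\<^bsub>k\<^esub> t) \<in> G"
      using G e unfolding linear_graph_def by blast
    from G'I[OF this, of "r \<oplus>\<^bsub>k\<^esub> r'"]
    show "(x \<oplus>\<^bsub>M\<^esub> y, s \<oplus>\<^bsub>k\<^esub> t) \<in> G'"
      using e Gc c by (simp add: M.smult_l_distr M.a_ac)
  next
    fix r x s assume r: "r \<in> carrier k" and "(x, s) \<in> G'"
    then obtain x' r' where e: "x = x' \<oplus>\<^bsub>M\<^esub> r' \<odot>\<^bsub>M\<^esub> c" "(x', s) \<in> G" "r' \<in> carrier k"
      unfolding G'_def by blast
    have "(r \<odot>\<^bsub>M\<^esub> x', r \<otimes>\<^bsub>k\<^esub> s) \<in> G"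
      using G e r unfolding linear_graph_def by blast
    from G'I[OF this, of "r \<otimes>\<^bsub>k\<^esub> r'"] show "(r \<odot>\<^bsub>M\<^esub> x, r \<otimes>\<^bsub>k\<^esub> s) \<in> G'"
      using e r Gc c by (simp add: M.smult_r_distr M.smult_assoc1)
  next
    fix s assume "(\<zero>\<^bsub>M\<^esub>, s) \<in> G'"
    then obtain x r where e: "\<zero>\<^bsub>M\<^esub> = x \<oplus>\<^bsub>M\<^esub> r \<odot>\<^bsub>M\<^esub> c" "(x, s) \<in> G" "r \<in> carrier k"
      unfolding G'_def by blast
    have "r = \<zero>\<^bsub>k\<^esub>"
    proof (rule ccontr)
      assume "r \<noteq> \<zero>\<^bsub>k\<^esub>"
      then have i: "inv\<^bsub>k\<^esub> r \<in> carrier k" "inv\<^bsub>k\<^esub> r \<otimes>\<^bsub>k\<^esub> r = \<one>\<^bsub>k\<^esub>"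
        using e(3) k.field_Units k.Units_inv_closed k.Units_l_inv by auto
      have "r \<odot>\<^bsub>M\<^esub> c = \<ominus>\<^bsub>M\<^esub> x"
        using e Gc[OF e(2)] c M.minus_equality[of "r \<odot>\<^bsub>M\<^esub> c" x] M.a_comm[of x "r \<odot>\<^bsub>M\<^esub> c"] by simp
      then have "inv\<^bsub>k\<^esub> r \<odot>\<^bsub>M\<^esub> (r \<odot>\<^bsub>M\<^esub> c) = (\<ominus>\<^bsub>k\<^esub> (inv\<^bsub>k\<^esub> r)) \<odot>\<^bsub>M\<^esub> x"
        using i Gc[OF e(2)] by (simp add: M.smult_r_minus M.smult_l_minus)
      then have "c = (\<ominus>\<^bsub>k\<^esub> (inv\<^bsub>k\<^esub> r)) \<odot>\<^bsub>M\<^esub> x"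
        using i e(3) c by (simp flip: M.smult_assoc1)
      moreover have "((\<ominus>\<^bsub>k\<^esub> (inv\<^bsub>k\<^esub> r)) \<odot>\<^bsub>M\<^esub> x, (\<ominus>\<^bsub>k\<^esub> (inv\<^bsub>k\<^esub> r)) \<otimes>\<^bsub>k\<^esub> s) \<in> G"
        using G e(2) i unfolding linear_graph_def by simp
      ultimately show False
        using c(2) by (metis fst_conv imageI)
    qed
    then have "x = \<zero>\<^bsub>M\<^esub>"
      using e Gc[OF e(2)] c by simp
    then show "s = \<zero>\<^bsub>k\<^esub>"
      using G e(2) by (simp add: linear_graph_def)
  qed
  moreover have "G \<subseteq> G'"
  proof
    fix z assume "z \<in> G"
    then show "z \<in> G'"
      using G'I[of "fst z" "snd z" "\<zero>\<^bsub>k\<^esub>"] Gc[of "fst z" "snd z"] c by simp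
  qed
  moreover have "(c, \<zero>\<^bsub>k\<^esub>) \<in> G'"
    using G'I[of "\<zero>\<^bsub>M\<^esub>" "\<zero>\<^bsub>k\<^esub>" "\<one>\<^bsub>k\<^esub>"] G c by (simp add: linear_graph_def)
  ultimately show thesis
    using that c(2) by (metis fst_conv imageI psubsetI)
qed

text \<open>Zorn's lemma: a maximal graph has full domain, for otherwise \<open>graph_extend\<close>
  would enlarge it.\<close>

lemma functional_extend:
  assumes "linear_graph k M G"
  obtains \<phi> where "linear_functional k M \<phi>" "\<And>x s. (x, s) \<in> G \<Longrightarrow> \<phi> x = s"
proof -
  let ?S = "{G'. linear_graph k M G' \<and> G \<subseteq> G'}"
  have "\<exists>N\<in>?S. \<forall>Y\<in>?S. N \<subseteq> Y \<longrightarrow> Y = N"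
  proof (rule subset_Zorn_nonempty)
    show "?S \<noteq> {}"
      using assms by auto
    fix \<C> assume C: "\<C> \<noteq> {}" "subset.chain ?S \<C>"
    have lin: "linear_graph k M H" "G \<subseteq> H" if "H \<in> \<C>" for H
      using C(2) that by (auto simp: subset.chain_def)
    have "linear_graph k M (\<Union>\<C>)"
      unfolding linear_graph_def
    proof (intro conjI allI impI ballI)
      show "\<Union>\<C> \<subseteq> carrier M \<times> carrier k"
        using lin unfolding linear_graph_def by blast
      show "(\<zero>\<^bsub>M\<^esub>, \<zero>\<^bsub>k\<^esub>) \<in> \<Union>\<C>"
        using lin C(1) unfolding linear_graph_def by blast
    next
      fix x s y t assume "(x, s) \<in> \<Union>\<C>" "(y, t) \<in> \<Union>\<C>"
      then obtain H H' where H: "H \<in> \<C>" "(x, s) \<in> H" "H' \<in> \<C>" "(y, t) \<in> H'"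
        by blast
      then have "H \<subseteq> H' \<or> H' \<subseteq> H"
        using C(2) unfolding subset.chain_def by blast
      then obtain H'' where "H'' \<in> \<C>" "(x, s) \<in> H''" "(y, t) \<in> H''"
        using H by blast
      then show "(x \<oplus>\<^bsub>M\<^esub> y, s \<oplus>\<^bsub>k\<^esub> t) \<in> \<Union>\<C>"
        using lin(1)[of H''] unfolding linear_graph_def by blast
    next
      fix r x s assume "r \<in> carrier k" "(x, s) \<in> \<Union>\<C>"
      then show "(r \<odot>\<^bsub>M\<^esub> x, r \<otimes>\<^bsub>k\<^esub> s) \<in> \<Union>\<C>"
        using lin(1) unfolding linear_graph_def by blast
    next
      fix s assume "(\<zero>\<^bsub>M\<^esub>, s) \<in> \<Union>\<C>"
      then show "s = \<zero>\<^bsub>k\<^esub>"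
        using lin(1) unfolding linear_graph_def by blast
    qed
    then show "\<Union>\<C> \<in> ?S"
      using lin(2) C(1) by blast
  qed
  then obtain N where NS: "N \<in> ?S" "\<forall>Y\<in>?S. N \<subseteq> Y \<longrightarrow> Y = N" ..
  then have N: "linear_graph k M N" "G \<subseteq> N"
    by simp_all
  have max: "Y = N" if "linear_graph k M Y" "N \<subseteq> Y" for Y
    using NS(2) N(2) that by simp
  have "\<exists>s. (x, s) \<in> N" if "x \<in> carrier M" for x
  proof (rule ccontr)
    assume "\<nexists>s. (x, s) \<in> N"
    then have "x \<notin> fst ` N"
      by auto
    then show False
      using graph_extend[OF N(1) that] max by (metis psubset_eq)
  qed
  then have total: "\<exists>!s. (x, s) \<in> N" if "x \<in> carrier M" for x
    using graph_unique[OF N(1)] that by blast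
  define \<phi> where "\<phi> x = (THE s. (x, s) \<in> N)" for x
  have \<phi>I: "\<phi> x = s" if "(x, s) \<in> N" for x s
    unfolding \<phi>_def using graph_unique[OF N(1)] that by blast
  have \<phi>N: "(x, \<phi> x) \<in> N" if "x \<in> carrier M" for x
    using total[OF that] \<phi>I by blast
  have "linear_functional k M \<phi>"
    unfolding linear_functional_def
  proof (intro conjI ballI)
    fix x assume x: "x \<in> carrier M"
    show "\<phi> x \<in> carrier k"
      using \<phi>N[OF x] N(1) unfolding linear_graph_def by blast
    show "\<phi> (x \<oplus>\<^bsub>M\<^esub> y) = \<phi> x \<oplus>\<^bsub>k\<^esub> \<phi> y" if "y \<in> carrier M" for y
      using \<phi>N[OF x] \<phi>N[OF that] N(1) by (intro \<phi>I) (auto simp: linear_graph_def)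
    show "\<phi> (r \<odot>\<^bsub>M\<^esub> x) = r \<otimes>\<^bsub>k\<^esub> \<phi> x" if "r \<in> carrier k" for r
      using \<phi>N[OF x] that N(1) by (intro \<phi>I) (auto simp: linear_graph_def)
  qed
  then show thesis
    using that \<phi>I N(2) by blast
qed

lemma functional_exists:
  assumes "c \<in> carrier M" "c \<noteq> \<zero>\<^bsub>M\<^esub>"
  obtains \<phi> where "linear_functional k M \<phi>" "\<phi> c = \<one>\<^bsub>k\<^esub>"
proof -
  define G where "G = {(r \<odot>\<^bsub>M\<^esub> c, r) | r. r \<in> carrier k}"
  have GI: "(r \<odot>\<^bsub>M\<^esub> c, r) \<in> G" if "r \<in> carrier k" for r
    using that by (auto simp: G_def)
  have "linear_graph k M G"
    unfolding linear_graph_def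
  proof (intro conjI allI impI ballI)
    show "(\<zero>\<^bsub>M\<^esub>, \<zero>\<^bsub>k\<^esub>) \<in> G"
      using GI[of "\<zero>\<^bsub>k\<^esub>"] assms by simp
  next
    fix x s y t assume "(x, s) \<in> G" "(y, t) \<in> G"
    then show "(x \<oplus>\<^bsub>M\<^esub> y, s \<oplus>\<^bsub>k\<^esub> t) \<in> G"
      using GI[of "s \<oplus>\<^bsub>k\<^esub> t"] assms by (auto simp: G_def M.smult_l_distr)
  next
    fix r x s assume "r \<in> carrier k" "(x, s) \<in> G"
    then show "(r \<odot>\<^bsub>M\<^esub> x, r \<otimes>\<^bsub>k\<^esub> s) \<in> G"
      using GI[of "r \<otimes>\<^bsub>k\<^esub> s"] assms by (auto simp: G_def M.smult_assoc1)
  next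
    fix s assume "(\<zero>\<^bsub>M\<^esub>, s) \<in> G"
    then have s: "s \<odot>\<^bsub>M\<^esub> c = \<zero>\<^bsub>M\<^esub>" "s \<in> carrier k"
      by (auto simp: G_def)
    show "s = \<zero>\<^bsub>k\<^esub>"
    proof (rule ccontr)
      assume "s \<noteq> \<zero>\<^bsub>k\<^esub>"
      then have i: "inv\<^bsub>k\<^esub> s \<in> carrier k" "inv\<^bsub>k\<^esub> s \<otimes>\<^bsub>k\<^esub> s = \<one>\<^bsub>k\<^esub>"
        using s(2) k.field_Units k.Units_inv_closed k.Units_l_inv by auto
      have "c = inv\<^bsub>k\<^esub> s \<odot>\<^bsub>M\<^esub> (s \<odot>\<^bsub>M\<^esub> c)"
        using i s(2) assms by (simp flip: M.smult_assoc1)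
      then show False
        using s i assms by simp
    qed
  qed (use assms in \<open>auto simp: G_def\<close>)
  then obtain \<phi> where "linear_functional k M \<phi>" "\<And>x s. (x, s) \<in> G \<Longrightarrow> \<phi> x = s"
    by (rule functional_extend) (rule that)
  moreover have "(c, \<one>\<^bsub>k\<^esub>) \<in> G"
    using GI[of "\<one>\<^bsub>k\<^esub>"] assms by simp
  ultimately show thesis
    using that by blast
qed

text \<open>The operator of finite rank given by vectors paired with functionals.\<close>

primrec coord_sum :: "('m \<times> ('m \<Rightarrow> 'k)) list \<Rightarrow> 'm \<Rightarrow> 'm"
  where "coord_sum [] x = \<zero>\<^bsub>M\<^esub>"
  | "coord_sum (b # bs) x = snd b x \<odot>\<^bsub>M\<^esub> fst b \<oplus>\<^bsub>M\<^esub> coord_sum bs x"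

definition coordinates :: "('m \<times> ('m \<Rightarrow> 'k)) list \<Rightarrow> bool"
  where "coordinates bs \<longleftrightarrow> (\<forall>b\<in>set bs. fst b \<in> carrier M \<and> linear_functional k M (snd b))"

lemma coord_sum_closed: "coordinates bs \<Longrightarrow> x \<in> carrier M \<Longrightarrow> coord_sum bs x \<in> carrier M"
  by (induction bs) (auto simp: coordinates_def linear_functional_simps)

lemma coord_sum_add: "coordinates bs \<Longrightarrow> x \<in> carrier M \<Longrightarrow> y \<in> carrier M \<Longrightarrow>
    coord_sum bs (x \<oplus>\<^bsub>M\<^esub> y) = coord_sum bs x \<oplus>\<^bsub>M\<^esub> coord_sum bs y"
proof (induction bs)
  case (Cons b bs)
  then have "coordinates bs" "fst b \<in> carrier M" "linear_functional k M (snd b)"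
    by (auto simp: coordinates_def)
  then show ?case
    using Cons by (simp add: linear_functional_simps M.smult_l_distr coord_sum_closed M.a_ac)
qed simp

lemma coord_sum_smult: "coordinates bs \<Longrightarrow> r \<in> carrier k \<Longrightarrow> x \<in> carrier M \<Longrightarrow>
    coord_sum bs (r \<odot>\<^bsub>M\<^esub> x) = r \<odot>\<^bsub>M\<^esub> coord_sum bs x"
proof (induction bs)
  case (Cons b bs)
  then have "coordinates bs" "fst b \<in> carrier M" "linear_functional k M (snd b)"
    by (auto simp: coordinates_def)
  then show ?case
    using Cons by (simp add: linear_functional_simps M.smult_r_distr M.smult_assoc1 coord_sum_closed)
qed simp

text \<open>Finite-dimensional subspaces are direct summands: a new vector \<open>c\<close> is added through the component
  \<open>c' = c - coord_sum bs c\<close> and a functional of the form \<open>\<psi> \<circ> (id - coord_sum bs)\<close> with \<open>\<psi> c' = 1\<close>.\<close>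

lemma coordinates_exist:
  assumes "finite Y" "Y \<subseteq> carrier M"
  obtains bs where "coordinates bs" "\<And>x. x \<in> Y \<Longrightarrow> coord_sum bs x = x"
proof -
  have "\<exists>bs. coordinates bs \<and> (\<forall>x\<in>Y. coord_sum bs x = x)"
    using assms
  proof (induction Y rule: finite_induct)
    case empty
    then show ?case
      by (auto intro!: exI[of _ "[]"] simp: coordinates_def)
  next
    case (insert c Y)
    then obtain bs where bs: "coordinates bs" "\<And>x. x \<in> Y \<Longrightarrow> coord_sum bs x = x"
      by auto
    have c: "c \<in> carrier M" and Y: "Y \<subseteq> carrier M"
      using insert.prems by auto
    define r where "r x = x \<ominus>\<^bsub>M\<^esub> coord_sum bs x" for x
    have rc: "r x \<in> carrier M" if "x \<in> carrier M" for x
      using that by (simp add: r_def coord_sum_closed bs(1))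
    show ?case
    proof (cases "r c = \<zero>\<^bsub>M\<^esub>")
      case True
      then have "coord_sum bs c = c"
        using c coord_sum_closed[OF bs(1) c] M.minus_equality[of c "\<ominus>\<^bsub>M\<^esub> coord_sum bs c"]
        by (simp add: r_def M.minus_eq)
      then show ?thesis
        using bs by auto
    next
      case False
      obtain \<psi> where \<psi>: "linear_functional k M \<psi>" "\<psi> (r c) = \<one>\<^bsub>k\<^esub>"
        using functional_exists[OF rc[OF c] False] by blast
      have \<psi>0: "\<psi> \<zero>\<^bsub>M\<^esub> = \<zero>\<^bsub>k\<^esub>"
        using linear_functional_simps(3)[OF \<psi>(1), of "\<zero>\<^bsub>M\<^esub>" "\<zero>\<^bsub>k\<^esub>"] linear_functional_simps(1)[OF \<psi>(1), of "\<zero>\<^bsub>M\<^esub>"]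
        by simp
      have "linear_functional k M (\<lambda>x. \<psi> (r x))"
        unfolding linear_functional_def
      proof (intro conjI ballI)
        fix x y s assume x: "x \<in> carrier M"
        show "\<psi> (r x) \<in> carrier k"
          by (rule linear_functional_simps(1)[OF \<psi>(1) rc[OF x]])
        show "\<psi> (r (x \<oplus>\<^bsub>M\<^esub> y)) = \<psi> (r x) \<oplus>\<^bsub>k\<^esub> \<psi> (r y)" if y: "y \<in> carrier M"
        proof -
          have "r (x \<oplus>\<^bsub>M\<^esub> y) = r x \<oplus>\<^bsub>M\<^esub> r y"
            using x y by (simp add: r_def coord_sum_add bs(1) coord_sum_closed M.minus_eq M.minus_add M.a_ac)
          then show ?thesis
            using linear_functional_simps(2)[OF \<psi>(1) rc[OF x] rc[OF y]] by simp
        qed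
        show "\<psi> (r (s \<odot>\<^bsub>M\<^esub> x)) = s \<otimes>\<^bsub>k\<^esub> \<psi> (r x)" if s: "s \<in> carrier k"
        proof -
          have "r (s \<odot>\<^bsub>M\<^esub> x) = s \<odot>\<^bsub>M\<^esub> r x"
            using x s by (simp add: r_def coord_sum_smult bs(1) coord_sum_closed M.minus_eq M.smult_r_distr M.smult_r_minus)
          then show ?thesis
            using linear_functional_simps(3)[OF \<psi>(1) rc[OF x] s] by simp
        qed
      qed
      then have coords: "coordinates ((r c, \<lambda>x. \<psi> (r x)) # bs)"
        using bs(1) rc[OF c] by (simp add: coordinates_def)
      have "coord_sum ((r c, \<lambda>x. \<psi> (r x)) # bs) x = x" if "x \<in> insert c Y" for x
      proof (cases "x = c")
        case True
        then show ?thesis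
          using c rc[OF c] \<psi>(2) coord_sum_closed[OF bs(1) c]
          by (simp add: r_def M.minus_eq M.a_assoc M.l_neg)
      next
        case False
        then have x: "x \<in> Y" "x \<in> carrier M"
          using that Y by auto
        then have "r x = \<zero>\<^bsub>M\<^esub>"
          by (simp add: r_def bs(2) M.minus_eq M.r_neg)
        then show ?thesis
          using x bs(2)[OF x(1)] rc[OF c] \<psi>0 by simp
      qed
      then show ?thesis
        using coords by blast
    qed
  qed
  then show thesis
    using that by blast
qed

end

section \<open>Contraction of tensors with functionals\<close>

locale tensor_vector_space = vector_space_over k L + N: module k N
  for k :: "('k, 'x) ring_scheme" and L :: "('k, 'l, 'y) module_scheme" and N :: "('k, 'n, 'z) module_scheme"
begin

sublocale T: tensor_product k L N
  by unfold_locales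

text \<open>This is \<open>\<phi> \<otimes> id\<close>, followed by the identification of
  \<open>k \<otimes> N\<close> with \<open>N\<close>.\<close>

definition push :: "('l \<Rightarrow> 'k) \<Rightarrow> ('l \<times> 'n \<Rightarrow>\<^sub>0 int) set \<Rightarrow> 'n"
  where "push \<phi> = tensor_lift k L N (add_monoid N) (\<lambda>c x. \<phi> c \<odot>\<^bsub>N\<^esub> x)"

lemma push_balanced:
  assumes "linear_functional k L \<phi>"
  shows "balanced k L N (add_monoid N) (\<lambda>c x. \<phi> c \<odot>\<^bsub>N\<^esub> x)"
  using assms
  by (intro balancedI) (auto simp: linear_functional_simps N.smult_l_distr N.smult_r_distr N.smult_assoc1 k.m_comm
      simp flip: N.smult_assoc1)

lemma push_hom: "linear_functional k L \<phi> \<Longrightarrow> push \<phi> \<in> hom T.T (add_monoid N)"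
  unfolding push_def by (rule T.tensor_lift(1)[OF N.a_comm_group push_balanced])

lemma push_pure: "linear_functional k L \<phi> \<Longrightarrow> c \<in> carrier L \<Longrightarrow> x \<in> carrier N \<Longrightarrow> push \<phi> (T.pt c x) = \<phi> c \<odot>\<^bsub>N\<^esub> x"
  unfolding push_def by (rule T.tensor_lift(2)[OF N.a_comm_group push_balanced])

lemma push_closed: "linear_functional k L \<phi> \<Longrightarrow> U \<in> carrier T.T \<Longrightarrow> push \<phi> U \<in> carrier N"
  using hom_in_carrier[OF push_hom] by simp

lemma push_add: "linear_functional k L \<phi> \<Longrightarrow> U \<in> carrier T.T \<Longrightarrow> V \<in> carrier T.T \<Longrightarrow>
    push \<phi> (U \<otimes>\<^bsub>T.T\<^esub> V) = push \<phi> U \<oplus>\<^bsub>N\<^esub> push \<phi> V"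
  using hom_mult[OF push_hom] by simp

text \<open>The operator \<open>coord_sum bs\<close> tensored with the identity of \<open>N\<close>
  (see \<open>recombine_pure\<close>), written so that a tensor is rebuilt from finitely many of its
  contractions.\<close>

primrec recombine :: "('l \<times> ('l \<Rightarrow> 'k)) list \<Rightarrow> ('l \<times> 'n \<Rightarrow>\<^sub>0 int) set \<Rightarrow> ('l \<times> 'n \<Rightarrow>\<^sub>0 int) set"
  where "recombine [] U = \<one>\<^bsub>T.T\<^esub>"
  | "recombine (b # bs) U = T.pt (fst b) (push (snd b) U) \<otimes>\<^bsub>T.T\<^esub> recombine bs U"

lemma recombine_closed: "coordinates bs \<Longrightarrow> U \<in> carrier T.T \<Longrightarrow> recombine bs U \<in> carrier T.T"
  by (induction bs) (auto simp: coordinates_def push_closed)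

lemma recombine_add: "coordinates bs \<Longrightarrow> U \<in> carrier T.T \<Longrightarrow> V \<in> carrier T.T \<Longrightarrow>
    recombine bs (U \<otimes>\<^bsub>T.T\<^esub> V) = recombine bs U \<otimes>\<^bsub>T.T\<^esub> recombine bs V"
proof (induction bs)
  case (Cons b bs)
  then have "coordinates bs" "fst b \<in> carrier L" "linear_functional k L (snd b)"
    by (auto simp: coordinates_def)
  then show ?case
    using Cons by (simp add: push_add push_closed T.pure_add_right recombine_closed T.T.m_ac)
qed simp

lemma recombine_pure: "coordinates bs \<Longrightarrow> c \<in> carrier L \<Longrightarrow> x \<in> carrier N \<Longrightarrow>
    recombine bs (T.pt c x) = T.pt (coord_sum bs c) x"
proof (induction bs)
  case (Cons b bs)
  then have "coordinates bs" "fst b \<in> carrier L" "linear_functional k L (snd b)"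
    by (auto simp: coordinates_def)
  then show ?case
    using Cons by (simp add: push_pure linear_functional_simps coord_sum_closed T.pure_add_left flip: T.pure_smult)
qed simp

text \<open>Finitely many tensors involve only finitely many elements of \<open>L\<close>, and an
  operator of finite rank fixing these elements fixes the tensors.\<close>

lemma recombine_exists:
  assumes "finite Z" "Z \<subseteq> carrier T.T"
  obtains bs where "coordinates bs" "\<And>U. U \<in> Z \<Longrightarrow> recombine bs U = U"
proof -
  have single: "\<exists>Y. finite Y \<and> Y \<subseteq> carrier L \<and>
      (\<forall>bs. coordinates bs \<longrightarrow> (\<forall>c\<in>Y. coord_sum bs c = c) \<longrightarrow> recombine bs U = U)"
    if "U \<in> carrier T.T" for U
    using that
  proof (induction rule: T.tensor_induct)
    case (pure c x)
    then show ?case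
      by (intro exI[of _ "{c}"]) (simp add: recombine_pure)
  next
    case (add U V)
    then obtain Y Y' where "finite Y" "Y \<subseteq> carrier L" "finite Y'" "Y' \<subseteq> carrier L"
        "\<forall>bs. coordinates bs \<longrightarrow> (\<forall>c\<in>Y. coord_sum bs c = c) \<longrightarrow> recombine bs U = U"
        "\<forall>bs. coordinates bs \<longrightarrow> (\<forall>c\<in>Y'. coord_sum bs c = c) \<longrightarrow> recombine bs V = V"
      by blast
    then show ?case
      using add(1,2) by (intro exI[of _ "Y \<union> Y'"]) (simp add: recombine_add)
  qed
  then obtain Y where Y: "\<And>U. U \<in> Z \<Longrightarrow> finite (Y U) \<and> Y U \<subseteq> carrier L \<and>
      (\<forall>bs. coordinates bs \<longrightarrow> (\<forall>c\<in>Y U. coord_sum bs c = c) \<longrightarrow> recombine bs U = U)"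
    using assms(2) by (metis subsetD)
  have "finite (\<Union>(Y ` Z))" "\<Union>(Y ` Z) \<subseteq> carrier L"
    using assms(1) Y by auto
  then obtain bs where bs: "coordinates bs" "\<And>c. c \<in> \<Union>(Y ` Z) \<Longrightarrow> coord_sum bs c = c"
    by (rule coordinates_exist) (rule that)
  then show thesis
    using that[OF bs(1)] Y by blast
qed

end

section \<open>Separability and the lifting of functionals along Frobenius\<close>

lemma (in algebra) add_pow_one: "add_pow M (n::nat) \<one>\<^bsub>M\<^esub> = (add_pow R n \<one>\<^bsub>R\<^esub>) \<odot>\<^bsub>M\<^esub> \<one>\<^bsub>M\<^esub>"
  by (induction n) (simp_all add: add.nat_pow_Suc R.add.nat_pow_Suc smult_l_distr)

text \<open>The extension \<open>k \<subseteq> k\<^bsup>1/p\<^esup>\<close>, realised as \<open>k\<close> acting on itself through the Frobenius map. It is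
  carried by singleton lists because \<^const>\<open>separable_algebra\<close> quantifies over fields in \<^typ>\<open>'k list\<close>.\<close>

definition frobenius_extension :: "('k, 'x) ring_scheme \<Rightarrow> nat \<Rightarrow> ('k, 'k list) module"
  where "frobenius_extension k p =
    \<lparr>carrier = (\<lambda>a. [a]) ` carrier k, monoid.mult = (\<lambda>x y. [hd x \<otimes>\<^bsub>k\<^esub> hd y]), monoid.one = [\<one>\<^bsub>k\<^esub>],
     ring.zero = [\<zero>\<^bsub>k\<^esub>], ring.add = (\<lambda>x y. [hd x \<oplus>\<^bsub>k\<^esub> hd y]),
     module.smult = (\<lambda>r x. [(r [^]\<^bsub>k\<^esub> p) \<otimes>\<^bsub>k\<^esub> hd x])\<rparr>"

locale char_p_field = k: field k for k :: "('k, 'x) ring_scheme" +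
  fixes p :: nat
  assumes prime: "normalization_semidom_class.prime p"
    and add_pow_p: "add_pow k p \<one>\<^bsub>k\<^esub> = \<zero>\<^bsub>k\<^esub>"
begin

abbreviation "K \<equiv> frobenius_extension k p"

lemma p_pos: "p > 0"
  using prime prime_gt_0_nat by blast

lemma frobenius_add: "x \<in> carrier k \<Longrightarrow> y \<in> carrier k \<Longrightarrow> (x \<oplus>\<^bsub>k\<^esub> y) [^]\<^bsub>k\<^esub> p = x [^]\<^bsub>k\<^esub> p \<oplus>\<^bsub>k\<^esub> y [^]\<^bsub>k\<^esub> p"
  using k.add_power_prime[OF prime add_pow_p] .

lemma cring_K: "cring K"
proof (rule cringI)
  show "abelian_group K"
  proof (rule abelian_groupI)
    fix x assume "x \<in> carrier K"
    then show "\<exists>y\<in>carrier K. y \<oplus>\<^bsub>K\<^esub> x = \<zero>\<^bsub>K\<^esub>"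
      by (auto simp: frobenius_extension_def intro!: bexI[of _ "\<ominus>\<^bsub>k\<^esub> _"] k.l_neg)
  qed (auto simp: frobenius_extension_def k.a_ac)
  show "comm_monoid K"
    by (rule comm_monoidI) (auto simp: frobenius_extension_def k.m_ac)
qed (auto simp: frobenius_extension_def k.l_distr)

lemma field_K: "field K"
proof (rule cring.cring_fieldI2[OF cring_K])
  show "\<zero>\<^bsub>K\<^esub> \<noteq> \<one>\<^bsub>K\<^esub>"
    by (simp add: frobenius_extension_def)
  fix x assume "x \<in> carrier K" "x \<noteq> \<zero>\<^bsub>K\<^esub>"
  then obtain a where a: "x = [a]" "a \<in> carrier k" "a \<noteq> \<zero>\<^bsub>k\<^esub>"
    by (auto simp: frobenius_extension_def)
  then have "a \<in> Units k"
    by (simp add: k.field_Units)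
  then show "\<exists>y\<in>carrier K. x \<otimes>\<^bsub>K\<^esub> y = \<one>\<^bsub>K\<^esub>"
    using a by (auto simp: frobenius_extension_def intro!: bexI[of _ "inv\<^bsub>k\<^esub> a"])
qed

lemma algebra_K: "algebra k K"
  by (rule algebraI[OF k.is_cring cring_K])
    (auto simp: frobenius_extension_def frobenius_add k.nat_pow_distrib k.l_distr k.r_distr k.m_ac)

end

locale separable_setting = char_p_field k p + L: algebra k L
  for k :: "('k, 'x) ring_scheme" and L :: "('k, 'l, 'y) module_scheme" and p :: nat +
  assumes separable: "separable_algebra k L"
begin

sublocale vector_space_over k L
  by unfold_locales

sublocale KL: base_change_algebra k K L
  by (intro base_change_algebra.intro algebra_K L.algebra_axioms)

lemma add_pow_L: "add_pow L p \<one>\<^bsub>L\<^esub> = \<zero>\<^bsub>L\<^esub>"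
  by (simp add: L.add_pow_one add_pow_p)

lemma frobenius_add_L: "x \<in> carrier L \<Longrightarrow> y \<in> carrier L \<Longrightarrow> (x \<oplus>\<^bsub>L\<^esub> y) [^]\<^bsub>L\<^esub> p = x [^]\<^bsub>L\<^esub> p \<oplus>\<^bsub>L\<^esub> y [^]\<^bsub>L\<^esub> p"
  using L.add_power_prime[OF prime add_pow_L] .

lemma power_smult_L: "r \<in> carrier k \<Longrightarrow> c \<in> carrier L \<Longrightarrow> (r \<odot>\<^bsub>L\<^esub> c) [^]\<^bsub>L\<^esub> (n::nat) = (r [^]\<^bsub>k\<^esub> n) \<odot>\<^bsub>L\<^esub> (c [^]\<^bsub>L\<^esub> n)"
proof (induction n)
  case (Suc n)
  have "(r [^]\<^bsub>k\<^esub> n \<odot>\<^bsub>L\<^esub> c [^]\<^bsub>L\<^esub> n) \<otimes>\<^bsub>L\<^esub> (r \<odot>\<^bsub>L\<^esub> c) = r [^]\<^bsub>k\<^esub> n \<odot>\<^bsub>L\<^esub> (r \<odot>\<^bsub>L\<^esub> (c [^]\<^bsub>L\<^esub> n \<otimes>\<^bsub>L\<^esub> c))"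
    using Suc.prems L.smult_assoc2[of r c "c [^]\<^bsub>L\<^esub> n"]
    by (simp add: L.smult_assoc2 L.m_comm[of "c [^]\<^bsub>L\<^esub> n"])
  then show ?case
    using Suc by (simp add: L.smult_assoc1)
qed simp

text \<open>For \<open>z = \<Sum> a\<^sub>i \<otimes> c\<^sub>i\<close> in \<open>k\<^bsup>1/p\<^esup> \<otimes> L\<close> one has \<open>z\<^sup>p = 1 \<otimes> \<Sum> a\<^sub>i c\<^sub>i\<^sup>p\<close>. Since the tensor product is reduced,
  a relation \<open>\<Sum> a\<^sub>i c\<^sub>i\<^sup>p = 0\<close> forces \<open>z = 0\<close> and hence \<open>\<Sum> a\<^sub>i \<phi>(c\<^sub>i)\<^sup>p = 0\<close>. So \<open>c\<^sup>p \<mapsto> \<phi>(c)\<^sup>p\<close> is well defined on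
  the span of the \<open>p\<close>-th powers.\<close>

lemma frobenius_functional:
  assumes "linear_functional k L \<phi>"
  obtains \<phi>' where "linear_functional k L \<phi>'" "\<And>c. c \<in> carrier L \<Longrightarrow> \<phi>' (c [^]\<^bsub>L\<^esub> p) = \<phi> c [^]\<^bsub>k\<^esub> p"
proof -
  let ?B = "base_change k K L"
  note \<phi> = linear_functional_simps[OF assms]
  \<comment> \<open>A list \<open>[a]\<close> stands for the \<open>p\<close>-th root of
    \<open>a\<close>. So \<open>\<alpha>\<close> computes the \<open>p\<close>-th power of a tensor
    as an element of \<open>L\<close>, and \<open>\<beta>\<close> does the same after applying
    \<open>\<phi>\<close> to the second factor.\<close>
  define \<alpha> where "\<alpha> = tensor_lift k K L (add_monoid L) (\<lambda>a c. hd a \<odot>\<^bsub>L\<^esub> (c [^]\<^bsub>L\<^esub> p))"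
  define \<beta> where "\<beta> = tensor_lift k K L (add_monoid k) (\<lambda>a c. hd a \<otimes>\<^bsub>k\<^esub> (\<phi> c [^]\<^bsub>k\<^esub> p))"
  have K: "hd a \<in> carrier k" "a = [hd a]" if "a \<in> carrier K" for a
    using that by (auto simp: frobenius_extension_def)
  have K_simps: "hd (a \<oplus>\<^bsub>K\<^esub> b) = hd a \<oplus>\<^bsub>k\<^esub> hd b" "hd (a \<otimes>\<^bsub>K\<^esub> b) = hd a \<otimes>\<^bsub>k\<^esub> hd b"
    "hd (r \<odot>\<^bsub>K\<^esub> a) = (r [^]\<^bsub>k\<^esub> p) \<otimes>\<^bsub>k\<^esub> hd a" for r a b
    by (simp_all add: frobenius_extension_def)
  have "balanced k K L (add_monoid L) (\<lambda>a c. hd a \<odot>\<^bsub>L\<^esub> (c [^]\<^bsub>L\<^esub> p))"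
  proof (rule balancedI)
    fix r a c assume c: "r \<in> carrier k" "a \<in> carrier K" "c \<in> carrier L"
    show "hd (r \<odot>\<^bsub>K\<^esub> a) \<odot>\<^bsub>L\<^esub> (c [^]\<^bsub>L\<^esub> p) = hd a \<odot>\<^bsub>L\<^esub> ((r \<odot>\<^bsub>L\<^esub> c) [^]\<^bsub>L\<^esub> p)"
      using c K(1)[OF c(2)]
      by (simp add: K_simps power_smult_L k.m_comm[of "r [^]\<^bsub>k\<^esub> p"] flip: L.smult_assoc1)
  qed (simp_all add: K K_simps L.smult_l_distr L.smult_r_distr frobenius_add_L)
  note \<alpha> = KL.T.tensor_lift[OF L.a_comm_group this, folded \<alpha>_def]
  have "balanced k K L (add_monoid k) (\<lambda>a c. hd a \<otimes>\<^bsub>k\<^esub> (\<phi> c [^]\<^bsub>k\<^esub> p))"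
  proof (rule balancedI)
    fix r a c assume c: "r \<in> carrier k" "a \<in> carrier K" "c \<in> carrier L"
    show "hd (r \<odot>\<^bsub>K\<^esub> a) \<otimes>\<^bsub>k\<^esub> (\<phi> c [^]\<^bsub>k\<^esub> p) = hd a \<otimes>\<^bsub>k\<^esub> (\<phi> (r \<odot>\<^bsub>L\<^esub> c) [^]\<^bsub>k\<^esub> p)"
      using c K(1)[OF c(2)] by (simp add: K_simps \<phi> k.nat_pow_distrib k.m_ac)
  qed (simp_all add: K K_simps \<phi> k.l_distr k.r_distr frobenius_add)
  note \<beta> = KL.T.tensor_lift[OF k.a_comm_group this, folded \<beta>_def]
  have \<alpha>c: "\<alpha> z \<in> carrier L" and \<beta>c: "\<beta> z \<in> carrier k" if "z \<in> carrier KL.T.T" for z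
    using hom_in_carrier[OF \<alpha>(1) that] hom_in_carrier[OF \<beta>(1) that] by simp_all
  have \<alpha>_add: "\<alpha> (z \<otimes>\<^bsub>KL.T.T\<^esub> w) = \<alpha> z \<oplus>\<^bsub>L\<^esub> \<alpha> w" and \<beta>_add: "\<beta> (z \<otimes>\<^bsub>KL.T.T\<^esub> w) = \<beta> z \<oplus>\<^bsub>k\<^esub> \<beta> w"
    if "z \<in> carrier KL.T.T" "w \<in> carrier KL.T.T" for z w
    using hom_mult[OF \<alpha>(1) that] hom_mult[OF \<beta>(1) that] by simp_all
  interpret B: algebra K ?B
    by (rule KL.algebra_B)
  have K1: "\<one>\<^bsub>K\<^esub> = [\<one>\<^bsub>k\<^esub>]"
    by (simp add: frobenius_extension_def)
  have "add_pow K p \<one>\<^bsub>K\<^esub> = \<zero>\<^bsub>K\<^esub>"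
    using algebra.add_pow_one[OF algebra_K, of p] add_pow_p module.smult_l_null[of k K] algebra_K
    by (simp add: algebra_def)
  then have "add_pow ?B p \<one>\<^bsub>?B\<^esub> = \<zero>\<^bsub>?B\<^esub>"
    by (simp add: B.add_pow_one)
  note B_frob = B.add_power_prime[OF prime this]
  have pure_pow: "KL.T.pt a c [^]\<^bsub>?B\<^esub> n = KL.T.pt (a [^]\<^bsub>K\<^esub> n) (c [^]\<^bsub>L\<^esub> n)"
    if "a \<in> carrier K" "c \<in> carrier L" for a c and n :: nat
    using that KL.L.nat_pow_closed
    by (induction n) (simp_all add: KL.B_simps(2) KL.mult_pure)
  have K_pow: "[r] [^]\<^bsub>K\<^esub> n = [r [^]\<^bsub>k\<^esub> n]" for r and n :: nat
    by (induction n) (simp_all add: frobenius_extension_def)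
  have power: "z [^]\<^bsub>?B\<^esub> p = KL.T.pt \<one>\<^bsub>K\<^esub> (\<alpha> z)" if "z \<in> carrier KL.T.T" for z
    using that
  proof (induction rule: KL.T.tensor_induct)
    case (pure a c)
    then obtain r where r: "a = [r]" "r \<in> carrier k"
      using K by metis
    have "a [^]\<^bsub>K\<^esub> p = r \<odot>\<^bsub>K\<^esub> \<one>\<^bsub>K\<^esub>"
      using r by (simp add: K_pow K1) (simp add: frobenius_extension_def)
    then show ?case
      using pure r by (simp add: pure_pow \<alpha>(2) KL.T.pure_smult)
  next
    case (add z w)
    then show ?case
      using B_frob[of z w] by (simp add: KL.B_simps(1,4) \<alpha>_add \<alpha>c KL.T.pure_add_right)
  qed
  have red: "reduced_ring ?B"
    using separable field_K algebra_K by (simp add: separable_algebra_def)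
  \<comment> \<open>The partial functional sending \<open>\<alpha> z\<close> to
    \<open>\<beta> z\<close>. Its single-valuedness over zero is where reducedness enters, and
    \<open>functional_extend\<close> then defines it on all of \<open>L\<close>.\<close>
  define G where "G = {(\<alpha> z, \<beta> z) | z. z \<in> carrier KL.T.T}"
  have GI: "(\<alpha> z, \<beta> z) \<in> G" if "z \<in> carrier KL.T.T" for z
    using that by (auto simp: G_def)
  have \<alpha>0: "\<alpha> \<one>\<^bsub>KL.T.T\<^esub> = \<zero>\<^bsub>L\<^esub>" and \<beta>0: "\<beta> \<one>\<^bsub>KL.T.T\<^esub> = \<zero>\<^bsub>k\<^esub>"
    using hom_one[OF \<alpha>(1) KL.T.T.is_group L.a_group] hom_one[OF \<beta>(1) KL.T.T.is_group k.a_group] by simp_all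
  have "linear_graph k L G"
    unfolding linear_graph_def
  proof (intro conjI allI impI ballI)
    show "G \<subseteq> carrier L \<times> carrier k"
      using \<alpha>c \<beta>c by (auto simp: G_def)
    show "(\<zero>\<^bsub>L\<^esub>, \<zero>\<^bsub>k\<^esub>) \<in> G"
      using GI[of "\<one>\<^bsub>KL.T.T\<^esub>"] by (simp add: \<alpha>0 \<beta>0)
  next
    fix x s y t assume "(x, s) \<in> G" "(y, t) \<in> G"
    then obtain z w where "z \<in> carrier KL.T.T" "w \<in> carrier KL.T.T" "x = \<alpha> z" "s = \<beta> z" "y = \<alpha> w" "t = \<beta> w"
      unfolding G_def by blast
    then show "(x \<oplus>\<^bsub>L\<^esub> y, s \<oplus>\<^bsub>k\<^esub> t) \<in> G"
      using GI[of "z \<otimes>\<^bsub>KL.T.T\<^esub> w"] by (simp add: \<alpha>_add \<beta>_add)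
  next
    fix r x s assume r: "r \<in> carrier k" and "(x, s) \<in> G"
    then obtain z where z: "z \<in> carrier KL.T.T" "x = \<alpha> z" "s = \<beta> z"
      unfolding G_def by blast
    have rK: "[r] \<in> carrier K"
      using r by (simp add: frobenius_extension_def)
    \<comment> \<open>Multiplying \<open>z\<close> by \<open>[r]\<close>, the \<open>p\<close>-th
      root of \<open>r\<close>, multiplies both values by \<open>r\<close>; this makes
      \<open>G\<close> linear over \<open>k\<close>.\<close>
    from z(1) have "\<alpha> ([r] \<odot>\<^bsub>?B\<^esub> z) = r \<odot>\<^bsub>L\<^esub> \<alpha> z \<and> \<beta> ([r] \<odot>\<^bsub>?B\<^esub> z) = r \<otimes>\<^bsub>k\<^esub> \<beta> z"
    proof (induction rule: KL.T.tensor_induct)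
      case (pure a c)
      then show ?case
        using K(1)[OF pure(1)] r KL.L.m_closed[OF rK pure(1)]
        by (simp add: KL.smult_pure[OF rK] \<alpha>(2) \<beta>(2) K_simps L.smult_assoc1 k.m_assoc \<phi>)
    next
      case (add u v)
      then show ?case
        using r by (simp add: KL.smult_add[OF rK] KL.smult_closed[OF rK] \<alpha>_add \<beta>_add \<alpha>c \<beta>c L.smult_r_distr k.r_distr)
    qed
    then show "(r \<odot>\<^bsub>L\<^esub> x, r \<otimes>\<^bsub>k\<^esub> s) \<in> G"
      using GI[OF KL.smult_closed[OF rK z(1)]] z by simp
  next
    fix s assume "(\<zero>\<^bsub>L\<^esub>, s) \<in> G"
    then obtain z where z: "z \<in> carrier KL.T.T" "\<alpha> z = \<zero>\<^bsub>L\<^esub>" "s = \<beta> z"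
      unfolding G_def by auto
    have "z [^]\<^bsub>?B\<^esub> p = \<zero>\<^bsub>?B\<^esub>"
      using power[OF z(1)] z(2) by (simp add: KL.B_simps(3))
    then have "z = \<one>\<^bsub>KL.T.T\<^esub>"
      using red z(1) unfolding reduced_ring_def KL.B_simps(1,3) by blast
    then show "s = \<zero>\<^bsub>k\<^esub>"
      using z(3) \<beta>0 by simp
  qed
  then obtain \<phi>' where \<phi>': "linear_functional k L \<phi>'" "\<And>x s. (x, s) \<in> G \<Longrightarrow> \<phi>' x = s"
    by (rule functional_extend) (rule that)
  have "\<phi>' (c [^]\<^bsub>L\<^esub> p) = \<phi> c [^]\<^bsub>k\<^esub> p" if c: "c \<in> carrier L" for c
  proof -
    have "(\<alpha> (KL.T.pt \<one>\<^bsub>K\<^esub> c), \<beta> (KL.T.pt \<one>\<^bsub>K\<^esub> c)) \<in> G"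
      using c by (intro GI) simp
    then show ?thesis
      using c \<phi>'(2) by (simp add: \<alpha>(2) \<beta>(2) K1[symmetric], simp add: K1 \<phi>)
  qed
  then show thesis
    using that \<phi>'(1) by blast
qed

end

section \<open>Base change of derivations\<close>

lemma module_homsI:
  assumes "\<And>x. x \<in> carrier M \<Longrightarrow> f x \<in> carrier N" "f \<in> extensional (carrier M)"
    and "\<And>x y. x \<in> carrier M \<Longrightarrow> y \<in> carrier M \<Longrightarrow> f (x \<oplus>\<^bsub>M\<^esub> y) = f x \<oplus>\<^bsub>N\<^esub> f y"
    and "\<And>r x. r \<in> carrier R \<Longrightarrow> x \<in> carrier M \<Longrightarrow> f (r \<odot>\<^bsub>M\<^esub> x) = r \<odot>\<^bsub>N\<^esub> f x"
  shows "f \<in> module_homs R M N"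
  using assms unfolding module_homs_def PiE_def by blast

lemma module_homsD:
  assumes "f \<in> module_homs R M N"
  shows "x \<in> carrier M \<Longrightarrow> f x \<in> carrier N" "f \<in> extensional (carrier M)"
    "x \<in> carrier M \<Longrightarrow> y \<in> carrier M \<Longrightarrow> f (x \<oplus>\<^bsub>M\<^esub> y) = f x \<oplus>\<^bsub>N\<^esub> f y"
    "r \<in> carrier R \<Longrightarrow> x \<in> carrier M \<Longrightarrow> f (r \<odot>\<^bsub>M\<^esub> x) = r \<odot>\<^bsub>N\<^esub> f x"
  using assms unfolding module_homs_def PiE_def by blast+

lemma IDer_module_homs: "\<delta> \<in> IDer k A m \<Longrightarrow> \<delta> \<in> module_homs k A A"
  and IDer_Der: "\<delta> \<in> IDer k A m \<Longrightarrow> \<delta> \<in> Der k A"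
  by (auto simp: IDer_def Der_def)

lemma IDer_antimono: "m \<le> n \<Longrightarrow> IDer k A n \<subseteq> IDer k A m"
proof
  fix \<delta> assume "m \<le> n" "\<delta> \<in> IDer k A n"
  then obtain D where D: "\<delta> \<in> Der k A" "hasse_schmidt k A n D" "D 1 = \<delta>"
    unfolding IDer_def by blast
  have "hasse_schmidt k A m D"
    using D(2) \<open>m \<le> n\<close> unfolding hasse_schmidt_def by simp
  then show "\<delta> \<in> IDer k A m"
    using D unfolding IDer_def by blast
qed

locale separable_base_change = separable_setting k L p + A: algebra k A
  for k :: "('k, 'x) ring_scheme" and L :: "('k, 'l, 'y) module_scheme"
    and A :: "('k, 'a, 'z) module_scheme" and p :: nat +
  assumes fin_gen: "fin_gen_algebra k A"
begin

sublocale BC: base_change_algebra k L A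
  by unfold_locales

sublocale TA: tensor_vector_space k L A
  by unfold_locales

abbreviation "B \<equiv> base_change k L A"
abbreviation "T \<equiv> tensor_group k L A"
abbreviation "pt \<equiv> pure_tensor k L A"

lemma add_pow_A: "add_pow A p \<one>\<^bsub>A\<^esub> = \<zero>\<^bsub>A\<^esub>"
  by (simp add: A.add_pow_one add_pow_p)

sublocale CA: char_p_algebra p k A
  by unfold_locales (rule prime add_pow_A)+

sublocale B: algebra L B
  by (rule BC.algebra_B)

lemma add_pow_B: "add_pow B p \<one>\<^bsub>B\<^esub> = \<zero>\<^bsub>B\<^esub>"
  by (simp add: B.add_pow_one add_pow_L)

sublocale CB: char_p_algebra p L B
  by unfold_locales (rule prime add_pow_B)+

lemmas B_simps = BC.B_simps(1-4)

lemma pt_closed: "c \<in> carrier L \<Longrightarrow> a \<in> carrier A \<Longrightarrow> pt c a \<in> carrier B"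
  by (simp add: B_simps)

lemma pt_add_right: "c \<in> carrier L \<Longrightarrow> a \<in> carrier A \<Longrightarrow> b \<in> carrier A \<Longrightarrow> pt c (a \<oplus>\<^bsub>A\<^esub> b) = pt c a \<oplus>\<^bsub>B\<^esub> pt c b"
  by (simp add: B_simps BC.T.pure_add_right)

lemma smult_one_B: "c \<in> carrier L \<Longrightarrow> c \<odot>\<^bsub>B\<^esub> \<one>\<^bsub>B\<^esub> = pt c \<one>\<^bsub>A\<^esub>"
  by (simp only: B_simps(2)) (simp add: BC.smult_pure)

lemma pt_smult: "c \<in> carrier L \<Longrightarrow> a \<in> carrier A \<Longrightarrow> pt c a = c \<odot>\<^bsub>B\<^esub> pt \<one>\<^bsub>L\<^esub> a"
  by (simp add: BC.smult_pure)

lemma pt_power: "c \<in> carrier L \<Longrightarrow> pt c \<one>\<^bsub>A\<^esub> [^]\<^bsub>B\<^esub> (n::nat) = pt (c [^]\<^bsub>L\<^esub> n) \<one>\<^bsub>A\<^esub>"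
  by (induction n) (simp_all add: B_simps(2) BC.mult_pure)

lemma B_hom_eqI:
  assumes "f \<in> module_homs L B B" "g \<in> module_homs L B B"
    and "\<And>a. a \<in> carrier A \<Longrightarrow> f (pt \<one>\<^bsub>L\<^esub> a) = g (pt \<one>\<^bsub>L\<^esub> a)"
  shows "f = g"
proof (rule extensionalityI[OF module_homsD(2)[OF assms(1)] module_homsD(2)[OF assms(2)]])
  fix z assume "z \<in> carrier B"
  then show "f z = g z"
    unfolding B_simps(1)
  proof (induction rule: BC.T.tensor_induct)
    case (pure c a)
    then show ?case
      using assms(3)[of a] module_homsD(4)[OF assms(1), of c "pt \<one>\<^bsub>L\<^esub> a"] module_homsD(4)[OF assms(2), of c "pt \<one>\<^bsub>L\<^esub> a"]
      by (simp add: pt_smult[of c a] pt_closed)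
  next
    case (add u v)
    then show ?case
      using module_homsD(3)[OF assms(1), of u v] module_homsD(3)[OF assms(2), of u v] by (simp add: B_simps)
  qed
qed

lemma extend_der:
  assumes h: "h \<in> module_homs k A A"
  shows "extend_der k L A h \<in> module_homs L B B"
    "c \<in> carrier L \<Longrightarrow> a \<in> carrier A \<Longrightarrow> extend_der k L A h (pt c a) = pt c (h a)"
proof -
  note h = module_homsD[OF h]
  have "balanced k L A T (\<lambda>c a. pt c (h a))"
    by (rule balancedI) (simp_all add: h(1,3,4) BC.T.pure_add_left BC.T.pure_add_right BC.T.pure_smult)
  note lift = BC.T.tensor_lift[OF BC.T.T.comm_group_axioms this, folded extend_der_def]
  then show ext_pure: "extend_der k L A h (pt c a) = pt c (h a)" if "c \<in> carrier L" "a \<in> carrier A" for c a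
    using that by blast
  have lift_add: "extend_der k L A h (U \<otimes>\<^bsub>T\<^esub> V) = extend_der k L A h U \<otimes>\<^bsub>T\<^esub> extend_der k L A h V"
    if "U \<in> carrier T" "V \<in> carrier T" for U V
    using hom_mult[OF lift(1) that] .
  have closed: "extend_der k L A h U \<in> carrier T" if "U \<in> carrier T" for U
    using hom_in_carrier[OF lift(1) that] .
  show "extend_der k L A h \<in> module_homs L B B"
  proof (rule module_homsI)
    show "extend_der k L A h \<in> extensional (carrier B)"
      unfolding extend_der_def B_simps(1) by (rule BC.T.tensor_lift_extensional)
    fix c U assume c: "c \<in> carrier L" and "U \<in> carrier B"
    from this(2) show "extend_der k L A h (c \<odot>\<^bsub>B\<^esub> U) = c \<odot>\<^bsub>B\<^esub> extend_der k L A h U"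
      unfolding B_simps(1)
    proof (induction rule: BC.T.tensor_induct)
      case (pure d a)
      then show ?case
        using c by (simp add: BC.smult_pure ext_pure h(1))
    next
      case (add u v)
      then show ?case
        using c by (simp add: BC.smult_add BC.smult_closed lift_add closed)
    qed
  qed (simp_all add: B_simps lift_add closed)
qed

lemma push_mult:
  assumes "linear_functional k L \<phi>" "a \<in> carrier A" "U \<in> carrier T"
  shows "TA.push \<phi> (pt \<one>\<^bsub>L\<^esub> a \<otimes>\<^bsub>B\<^esub> U) = a \<otimes>\<^bsub>A\<^esub> TA.push \<phi> U"
  using assms(3)
proof (induction rule: BC.T.tensor_induct)
  case (pure c b)
  then show ?case
    using assms A.smult_assoc2[of "\<phi> c" b a] linear_functional_simps(1)[OF assms(1) pure(1)]
    by (simp add: BC.mult_pure TA.push_pure A.m_comm[of a])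
next
  case (add u v)
  then show ?case
    using assms by (simp add: BC.mult_add_right BC.mult_closed TA.push_add TA.push_closed A.r_distr)
qed

text \<open>Compatibility with multiplication by \<open>1 \<otimes> a\<close>. It lets the property
  of being fixed by \<open>recombine\<close> pass through the Leibniz rule, from generators to all
  of \<open>A\<close>.\<close>

lemma recombine_mult:
  assumes "coordinates bs" "a \<in> carrier A" "U \<in> carrier T"
  shows "TA.recombine bs (pt \<one>\<^bsub>L\<^esub> a \<otimes>\<^bsub>B\<^esub> U) = pt \<one>\<^bsub>L\<^esub> a \<otimes>\<^bsub>B\<^esub> TA.recombine bs U"
  using assms(1)
proof (induction bs)
  case Nil
  have "pt \<one>\<^bsub>L\<^esub> a \<otimes>\<^bsub>B\<^esub> \<zero>\<^bsub>B\<^esub> = \<zero>\<^bsub>B\<^esub>"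
    using assms(2) by (intro B.r_null pt_closed) simp_all
  then show ?case
    by (simp add: B_simps)
next
  case (Cons b bs)
  then have b: "coordinates bs" "fst b \<in> carrier L" "linear_functional k L (snd b)"
    by (auto simp: coordinates_def)
  then have "pt (fst b) (a \<otimes>\<^bsub>A\<^esub> TA.push (snd b) U) = pt \<one>\<^bsub>L\<^esub> a \<otimes>\<^bsub>B\<^esub> pt (fst b) (TA.push (snd b) U)"
    using assms by (simp add: BC.mult_pure TA.push_closed)
  then show ?case
    using Cons b assms by (simp add: push_mult BC.mult_add_right TA.push_closed TA.recombine_closed)
qed

text \<open>A derivation is determined by its values on the finitely many generators of \<open>A\<close>, and these lie in
  \<open>V \<otimes> A\<close> for a finite-dimensional \<open>V \<subseteq> L\<close>.\<close>

lemma recombine_derivation: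
  assumes E: "E \<in> Der L B"
  obtains bs where "coordinates bs" "\<And>a. a \<in> carrier A \<Longrightarrow> TA.recombine bs (E (pt \<one>\<^bsub>L\<^esub> a)) = E (pt \<one>\<^bsub>L\<^esub> a)"
proof -
  have Eh: "E \<in> module_homs L B B"
    and E_mult: "\<And>U V. U \<in> carrier B \<Longrightarrow> V \<in> carrier B \<Longrightarrow> E (U \<otimes>\<^bsub>B\<^esub> V) = E U \<otimes>\<^bsub>B\<^esub> V \<oplus>\<^bsub>B\<^esub> U \<otimes>\<^bsub>B\<^esub> E V"
    using E by (auto simp: Der_def)
  note Eh = module_homsD[OF Eh]
  obtain S where S: "finite S" "S \<subseteq> carrier A"
      "generate_ring A ((\<lambda>r. r \<odot>\<^bsub>A\<^esub> \<one>\<^bsub>A\<^esub>) ` carrier k \<union> S) = carrier A"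
    using fin_gen by (auto simp: fin_gen_algebra_def)
  let ?F = "\<lambda>a. E (pt \<one>\<^bsub>L\<^esub> a)"
  have Fc: "?F a \<in> carrier T" if "a \<in> carrier A" for a
    using Eh(1)[OF pt_closed[of "\<one>\<^bsub>L\<^esub>" a]] that by (simp add: B_simps)
  have "finite (?F ` S)" "?F ` S \<subseteq> carrier T"
    using S Fc by auto
  then obtain bs where bs: "coordinates bs" "\<And>U. U \<in> ?F ` S \<Longrightarrow> TA.recombine bs U = U"
    by (rule TA.recombine_exists) (rule that)
  have zero: "TA.recombine bs \<one>\<^bsub>T\<^esub> = \<one>\<^bsub>T\<^esub>"
    using TA.recombine_add[OF bs(1), of "\<one>\<^bsub>T\<^esub>" "\<one>\<^bsub>T\<^esub>"] TA.recombine_closed[OF bs(1), of "\<one>\<^bsub>T\<^esub>"] by simp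
  have E1: "E \<one>\<^bsub>B\<^esub> = \<zero>\<^bsub>B\<^esub>"
    using E_mult[of "\<one>\<^bsub>B\<^esub>" "\<one>\<^bsub>B\<^esub>"] Eh(1)[of "\<one>\<^bsub>B\<^esub>"] by simp
  have F_add: "?F (a \<oplus>\<^bsub>A\<^esub> b) = ?F a \<otimes>\<^bsub>T\<^esub> ?F b" if "a \<in> carrier A" "b \<in> carrier A" for a b
    using that Eh(3)[of "pt \<one>\<^bsub>L\<^esub> a" "pt \<one>\<^bsub>L\<^esub> b"] by (simp add: pt_add_right pt_closed) (simp add: B_simps)
  have F_mult: "?F (a \<otimes>\<^bsub>A\<^esub> b) = (pt \<one>\<^bsub>L\<^esub> b \<otimes>\<^bsub>B\<^esub> ?F a) \<otimes>\<^bsub>T\<^esub> (pt \<one>\<^bsub>L\<^esub> a \<otimes>\<^bsub>B\<^esub> ?F b)"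
    if "a \<in> carrier A" "b \<in> carrier A" for a b
  proof -
    have "pt \<one>\<^bsub>L\<^esub> (a \<otimes>\<^bsub>A\<^esub> b) = pt \<one>\<^bsub>L\<^esub> a \<otimes>\<^bsub>B\<^esub> pt \<one>\<^bsub>L\<^esub> b"
      using that by (simp add: BC.mult_pure)
    then show ?thesis
      using E_mult[of "pt \<one>\<^bsub>L\<^esub> a" "pt \<one>\<^bsub>L\<^esub> b"] that Eh(1)[of "pt \<one>\<^bsub>L\<^esub> a"]
      by (simp add: pt_closed B.m_comm) (simp add: B_simps)
  qed
  have "TA.recombine bs (?F a) = ?F a" if a: "a \<in> carrier A" for a
  proof -
    have "a \<in> generate_ring A ((\<lambda>r. r \<odot>\<^bsub>A\<^esub> \<one>\<^bsub>A\<^esub>) ` carrier k \<union> S)"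
      using a S(3) by simp
    then show ?thesis
    proof (induction rule: generate_ring.induct)
      case one
      have "?F \<one>\<^bsub>A\<^esub> = \<one>\<^bsub>T\<^esub>"
        using E1 by (simp add: B_simps)
      then show ?case
        by (simp add: zero)
    next
      case (incl h)
      then consider r where "r \<in> carrier k" "h = r \<odot>\<^bsub>A\<^esub> \<one>\<^bsub>A\<^esub>" | "h \<in> S"
        by blast
      then show ?case
      proof cases
        case 1
        have "pt \<one>\<^bsub>L\<^esub> h = (r \<odot>\<^bsub>L\<^esub> \<one>\<^bsub>L\<^esub>) \<odot>\<^bsub>B\<^esub> \<one>\<^bsub>B\<^esub>"
          using 1 by (simp add: smult_one_B flip: BC.T.pure_smult)
        then have "?F h = \<one>\<^bsub>T\<^esub>"
          using 1 Eh(4)[of "r \<odot>\<^bsub>L\<^esub> \<one>\<^bsub>L\<^esub>" "\<one>\<^bsub>B\<^esub>"] E1 B.smult_r_null[of "r \<odot>\<^bsub>L\<^esub> \<one>\<^bsub>L\<^esub>"] by (simp add: B_simps)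
        then show ?thesis
          by (simp add: zero)
      qed (simp add: bs(2))
    next
      case (a_inv h)
      then have h: "h \<in> carrier A"
        using S(3) by simp
      have "?F (\<ominus>\<^bsub>A\<^esub> h) \<otimes>\<^bsub>T\<^esub> ?F h = \<one>\<^bsub>T\<^esub>"
        using F_add[of "\<ominus>\<^bsub>A\<^esub> h" h] h Eh(4)[of "\<zero>\<^bsub>L\<^esub>" "\<zero>\<^bsub>B\<^esub>"] Eh(1)[of "\<zero>\<^bsub>B\<^esub>"] by (simp add: A.l_neg) (simp add: B_simps)
      moreover have "TA.recombine bs (?F (\<ominus>\<^bsub>A\<^esub> h)) \<otimes>\<^bsub>T\<^esub> ?F h = \<one>\<^bsub>T\<^esub>"
        using TA.recombine_add[OF bs(1) Fc Fc, of "\<ominus>\<^bsub>A\<^esub> h" h] h calculation zero a_inv.IH by simp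
      ultimately show ?case
        using h Fc[of h] Fc[of "\<ominus>\<^bsub>A\<^esub> h"] TA.recombine_closed[OF bs(1), of "?F (\<ominus>\<^bsub>A\<^esub> h)"]
        by (metis A.a_inv_closed BC.T.T.r_cancel)
    next
      case (eng_add a b)
      then show ?case
        using S(3) by (simp add: F_add TA.recombine_add bs(1) Fc)
    next
      case (eng_mult a b)
      then show ?case
        using S(3) by (simp add: F_mult TA.recombine_add bs(1) Fc recombine_mult BC.mult_closed)
    qed
  qed
  then show thesis
    using that bs(1) by blast
qed

text \<open>The canonical map from \<open>A\<close> to \<open>L \<otimes> A\<close>, carried over to
  the two product rings; elements outside the factor \<open>A\<close> are projected first.\<close>

definition inclusion :: "'a ring_product \<Rightarrow> ('l \<times> 'a \<Rightarrow>\<^sub>0 int) set ring_product"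
  where "inclusion x = emb B (pt \<one>\<^bsub>L\<^esub> (proj A x))"

definition functional_map :: "('l \<Rightarrow> 'k) \<Rightarrow> ('l \<times> 'a \<Rightarrow>\<^sub>0 int) set ring_product \<Rightarrow> 'a ring_product"
  where "functional_map \<phi> z = emb A (TA.push \<phi> (proj B z))"

text \<open>Puts \<open>recombine\<close> into the form of a sum over a list that the assumption
  \<open>decompose\<close> of \<open>base_change_setting\<close> asks for.\<close>

lemma emb_recombine:
  assumes "coordinates bs" "U \<in> carrier T"
  shows "emb B (TA.recombine bs U) =
    (\<Sum>(b, \<pi>)\<leftarrow>map (\<lambda>b. (emb B (fst b \<odot>\<^bsub>B\<^esub> \<one>\<^bsub>B\<^esub>), functional_map (snd b))) bs. b * inclusion (\<pi> (emb B U)))"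
  using assms(1)
proof (induction bs)
  case Nil
  then show ?case
    using B.emb_0 by (simp add: B_simps)
next
  case (Cons b bs)
  then have b: "coordinates bs" "fst b \<in> carrier L" "linear_functional k L (snd b)"
    by (auto simp: coordinates_def)
  have UB: "U \<in> carrier B"
    using assms(2) by (simp add: B_simps)
  have p: "TA.push (snd b) U \<in> carrier A"
    by (rule TA.push_closed[OF b(3) assms(2)])
  have "emb B (fst b \<odot>\<^bsub>B\<^esub> \<one>\<^bsub>B\<^esub>) * inclusion (functional_map (snd b) (emb B U)) = emb B (pt (fst b) (TA.push (snd b) U))"
    using b p UB by (simp add: inclusion_def functional_map_def smult_one_B BC.mult_pure pt_closed flip: B.emb_mult_emb)
  moreover have "emb B (TA.recombine (b # bs) U) = emb B (pt (fst b) (TA.push (snd b) U)) + emb B (TA.recombine bs U)"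
    using b p assms(2) B.emb_add[of "pt (fst b) (TA.push (snd b) U)" "TA.recombine bs U"]
    by (simp add: B_simps TA.recombine_closed)
  ultimately show ?case
    using Cons.IH[OF b(1)] by simp
qed

sublocale descent: base_change_setting p CA.scalars "emb A \<one>\<^bsub>A\<^esub>" CB.scalars "emb B \<one>\<^bsub>B\<^esub>"
  inclusion CB.scalars "functional_map ` {\<phi>. linear_functional k L \<phi>}"
proof unfold_locales
  fix x y
  show "inclusion (x + y) = inclusion x + inclusion y"
    by (simp add: inclusion_def A.proj_add pt_add_right pt_closed flip: B.emb_add)
  show "inclusion (x * y) = inclusion x * inclusion y"
    by (simp add: inclusion_def A.proj_mult BC.mult_pure pt_closed flip: B.emb_mult_emb)
next
  fix c assume "c \<in> CA.scalars"
  then obtain r where r: "r \<in> carrier k" "c = emb A (r \<odot>\<^bsub>A\<^esub> \<one>\<^bsub>A\<^esub>)"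
    by blast
  then have "inclusion c = emb B ((r \<odot>\<^bsub>L\<^esub> \<one>\<^bsub>L\<^esub>) \<odot>\<^bsub>B\<^esub> \<one>\<^bsub>B\<^esub>)"
    by (simp add: inclusion_def smult_one_B BC.T.pure_smult)
  then show "inclusion c \<in> CB.scalars"
    using r by simp
next
  fix b assume "b \<in> CB.scalars"
  then obtain c where c: "c \<in> carrier L" "b = emb B (pt c \<one>\<^bsub>A\<^esub>)"
    by (auto simp: smult_one_B)
  then have "b ^ p = emb B ((c [^]\<^bsub>L\<^esub> p) \<odot>\<^bsub>B\<^esub> \<one>\<^bsub>B\<^esub>)"
    using p_pos by (simp add: smult_one_B pt_power pt_closed flip: B.emb_power)
  then show "b ^ p \<in> CB.scalars"
    using c by simp
next
  fix \<pi> z w x assume "\<pi> \<in> functional_map ` {\<phi>. linear_functional k L \<phi>}"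
  then obtain \<phi> where \<phi>: "linear_functional k L \<phi>" "\<pi> = functional_map \<phi>"
    by blast
  have q: "proj B v \<in> carrier T" for v
    using B.proj_closed[of v] by (simp add: B_simps)
  have "proj B (z + w) = proj B z \<otimes>\<^bsub>T\<^esub> proj B w"
    by (simp add: B.proj_add) (simp add: B_simps)
  then show "\<pi> (z + w) = \<pi> z + \<pi> w"
    using q by (simp add: \<phi> functional_map_def TA.push_add TA.push_closed flip: A.emb_add)
  show "\<pi> (inclusion x * w) = x * \<pi> w"
    using q[of w] \<phi>(1)
    by (simp add: \<phi>(2) functional_map_def inclusion_def B.proj_mult pt_closed push_mult
        mult.commute[of x] A.emb_mult TA.push_closed A.m_comm)
  show "emb A \<one>\<^bsub>A\<^esub> * \<pi> w = \<pi> w"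
    using q[of w] \<phi>(1) by (simp add: \<phi>(2) functional_map_def A.emb_one_mult TA.push_closed)
next
  fix \<pi> assume "\<pi> \<in> functional_map ` {\<phi>. linear_functional k L \<phi>}"
  then obtain \<phi> where \<phi>: "linear_functional k L \<phi>" "\<pi> = functional_map \<phi>"
    by blast
  obtain \<phi>' where \<phi>': "linear_functional k L \<phi>'" "\<And>c. c \<in> carrier L \<Longrightarrow> \<phi>' (c [^]\<^bsub>L\<^esub> p) = \<phi> c [^]\<^bsub>k\<^esub> p"
    using frobenius_functional[OF \<phi>(1)] by blast
  have one_pow: "(r \<odot>\<^bsub>A\<^esub> \<one>\<^bsub>A\<^esub>) [^]\<^bsub>A\<^esub> (n::nat) = (r [^]\<^bsub>k\<^esub> n) \<odot>\<^bsub>A\<^esub> \<one>\<^bsub>A\<^esub>" if "r \<in> carrier k" for r n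
    using that by (induction n) (simp_all add: A.smult_assoc2 A.smult_assoc1)
  have "functional_map \<phi>' (c ^ p) = functional_map \<phi> c ^ p" if c: "c \<in> CB.scalars" for c
  proof -
    obtain d where d: "d \<in> carrier L" "c = emb B (pt d \<one>\<^bsub>A\<^esub>)"
      using c by (auto simp: smult_one_B)
    then have "c ^ p = emb B (pt (d [^]\<^bsub>L\<^esub> p) \<one>\<^bsub>A\<^esub>)"
      using p_pos by (simp add: pt_power pt_closed flip: B.emb_power)
    then have "functional_map \<phi>' (c ^ p) = emb A ((\<phi> d [^]\<^bsub>k\<^esub> p) \<odot>\<^bsub>A\<^esub> \<one>\<^bsub>A\<^esub>)"
      using d \<phi>' by (simp add: functional_map_def pt_closed TA.push_pure)
    also have "\<dots> = functional_map \<phi> c ^ p"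
      using d \<phi>(1) p_pos linear_functional_simps(1)[OF \<phi>(1) d(1)]
      by (simp add: functional_map_def pt_closed TA.push_pure one_pow flip: A.emb_power)
    finally show ?thesis .
  qed
  then show "\<exists>\<pi>'\<in>functional_map ` {\<phi>. linear_functional k L \<phi>}. \<forall>c\<in>CB.scalars. \<pi>' (c ^ p) = \<pi> c ^ p"
    using \<phi>'(1) \<phi>(2) by blast
next
  fix E assume lin: "CB.P.lin E" and Leibniz: "\<And>x y. E (x * y) = x * E y + E x * y"
  \<comment> \<open>The derivation of \<open>B\<close> induced by \<open>E\<close>; for it the
    finite generation of \<open>A\<close> provides the coordinates.\<close>
  define E0 where "E0 = (\<lambda>U\<in>carrier B. proj B (E (emb B U)))"
  have "E0 \<in> Der L B"
    unfolding Der_def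
  proof (intro CollectI conjI ballI)
    show "E0 \<in> module_homs L B B"
      unfolding E0_def by (rule CB.lin_project[OF lin])
    fix U V assume "U \<in> carrier B" "V \<in> carrier B"
    then show "E0 (U \<otimes>\<^bsub>B\<^esub> V) = E0 U \<otimes>\<^bsub>B\<^esub> V \<oplus>\<^bsub>B\<^esub> U \<otimes>\<^bsub>B\<^esub> E0 V"
      by (simp add: E0_def B.emb_mult_emb Leibniz B.proj_add B.proj_mult B.a_comm)
  qed
  then obtain bs where bs: "coordinates bs" "\<And>a. a \<in> carrier A \<Longrightarrow> TA.recombine bs (E0 (pt \<one>\<^bsub>L\<^esub> a)) = E0 (pt \<one>\<^bsub>L\<^esub> a)"
    by (rule recombine_derivation) (rule that)
  let ?bs = "map (\<lambda>b. (emb B (fst b \<odot>\<^bsub>B\<^esub> \<one>\<^bsub>B\<^esub>), functional_map (snd b))) bs"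
  have "E (inclusion x) = (\<Sum>(b, \<pi>)\<leftarrow>?bs. b * inclusion (\<pi> (E (inclusion x))))" for x
  proof -
    have "E (inclusion x) = emb B (E0 (pt \<one>\<^bsub>L\<^esub> (proj A x)))"
      by (simp add: E0_def inclusion_def pt_closed CB.emb_proj_lin[OF lin])
    moreover have "E0 (pt \<one>\<^bsub>L\<^esub> (proj A x)) \<in> carrier T"
      using B.proj_closed by (simp add: E0_def pt_closed B_simps[symmetric])
    ultimately show ?thesis
      using emb_recombine[OF bs(1), of "E0 (pt \<one>\<^bsub>L\<^esub> (proj A x))"] bs(2)[of "proj A x"] by simp
  qed
  moreover have "set ?bs \<subseteq> CB.scalars \<times> functional_map ` {\<phi>. linear_functional k L \<phi>}"
    using bs(1) by (auto simp: coordinates_def)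
  ultimately show "\<exists>bs. set bs \<subseteq> CB.scalars \<times> functional_map ` {\<phi>. linear_functional k L \<phi>} \<and>
      (\<forall>x. E (inclusion x) = (\<Sum>(b, \<pi>)\<leftarrow>bs. b * inclusion (\<pi> (E (inclusion x)))))"
    by blast
next
  fix g h assume lin: "CB.P.lin g" "CB.P.lin h" and eq: "\<And>x. g (inclusion x) = h (inclusion x)"
  have "(\<lambda>U\<in>carrier B. proj B (g (emb B U))) = (\<lambda>U\<in>carrier B. proj B (h (emb B U)))"
  proof (rule B_hom_eqI[OF CB.lin_project[OF lin(1)] CB.lin_project[OF lin(2)]])
    fix a assume "a \<in> carrier A"
    then show "(\<lambda>U\<in>carrier B. proj B (g (emb B U))) (pt \<one>\<^bsub>L\<^esub> a) = (\<lambda>U\<in>carrier B. proj B (h (emb B U))) (pt \<one>\<^bsub>L\<^esub> a)"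
      using eq[of "emb A a"] by (simp add: inclusion_def pt_closed)
  qed
  note restrict_eq = this
  have eqB: "proj B (g (emb B U)) = proj B (h (emb B U))" if "U \<in> carrier B" for U
    using fun_cong[OF restrict_eq, of U] that by simp
  show "g = h"
  proof
    fix f
    have "g f = emb B (proj B (g (emb B (proj B f))))"
      by (simp add: CB.emb_proj_lin[OF lin(1)] flip: CB.proj_lin[OF lin(1)])
    also have "\<dots> = emb B (proj B (h (emb B (proj B f))))"
      by (simp add: eqB)
    also have "\<dots> = h f"
      by (simp add: CB.emb_proj_lin[OF lin(2)] flip: CB.proj_lin[OF lin(2)])
    finally show "g f = h f" .
  qed
next
  fix n \<Phi> assume \<Phi>: "CA.P.HS n \<Phi>"
  note u = CA.P.HS_unip[OF \<Phi>]
  define D where "D i = (\<lambda>x\<in>carrier A. proj A (CA.P.comp_at \<Phi> i (emb A x)))" for i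
  \<comment> \<open>Each positive component is extended linearly over \<open>L\<close>. The Leibniz
    sums carry over because both sides are biadditive and agree on pure tensors.\<close>
  define E where "E i z = (if i = 0 then z else emb B (extend_der k L A (D i) (proj B z)))" for i :: nat and z
  have lin: "CA.P.lin (CA.P.comp_at \<Phi> i)" if "i > 0" for i
    by (rule CA.P.lin_comp_at[OF u that])
  have D: "D i \<in> module_homs k A A" if "i > 0" for i
    unfolding D_def by (rule CA.lin_project[OF lin[OF that]])
  note X = extend_der[OF D]
  have linE: "CB.P.lin (E i)" if "i > 0" for i
    using CB.lin_inject[OF X(1)[OF that]] that by (simp add: E_def[abs_def])
  have E0: "E 0 = id"
    by (simp add: E_def fun_eq_iff)
  have E_add: "E i (z + w) = E i z + E i w" for i z w
    by (cases "i = 0") (simp_all add: E0 CB.P.lin_add[OF linE])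
  have emb_comp: "emb A (D i a) = CA.P.comp_at \<Phi> i (emb A a)" if "a \<in> carrier A" for i a
    using that CA.emb_proj_lin[OF lin] by (cases "i = 0") (simp_all add: D_def CA.P.comp_at_0[OF u])
  have D0: "D 0 a = a" if "a \<in> carrier A" for a
    using that by (simp add: D_def CA.P.comp_at_0[OF u])
  have Dc: "D i a \<in> carrier A" if "a \<in> carrier A" for i a
    using that by (simp add: D_def)
  have E_pure: "E i (emb B (pt c a)) = emb B (pt c (D i a))" if "c \<in> carrier L" "a \<in> carrier A" for i c a
    using that by (cases "i = 0") (simp_all add: E_def D0 X(2) pt_closed)
  have E_inclusion: "E i (inclusion x) = inclusion (CA.P.comp_at \<Phi> i x)" for i x
  proof (cases "i = 0")
    case False
    then have "proj A (CA.P.comp_at \<Phi> i x) = D i (proj A x)"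
      using CA.proj_lin[OF lin, of i x] by (simp add: D_def)
    then show ?thesis
      by (simp add: inclusion_def E_pure)
  qed (simp add: E0 CA.P.comp_at_0[OF u])
  have prod: "E i (emb B U * emb B V) = (\<Sum>l\<in>{0..i}. E l (emb B U) * E (i - l) (emb B V))"
    if "i < n" "U \<in> carrier T" "V \<in> carrier T" for i U V
    using that(2)
  proof (induction rule: BC.T.tensor_induct)
    case ca: (pure c a)
    from that(3) show ?case
    proof (induction rule: BC.T.tensor_induct)
      case db: (pure d b)
      \<comment> \<open>The additive map sending \<open>x\<close> to \<open>cd \<otimes> x\<close>:
        applying it to the Leibniz formula for \<open>a\<close> and \<open>b\<close> gives the
        formula for \<open>c \<otimes> a\<close> and \<open>d \<otimes> b\<close>.\<close>
      define \<theta> where "\<theta> x = emb B (pt (c \<otimes>\<^bsub>L\<^esub> d) (proj A x))" for x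
      have \<theta>_add: "\<theta> (x + y) = \<theta> x + \<theta> y" for x y
        using ca db by (simp add: \<theta>_def A.proj_add pt_add_right pt_closed B.emb_add)
      have \<theta>_0: "\<theta> 0 = 0"
        using \<theta>_add[of 0 0] by simp
      have \<theta>_sum: "\<theta> (sum f I) = (\<Sum>i\<in>I. \<theta> (f i))" for f and I :: "nat set"
        by (induction I rule: infinite_finite_induct) (simp_all add: \<theta>_0 \<theta>_add)
      have "E i (emb B (pt c a) * emb B (pt d b)) = \<theta> (emb A (D i (a \<otimes>\<^bsub>A\<^esub> b)))"
        using ca db by (simp add: \<theta>_def BC.mult_pure pt_closed E_pure Dc flip: B.emb_mult_emb)
      also have "emb A (D i (a \<otimes>\<^bsub>A\<^esub> b)) = (\<Sum>l\<in>{0..i}. emb A (D l a) * emb A (D (i - l) b))"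
        using ca db CA.P.comp_at_mult[OF \<Phi> \<open>i < n\<close>, of "emb A a" "emb A b"] by (simp add: emb_comp A.emb_mult_emb)
      also have "\<theta> \<dots> = (\<Sum>l\<in>{0..i}. E l (emb B (pt c a)) * E (i - l) (emb B (pt d b)))"
        unfolding \<theta>_sum
        by (rule sum.cong) (use ca db in \<open>simp_all add: \<theta>_def E_pure Dc BC.mult_pure pt_closed
          flip: A.emb_mult_emb B.emb_mult_emb\<close>)
      finally show ?case .
    next
      case (add v w)
      then have "emb B (v \<otimes>\<^bsub>T\<^esub> w) = emb B v + emb B w"
        using B.emb_add[of v w] by (simp add: B_simps)
      then show ?case
        using add by (simp add: distrib_left E_add sum.distrib)
    qed
  next
    case (add v w)
    then have "emb B (v \<otimes>\<^bsub>T\<^esub> w) = emb B v + emb B w"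
      using B.emb_add[of v w] by (simp add: B_simps)
    then show ?case
      using add by (simp add: distrib_right E_add sum.distrib)
  qed
  have E_mult: "E i (z * w) = (\<Sum>l\<in>{0..i}. E l z * E (i - l) w)" if i: "0 < i" "i < n" for i z w
  proof -
    \<comment> \<open>To pass to arbitrary elements of the product: positive components see only
      projections, and at the two ends of the sum the identity component is multiplied by a value in
      the factor \<open>B\<close>, which projects it.\<close>
    have E_proj: "E l (emb B (proj B v)) = E l v" if "l > 0" for l v
      using that by (simp add: E_def)
    have E_e: "emb B \<one>\<^bsub>B\<^esub> * E l v = E l v" if "l > 0" for l v
      by (rule CB.P.lin_e[OF linE[OF that]])
    have "E i (z * w) = E i (emb B (proj B z) * emb B (proj B w))"
      using i by (simp add: E_def B.proj_mult)
    also have "\<dots> = (\<Sum>l\<in>{0..i}. E l (emb B (proj B z)) * E (i - l) (emb B (proj B w)))"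
      using i(2) B.proj_closed by (intro prod) (simp_all add: B_simps[symmetric])
    also have "\<dots> = (\<Sum>l\<in>{0..i}. E l z * E (i - l) w)"
    proof (rule sum.cong[OF refl])
      fix l assume l: "l \<in> {0..i}"
      consider "l = 0" | "l = i" | "0 < l" "0 < i - l"
        using l by fastforce
      then show "E l (emb B (proj B z)) * E (i - l) (emb B (proj B w)) = E l z * E (i - l) w"
      proof cases
        case 1
        have "emb B (proj B z) * E i w = z * (emb B \<one>\<^bsub>B\<^esub> * E i w)"
          by (simp add: mult.left_commute flip: B.emb_one_mult)
        then show ?thesis
          using 1 i by (simp add: E_proj E_e E0)
      next
        case 2
        have "E i z * emb B (proj B w) = (emb B \<one>\<^bsub>B\<^esub> * E i z) * w"
          by (simp add: ac_simps flip: B.emb_one_mult)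
        then show ?thesis
          using 2 i by (simp add: E_proj E_e E0)
      qed (simp add: E_proj)
    qed
    finally show ?thesis .
  qed
  obtain \<Psi> where "CB.P.HS n \<Psi>" "\<forall>i. CB.P.comp_at \<Psi> i = E i"
    using CB.P.HS_of_components[of E n] E0 linE E_mult by blast
  then show "\<exists>\<Psi>. CB.P.HS n \<Psi> \<and> (\<forall>i x. CB.P.comp_at \<Psi> i (inclusion x) = inclusion (CA.P.comp_at \<Phi> i x))"
    using E_inclusion by auto
qed

text \<open>The theorem \<open>descends\<close>, brought back to the given algebras. All use of
  separability in the final statements passes through this lemma.\<close>

lemma IDer_push:
  assumes "E \<in> IDer L B m" "m > 0" "linear_functional k L \<phi>"
  shows "(\<lambda>a\<in>carrier A. TA.push \<phi> (E (pt \<one>\<^bsub>L\<^esub> a))) \<in> IDer k A m"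
proof -
  obtain \<Psi> where \<Psi>: "CB.P.HS (Suc m) \<Psi>" "\<forall>f. CB.P.comp_at \<Psi> 1 f = emb B (E (proj B f))"
    by (rule CB.IDerE[OF assms(1,2)])
  obtain D where D: "CA.P.HS (Suc m) D"
      "\<forall>x. CA.P.comp_at D 1 x = functional_map \<phi> (CB.P.comp_at \<Psi> 1 (inclusion x))"
    using descent.descends[OF assms(2)] \<Psi>(1) assms(3) unfolding descent.descends_def by blast
  have "TA.push \<phi> (E (pt \<one>\<^bsub>L\<^esub> a)) = proj A (CA.P.comp_at D 1 (emb A a))" if "a \<in> carrier A" for a
  proof -
    have "E (pt \<one>\<^bsub>L\<^esub> a) \<in> carrier B"
      using that by (intro CB.IDer_closed[OF assms(1)] pt_closed) simp_all
    then have "TA.push \<phi> (E (pt \<one>\<^bsub>L\<^esub> a)) \<in> carrier A" "E (pt \<one>\<^bsub>L\<^esub> a) \<in> carrier B"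
      using TA.push_closed[OF assms(3)] by (simp_all add: B_simps)
    then show ?thesis
      using that unfolding D(2)[rule_format] \<Psi>(2)[rule_format]
      by (simp add: functional_map_def inclusion_def pt_closed)
  qed
  then have "(\<lambda>a\<in>carrier A. TA.push \<phi> (E (pt \<one>\<^bsub>L\<^esub> a))) = (\<lambda>a\<in>carrier A. proj A (CA.P.comp_at D 1 (emb A a)))"
    by (intro restrict_ext) simp
  then show ?thesis
    using CA.IDerI[OF D(1) assms(2)] by metis
qed

lemma extend_der_IDer:
  assumes "\<delta> \<in> IDer k A m" "m > 0"
  shows "extend_der k L A \<delta> \<in> IDer L B m"
proof -
  obtain \<Phi> where \<Phi>: "CA.P.HS (Suc m) \<Phi>" "\<forall>f. CA.P.comp_at \<Phi> 1 f = emb A (\<delta> (proj A f))"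
    by (rule CA.IDerE[OF assms])
  obtain \<Psi> where \<Psi>: "CB.P.HS (Suc m) \<Psi>" "\<forall>i x. CB.P.comp_at \<Psi> i (inclusion x) = inclusion (CA.P.comp_at \<Phi> i x)"
    using descent.extend[OF \<Phi>(1)] by blast
  let ?E = "\<lambda>U\<in>carrier B. proj B (CB.P.comp_at \<Psi> 1 (emb B U))"
  have E: "?E \<in> IDer L B m"
    by (rule CB.IDerI[OF \<Psi>(1) assms(2)])
  have "?E = extend_der k L A \<delta>"
  proof (rule B_hom_eqI[OF IDer_module_homs[OF E] extend_der(1)[OF IDer_module_homs[OF assms(1)]]])
    fix a assume a: "a \<in> carrier A"
    have "CB.P.comp_at \<Psi> 1 (inclusion (emb A a)) = inclusion (emb A (\<delta> a))"
      using a \<Phi>(2) \<Psi>(2) by simp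
    then show "?E (pt \<one>\<^bsub>L\<^esub> a) = extend_der k L A \<delta> (pt \<one>\<^bsub>L\<^esub> a)"
      using a CA.IDer_closed[OF assms(1) a] extend_der(2)[OF IDer_module_homs[OF assms(1)], of "\<one>\<^bsub>L\<^esub>" a]
      by (simp add: inclusion_def pt_closed)
  qed
  then show ?thesis
    using E by simp
qed

end

section \<open>The base change isomorphism\<close>

lemma restrict_scalars_simps:
  "carrier (restrict_scalars A M) = carrier M" "x \<oplus>\<^bsub>restrict_scalars A M\<^esub> y = x \<oplus>\<^bsub>M\<^esub> y"
  "\<zero>\<^bsub>restrict_scalars A M\<^esub> = \<zero>\<^bsub>M\<^esub>" "r \<odot>\<^bsub>restrict_scalars A M\<^esub> x = (r \<odot>\<^bsub>A\<^esub> \<one>\<^bsub>A\<^esub>) \<odot>\<^bsub>M\<^esub> x"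
  by (simp_all add: restrict_scalars_def)

lemma module_restrict_scalars:
  assumes "algebra k A" "module A M"
  shows "module k (restrict_scalars A M)"
proof -
  interpret A: algebra k A
    by fact
  interpret M: module A M
    by fact
  show ?thesis
  proof (rule moduleI)
    show "abelian_group (restrict_scalars A M)"
    proof (rule abelian_groupI)
      fix x assume "x \<in> carrier (restrict_scalars A M)"
      then show "\<exists>y\<in>carrier (restrict_scalars A M). y \<oplus>\<^bsub>restrict_scalars A M\<^esub> x = \<zero>\<^bsub>restrict_scalars A M\<^esub>"
        by (auto simp: restrict_scalars_simps intro!: bexI[of _ "\<ominus>\<^bsub>M\<^esub> x"] M.l_neg)
    qed (auto simp: restrict_scalars_simps M.a_ac)
  next
    fix r s x assume "r \<in> carrier k" "s \<in> carrier k" "x \<in> carrier (restrict_scalars A M)"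
    then show "(r \<otimes>\<^bsub>k\<^esub> s) \<odot>\<^bsub>restrict_scalars A M\<^esub> x = r \<odot>\<^bsub>restrict_scalars A M\<^esub> (s \<odot>\<^bsub>restrict_scalars A M\<^esub> x)"
      by (simp add: restrict_scalars_simps A.smult_assoc1 A.smult_assoc2 flip: M.smult_assoc1)
  qed (auto simp: restrict_scalars_simps A.R.is_cring A.smult_l_distr M.smult_l_distr M.smult_r_distr)
qed

context separable_base_change
begin

context
  fixes m :: nat
  assumes m: "m > 0"
begin

abbreviation "M \<equiv> IDer_module k A m"
abbreviation "M' \<equiv> restrict_scalars A (IDer_module k A m)"
abbreviation "N \<equiv> IDer_module L B m"
abbreviation "BM \<equiv> base_change_module k L A (IDer_module k A m)"
abbreviation "T' \<equiv> tensor_group k L (restrict_scalars A (IDer_module k A m))"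
abbreviation "pt' \<equiv> pure_tensor k L (restrict_scalars A (IDer_module k A m))"
abbreviation "\<Phi> \<equiv> IDer_base_change_map k L A m"

lemma IDer_module_simps:
  "carrier M = IDer k A m" "\<delta> \<oplus>\<^bsub>M\<^esub> \<epsilon> = (\<lambda>x\<in>carrier A. \<delta> x \<oplus>\<^bsub>A\<^esub> \<epsilon> x)"
  "a \<odot>\<^bsub>M\<^esub> \<delta> = (\<lambda>x\<in>carrier A. a \<otimes>\<^bsub>A\<^esub> \<delta> x)" "\<zero>\<^bsub>M\<^esub> = (\<lambda>x\<in>carrier A. \<zero>\<^bsub>A\<^esub>)"
  by (simp_all add: IDer_module_def)

lemma IDer_module_B_simps:
  "carrier N = IDer L B m" "E \<oplus>\<^bsub>N\<^esub> E' = (\<lambda>x\<in>carrier B. E x \<oplus>\<^bsub>B\<^esub> E' x)"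
  "U \<odot>\<^bsub>N\<^esub> E = (\<lambda>x\<in>carrier B. U \<otimes>\<^bsub>B\<^esub> E x)" "\<zero>\<^bsub>N\<^esub> = (\<lambda>x\<in>carrier B. \<zero>\<^bsub>B\<^esub>)"
  by (simp_all add: IDer_module_def)

interpretation M: module A M
  by (rule CA.IDer_module_module[OF m])

interpretation N: module B N
  by (rule CB.IDer_module_module[OF m])

interpretation M': module k M'
  by (rule module_restrict_scalars[OF A.algebra_axioms M.module_axioms])

interpretation TM: tensor_vector_space k L M'
  by unfold_locales

interpretation act: tensor_action k L A M' "\<lambda>a \<delta>. a \<odot>\<^bsub>M\<^esub> \<delta>"
proof unfold_locales
  fix r a \<delta> assume c: "r \<in> carrier k" "a \<in> carrier A" "\<delta> \<in> carrier M'"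
  then show "(r \<odot>\<^bsub>A\<^esub> a) \<odot>\<^bsub>M\<^esub> \<delta> = r \<odot>\<^bsub>M'\<^esub> (a \<odot>\<^bsub>M\<^esub> \<delta>)"
    by (simp add: restrict_scalars_simps A.smult_assoc2 flip: M.smult_assoc1)
  show "a \<odot>\<^bsub>M\<^esub> (r \<odot>\<^bsub>M'\<^esub> \<delta>) = r \<odot>\<^bsub>M'\<^esub> (a \<odot>\<^bsub>M\<^esub> \<delta>)"
    using c by (simp add: restrict_scalars_simps A.m_comm flip: M.smult_assoc1)
qed (simp_all add: restrict_scalars_simps M.smult_l_distr M.smult_r_distr)

lemma BM_simps:
  "carrier BM = carrier T'" "z \<oplus>\<^bsub>BM\<^esub> w = z \<otimes>\<^bsub>T'\<^esub> w" "\<zero>\<^bsub>BM\<^esub> = \<one>\<^bsub>T'\<^esub>" "U \<odot>\<^bsub>BM\<^esub> z = act.tensor_act U z"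
  by (simp_all add: base_change_module_def Let_def act.tensor_act_def act.inner_def)

lemma smult_BM_pure:
  "c \<in> carrier L \<Longrightarrow> a \<in> carrier A \<Longrightarrow> d \<in> carrier L \<Longrightarrow> \<delta> \<in> IDer k A m \<Longrightarrow>
    pt c a \<odot>\<^bsub>BM\<^esub> pt' d \<delta> = pt' (c \<otimes>\<^bsub>L\<^esub> d) (a \<odot>\<^bsub>M\<^esub> \<delta>)"
  unfolding BM_simps by (rule act.tensor_act_pure) (simp_all add: restrict_scalars_simps IDer_module_simps)

lemma smult_BM_closed: "U \<in> carrier T \<Longrightarrow> z \<in> carrier T' \<Longrightarrow> U \<odot>\<^bsub>BM\<^esub> z \<in> carrier T'"
  and smult_BM_add_left: "U \<in> carrier T \<Longrightarrow> V \<in> carrier T \<Longrightarrow> z \<in> carrier T' \<Longrightarrow>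
    (U \<otimes>\<^bsub>T\<^esub> V) \<odot>\<^bsub>BM\<^esub> z = (U \<odot>\<^bsub>BM\<^esub> z) \<otimes>\<^bsub>T'\<^esub> (V \<odot>\<^bsub>BM\<^esub> z)"
  and smult_BM_add_right: "U \<in> carrier T \<Longrightarrow> z \<in> carrier T' \<Longrightarrow> w \<in> carrier T' \<Longrightarrow>
    U \<odot>\<^bsub>BM\<^esub> (z \<otimes>\<^bsub>T'\<^esub> w) = (U \<odot>\<^bsub>BM\<^esub> z) \<otimes>\<^bsub>T'\<^esub> (U \<odot>\<^bsub>BM\<^esub> w)"
  unfolding BM_simps by (rule act.tensor_act_closed act.tensor_act_add_left act.tensor_act_add_right; assumption)+

lemma carrier_M': "carrier M' = IDer k A m"
  by (simp add: restrict_scalars_simps IDer_module_simps)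

lemma smult_M_closed: "a \<in> carrier A \<Longrightarrow> \<delta> \<in> IDer k A m \<Longrightarrow> a \<odot>\<^bsub>M\<^esub> \<delta> \<in> IDer k A m"
  using M.smult_closed[of a \<delta>] by (simp add: IDer_module_simps(1))

lemma module_BM: "module B BM"
proof (rule moduleI[OF B.is_cring])
  show "abelian_group BM"
  proof (rule abelian_groupI)
    fix z assume "z \<in> carrier BM"
    then show "\<exists>w\<in>carrier BM. w \<oplus>\<^bsub>BM\<^esub> z = \<zero>\<^bsub>BM\<^esub>"
      by (auto simp: BM_simps intro!: bexI[of _ "inv\<^bsub>T'\<^esub> z"])
  qed (auto simp: BM_simps TM.T.T.m_ac)
next
  fix U V z assume U: "U \<in> carrier B" and V: "V \<in> carrier B" and z: "z \<in> carrier BM"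
  from U V z show "(U \<oplus>\<^bsub>B\<^esub> V) \<odot>\<^bsub>BM\<^esub> z = U \<odot>\<^bsub>BM\<^esub> z \<oplus>\<^bsub>BM\<^esub> V \<odot>\<^bsub>BM\<^esub> z"
    by (simp add: BM_simps(1,2) B_simps smult_BM_add_left)
  from U show "(U \<otimes>\<^bsub>B\<^esub> V) \<odot>\<^bsub>BM\<^esub> z = U \<odot>\<^bsub>BM\<^esub> (V \<odot>\<^bsub>BM\<^esub> z)"
    unfolding B_simps(1)
  proof (induction rule: BC.T.tensor_induct)
    case ca: (pure c a)
    from V show ?case
      unfolding B_simps(1)
    proof (induction rule: BC.T.tensor_induct)
      case db: (pure d b)
      from z show ?case
        unfolding BM_simps(1)
      proof (induction rule: TM.T.tensor_induct)
        case (pure f \<delta>)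
        then have \<delta>: "\<delta> \<in> carrier M" "\<delta> \<in> IDer k A m"
          by (simp_all add: carrier_M' IDer_module_simps(1))
        have "(a \<otimes>\<^bsub>A\<^esub> b) \<odot>\<^bsub>M\<^esub> \<delta> = a \<odot>\<^bsub>M\<^esub> (b \<odot>\<^bsub>M\<^esub> \<delta>)"
          using ca db \<delta> by (intro M.smult_assoc1)
        then show ?case
          using ca db pure \<delta> by (simp add: BC.mult_pure smult_BM_pure smult_M_closed L.m_assoc)
      next
        case (add v w)
        then show ?case
          using ca db by (simp add: BC.mult_pure smult_BM_add_right smult_BM_closed)
      qed
    next
      case (add u v)
      then show ?case
        using ca z by (simp add: BM_simps(1) BC.mult_add_right BC.mult_closed smult_BM_add_left smult_BM_add_right smult_BM_closed)
    qed
  next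
    case (add u v)
    then show ?case
      using V z by (simp add: BM_simps(1) B_simps(1) BC.mult_add_left BC.mult_closed smult_BM_add_left smult_BM_closed)
  qed
next
  fix z assume "z \<in> carrier BM"
  then show "\<one>\<^bsub>B\<^esub> \<odot>\<^bsub>BM\<^esub> z = z"
    unfolding BM_simps(1) B_simps(2)
  proof (induction rule: TM.T.tensor_induct)
    case (pure f \<delta>)
    then have "\<delta> \<in> carrier M" "\<delta> \<in> IDer k A m"
      by (simp_all add: carrier_M' IDer_module_simps(1))
    then show ?case
      using pure M.smult_one[of \<delta>] by (simp add: smult_BM_pure)
  qed (simp add: smult_BM_add_right)
qed (simp_all add: BM_simps(1,2) B_simps(1) smult_BM_closed smult_BM_add_right)

lemma scaled_extension_IDer:
  assumes "c \<in> carrier L" "\<delta> \<in> IDer k A m"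
  shows "scaled_extension k L A c \<delta> \<in> IDer L B m"
    "a \<in> carrier A \<Longrightarrow> scaled_extension k L A c \<delta> (pt \<one>\<^bsub>L\<^esub> a) = pt c (\<delta> a)"
proof -
  have X: "extend_der k L A \<delta> \<in> IDer L B m"
    by (rule extend_der_IDer[OF assms(2) m])
  have "scaled_extension k L A c \<delta> = (\<lambda>z\<in>carrier B. (c \<odot>\<^bsub>B\<^esub> \<one>\<^bsub>B\<^esub>) \<otimes>\<^bsub>B\<^esub> extend_der k L A \<delta> z)"
    unfolding scaled_extension_def
    by (rule restrict_ext) (use assms(1) CB.IDer_closed[OF X] in \<open>simp add: CB.smult_one_mult\<close>)
  then show "scaled_extension k L A c \<delta> \<in> IDer L B m"
    using CB.IDer_smult[OF X _ m, of "c \<odot>\<^bsub>B\<^esub> \<one>\<^bsub>B\<^esub>"] assms(1) by simp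
  show "scaled_extension k L A c \<delta> (pt \<one>\<^bsub>L\<^esub> a) = pt c (\<delta> a)" if "a \<in> carrier A"
    using that assms extend_der(2)[OF IDer_module_homs[OF assms(2)], of "\<one>\<^bsub>L\<^esub>" a] CA.IDer_closed[OF assms(2) that]
    by (simp add: scaled_extension_def pt_closed BC.smult_pure)
qed

lemma IDer_B_eqI:
  assumes "E \<in> IDer L B m" "E' \<in> IDer L B m" "\<And>a. a \<in> carrier A \<Longrightarrow> E (pt \<one>\<^bsub>L\<^esub> a) = E' (pt \<one>\<^bsub>L\<^esub> a)"
  shows "E = E'"
  using B_hom_eqI[OF IDer_module_homs[OF assms(1)] IDer_module_homs[OF assms(2)] assms(3)] .

lemma N_add_closed: "E \<in> IDer L B m \<Longrightarrow> E' \<in> IDer L B m \<Longrightarrow> E \<oplus>\<^bsub>N\<^esub> E' \<in> IDer L B m"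
  using N.a_closed[of E E'] by (simp add: IDer_module_B_simps(1))

lemma N_smult_closed: "U \<in> carrier B \<Longrightarrow> E \<in> IDer L B m \<Longrightarrow> U \<odot>\<^bsub>N\<^esub> E \<in> IDer L B m"
  using N.smult_closed[of U E] by (simp add: IDer_module_B_simps(1))

lemma N_add_apply: "U \<in> carrier B \<Longrightarrow> (E \<oplus>\<^bsub>N\<^esub> E') U = E U \<oplus>\<^bsub>B\<^esub> E' U"
  and N_smult_apply: "U \<in> carrier B \<Longrightarrow> (V \<odot>\<^bsub>N\<^esub> E) U = V \<otimes>\<^bsub>B\<^esub> E U"
  by (simp_all add: IDer_module_B_simps)

lemma scaled_extension_balanced: "balanced k L M' (add_monoid N) (scaled_extension k L A)"
proof (rule balancedI)
  fix c \<delta> assume "c \<in> carrier L" "\<delta> \<in> carrier M'"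
  then show "scaled_extension k L A c \<delta> \<in> carrier (add_monoid N)"
    by (simp add: carrier_M' IDer_module_B_simps(1) scaled_extension_IDer(1))
next
  fix c c' \<delta> assume c: "c \<in> carrier L" "c' \<in> carrier L" "\<delta> \<in> carrier M'"
  then have \<delta>: "\<delta> \<in> IDer k A m"
    by (simp add: carrier_M')
  show "scaled_extension k L A (c \<oplus>\<^bsub>L\<^esub> c') \<delta> = scaled_extension k L A c \<delta> \<otimes>\<^bsub>add_monoid N\<^esub> scaled_extension k L A c' \<delta>"
    unfolding monoid.simps
  proof (rule IDer_B_eqI)
    fix a assume "a \<in> carrier A"
    then show "scaled_extension k L A (c \<oplus>\<^bsub>L\<^esub> c') \<delta> (pt \<one>\<^bsub>L\<^esub> a) =
        (scaled_extension k L A c \<delta> \<oplus>\<^bsub>N\<^esub> scaled_extension k L A c' \<delta>) (pt \<one>\<^bsub>L\<^esub> a)"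
      using c \<delta> CA.IDer_closed[OF \<delta>]
      by (simp add: N_add_apply pt_closed scaled_extension_IDer BC.T.pure_add_left) (simp add: B_simps)
  qed (use c \<delta> in \<open>simp_all add: scaled_extension_IDer N_add_closed\<close>)
next
  fix c \<delta> \<epsilon> assume c: "c \<in> carrier L" "\<delta> \<in> carrier M'" "\<epsilon> \<in> carrier M'"
  then have \<delta>: "\<delta> \<in> IDer k A m" "\<epsilon> \<in> IDer k A m" "\<delta> \<oplus>\<^bsub>M'\<^esub> \<epsilon> \<in> IDer k A m"
    using M'.a_closed[of \<delta> \<epsilon>] by (simp_all add: carrier_M')
  show "scaled_extension k L A c (\<delta> \<oplus>\<^bsub>M'\<^esub> \<epsilon>) = scaled_extension k L A c \<delta> \<otimes>\<^bsub>add_monoid N\<^esub> scaled_extension k L A c \<epsilon>"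
    unfolding monoid.simps
  proof (rule IDer_B_eqI)
    fix a assume a: "a \<in> carrier A"
    have "(\<delta> \<oplus>\<^bsub>M'\<^esub> \<epsilon>) a = \<delta> a \<oplus>\<^bsub>A\<^esub> \<epsilon> a"
      using a by (simp add: restrict_scalars_simps IDer_module_simps)
    then show "scaled_extension k L A c (\<delta> \<oplus>\<^bsub>M'\<^esub> \<epsilon>) (pt \<one>\<^bsub>L\<^esub> a) =
        (scaled_extension k L A c \<delta> \<oplus>\<^bsub>N\<^esub> scaled_extension k L A c \<epsilon>) (pt \<one>\<^bsub>L\<^esub> a)"
      using a c \<delta> CA.IDer_closed[OF \<delta>(1)] CA.IDer_closed[OF \<delta>(2)]
      by (simp add: N_add_apply pt_closed scaled_extension_IDer pt_add_right)
  qed (use c \<delta> in \<open>simp_all add: scaled_extension_IDer N_add_closed\<close>)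
next
  fix r c \<delta> assume c: "r \<in> carrier k" "c \<in> carrier L" "\<delta> \<in> carrier M'"
  then have \<delta>: "\<delta> \<in> IDer k A m" "r \<odot>\<^bsub>M'\<^esub> \<delta> \<in> IDer k A m"
    using M'.smult_closed[of r \<delta>] by (simp_all add: carrier_M')
  show "scaled_extension k L A (r \<odot>\<^bsub>L\<^esub> c) \<delta> = scaled_extension k L A c (r \<odot>\<^bsub>M'\<^esub> \<delta>)"
  proof (rule IDer_B_eqI)
    fix a assume a: "a \<in> carrier A"
    have "(r \<odot>\<^bsub>M'\<^esub> \<delta>) a = r \<odot>\<^bsub>A\<^esub> \<delta> a"
      using a c CA.IDer_closed[OF \<delta>(1) a] by (simp add: restrict_scalars_simps IDer_module_simps CA.smult_one_mult)
    then show "scaled_extension k L A (r \<odot>\<^bsub>L\<^esub> c) \<delta> (pt \<one>\<^bsub>L\<^esub> a) = scaled_extension k L A c (r \<odot>\<^bsub>M'\<^esub> \<delta>) (pt \<one>\<^bsub>L\<^esub> a)"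
      using a c \<delta> CA.IDer_closed[OF \<delta>(1) a] by (simp add: scaled_extension_IDer BC.T.pure_smult)
  qed (use c \<delta> in \<open>simp_all add: scaled_extension_IDer\<close>)
qed

lemmas \<Phi>_lift = TM.T.tensor_lift[OF N.a_comm_group scaled_extension_balanced, folded IDer_base_change_map_def]

lemma \<Phi>_pure: "c \<in> carrier L \<Longrightarrow> \<delta> \<in> IDer k A m \<Longrightarrow> \<Phi> (pt' c \<delta>) = scaled_extension k L A c \<delta>"
  by (rule \<Phi>_lift(2)) (simp_all add: carrier_M')

lemma \<Phi>_closed: "z \<in> carrier T' \<Longrightarrow> \<Phi> z \<in> IDer L B m"
  using hom_in_carrier[OF \<Phi>_lift(1)] by (simp add: IDer_module_B_simps(1))

lemma \<Phi>_add: "z \<in> carrier T' \<Longrightarrow> w \<in> carrier T' \<Longrightarrow> \<Phi> (z \<otimes>\<^bsub>T'\<^esub> w) = \<Phi> z \<oplus>\<^bsub>N\<^esub> \<Phi> w"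
  using hom_mult[OF \<Phi>_lift(1)] by simp

lemma \<Phi>_one: "\<Phi> \<one>\<^bsub>T'\<^esub> = \<zero>\<^bsub>N\<^esub>"
  using hom_one[OF \<Phi>_lift(1) TM.T.T.is_group N.a_group] by simp

lemma \<Phi>_smult:
  assumes "U \<in> carrier B" "z \<in> carrier T'"
  shows "\<Phi> (U \<odot>\<^bsub>BM\<^esub> z) = U \<odot>\<^bsub>N\<^esub> \<Phi> z"
  using assms(1) unfolding B_simps(1)
proof (induction rule: BC.T.tensor_induct)
  case ca: (pure c a)
  from assms(2) show ?case
  proof (induction rule: TM.T.tensor_induct)
    case (pure d \<delta>)
    then have \<delta>: "\<delta> \<in> IDer k A m" "a \<odot>\<^bsub>M\<^esub> \<delta> \<in> IDer k A m"
      using ca smult_M_closed by (simp_all add: carrier_M')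
    have "scaled_extension k L A (c \<otimes>\<^bsub>L\<^esub> d) (a \<odot>\<^bsub>M\<^esub> \<delta>) = pt c a \<odot>\<^bsub>N\<^esub> scaled_extension k L A d \<delta>"
    proof (rule IDer_B_eqI)
      fix x assume x: "x \<in> carrier A"
      have "(a \<odot>\<^bsub>M\<^esub> \<delta>) x = a \<otimes>\<^bsub>A\<^esub> \<delta> x"
        using x by (simp add: IDer_module_simps)
      then show "scaled_extension k L A (c \<otimes>\<^bsub>L\<^esub> d) (a \<odot>\<^bsub>M\<^esub> \<delta>) (pt \<one>\<^bsub>L\<^esub> x) =
          (pt c a \<odot>\<^bsub>N\<^esub> scaled_extension k L A d \<delta>) (pt \<one>\<^bsub>L\<^esub> x)"
        using ca pure(1) x \<delta> CA.IDer_closed[OF \<delta>(1) x]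
        by (simp add: N_smult_apply pt_closed scaled_extension_IDer BC.mult_pure)
    qed (use ca pure(1) \<delta> in \<open>simp_all add: scaled_extension_IDer N_smult_closed pt_closed\<close>)
    then show ?case
      using ca pure(1) \<delta> by (simp add: smult_BM_pure \<Phi>_pure)
  next
    case (add z w)
    have "pt c a \<odot>\<^bsub>N\<^esub> (\<Phi> z \<oplus>\<^bsub>N\<^esub> \<Phi> w) = (pt c a \<odot>\<^bsub>N\<^esub> \<Phi> z) \<oplus>\<^bsub>N\<^esub> (pt c a \<odot>\<^bsub>N\<^esub> \<Phi> w)"
      using ca add by (intro N.smult_r_distr) (simp_all add: pt_closed IDer_module_B_simps(1) \<Phi>_closed)
    then show ?case
      using ca add by (simp add: smult_BM_add_right smult_BM_closed \<Phi>_add)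
  qed
next
  case (add u v)
  have "(u \<oplus>\<^bsub>B\<^esub> v) \<odot>\<^bsub>N\<^esub> \<Phi> z = (u \<odot>\<^bsub>N\<^esub> \<Phi> z) \<oplus>\<^bsub>N\<^esub> (v \<odot>\<^bsub>N\<^esub> \<Phi> z)"
    using add assms(2) by (intro N.smult_l_distr) (simp_all add: B_simps IDer_module_B_simps(1) \<Phi>_closed)
  then show ?case
    using add assms(2) by (simp add: B_simps smult_BM_add_left smult_BM_closed \<Phi>_add)
qed

text \<open>Contracting the values of \<open>\<Phi> z\<close> is the same as contracting
  \<open>z\<close> to a derivation and evaluating it, so \<open>\<Phi> z\<close> determines every
  contraction of \<open>z\<close>.\<close>

lemma push_\<Phi>:
  assumes "z \<in> carrier T'" "linear_functional k L \<phi>" "a \<in> carrier A"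
  shows "TA.push \<phi> (\<Phi> z (pt \<one>\<^bsub>L\<^esub> a)) = TM.push \<phi> z a"
  using assms(1)
proof (induction rule: TM.T.tensor_induct)
  case (pure c \<delta>)
  then have \<delta>: "\<delta> \<in> IDer k A m"
    by (simp add: carrier_M')
  show ?case
    using pure assms(2,3) \<delta> CA.IDer_closed[OF \<delta> assms(3)] linear_functional_simps(1)[OF assms(2) pure(1)]
    by (simp add: \<Phi>_pure scaled_extension_IDer TA.push_pure TM.push_pure)
      (simp add: restrict_scalars_simps IDer_module_simps CA.smult_one_mult)
next
  case (add z w)
  have c: "\<Phi> y (pt \<one>\<^bsub>L\<^esub> a) \<in> carrier T" if "y \<in> carrier T'" for y
    using CB.IDer_closed[OF \<Phi>_closed[OF that] pt_closed[of "\<one>\<^bsub>L\<^esub>" a]] assms(3) by (simp add: B_simps)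
  have "(TM.push \<phi> z \<oplus>\<^bsub>M'\<^esub> TM.push \<phi> w) a = TM.push \<phi> z a \<oplus>\<^bsub>A\<^esub> TM.push \<phi> w a"
    using assms(3) by (simp add: restrict_scalars_simps IDer_module_simps)
  moreover have "\<Phi> (z \<otimes>\<^bsub>T'\<^esub> w) (pt \<one>\<^bsub>L\<^esub> a) = \<Phi> z (pt \<one>\<^bsub>L\<^esub> a) \<otimes>\<^bsub>T\<^esub> \<Phi> w (pt \<one>\<^bsub>L\<^esub> a)"
    using add assms(3) by (simp add: \<Phi>_add N_add_apply pt_closed) (simp add: B_simps)
  ultimately show ?case
    using add assms(2) c by (simp add: TA.push_add TM.push_add)
qed

lemma recombine_cong:
  "(\<And>b. b \<in> set bs \<Longrightarrow> TM.push (snd b) z = TM.push (snd b) w) \<Longrightarrow> TM.recombine bs z = TM.recombine bs w"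
  by (induction bs) simp_all

text \<open>A tensor is rebuilt by \<open>recombine\<close> from finitely many contractions, and
  each of these can be read off from its image by \<open>push_\<Phi>\<close>.\<close>

lemma inj_on_\<Phi>: "inj_on \<Phi> (carrier T')"
proof (rule inj_onI)
  fix z w assume zw: "z \<in> carrier T'" "w \<in> carrier T'" "\<Phi> z = \<Phi> w"
  then have "finite {z, w}" "{z, w} \<subseteq> carrier T'"
    by simp_all
  then obtain bs where bs: "coordinates bs" "\<And>y. y \<in> {z, w} \<Longrightarrow> TM.recombine bs y = y"
    by (rule TM.recombine_exists) (rule that)
  have "TM.push (snd b) z = TM.push (snd b) w" if "b \<in> set bs" for b
  proof -
    have \<phi>: "linear_functional k L (snd b)"
      using bs(1) that by (simp add: coordinates_def)
    have ext: "TM.push (snd b) y \<in> extensional (carrier A)" if "y \<in> carrier T'" for y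
      using TM.push_closed[OF \<phi> that] by (intro CA.IDer_extensional[of _ m]) (simp add: carrier_M')
    show ?thesis
      by (rule extensionalityI[OF ext[OF zw(1)] ext[OF zw(2)]])
        (use zw push_\<Phi>[OF zw(1) \<phi>] push_\<Phi>[OF zw(2) \<phi>] in simp)
  qed
  then have "TM.recombine bs z = TM.recombine bs w"
    by (rule recombine_cong)
  then show "z = w"
    using bs(2) by simp
qed

text \<open>The preimage is the sum of \<open>b \<otimes> \<delta>\<close> over the coordinates
  \<open>bs\<close> of \<open>E\<close>, where \<open>\<delta>\<close> is the contraction of
  \<open>E\<close> with the functional paired with \<open>b\<close>. Integrability is asked of the
  contractions rather than of \<open>E\<close>, so that the lemma can also raise the length in
  \<open>IDer_eq_iff\<close>.\<close>

lemma \<Phi>_surj: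
  assumes E: "E \<in> Der L B"
    and push: "\<And>\<phi>. linear_functional k L \<phi> \<Longrightarrow> (\<lambda>a\<in>carrier A. TA.push \<phi> (E (pt \<one>\<^bsub>L\<^esub> a))) \<in> IDer k A m"
  shows "\<exists>z\<in>carrier T'. \<Phi> z = E"
proof -
  obtain bs where bs: "coordinates bs" "\<And>a. a \<in> carrier A \<Longrightarrow> TA.recombine bs (E (pt \<one>\<^bsub>L\<^esub> a)) = E (pt \<one>\<^bsub>L\<^esub> a)"
    using recombine_derivation[OF E] by metis
  have "\<exists>z\<in>carrier T'. \<forall>a\<in>carrier A. \<Phi> z (pt \<one>\<^bsub>L\<^esub> a) = TA.recombine bs (E (pt \<one>\<^bsub>L\<^esub> a))"
    using bs(1)
  proof (induction bs)
    case Nil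
    have "\<forall>a\<in>carrier A. \<Phi> \<one>\<^bsub>T'\<^esub> (pt \<one>\<^bsub>L\<^esub> a) = \<one>\<^bsub>T\<^esub>"
      by (simp add: \<Phi>_one IDer_module_B_simps(4) pt_closed) (simp add: B_simps)
    then show ?case
      by (auto intro!: bexI[of _ "\<one>\<^bsub>T'\<^esub>"])
  next
    case (Cons b bs)
    then have b: "coordinates bs" "fst b \<in> carrier L" "linear_functional k L (snd b)"
      by (auto simp: coordinates_def)
    obtain z where z: "z \<in> carrier T'" "\<forall>a\<in>carrier A. \<Phi> z (pt \<one>\<^bsub>L\<^esub> a) = TA.recombine bs (E (pt \<one>\<^bsub>L\<^esub> a))"
      using Cons.IH[OF b(1)] by blast
    define \<delta> where "\<delta> = (\<lambda>a\<in>carrier A. TA.push (snd b) (E (pt \<one>\<^bsub>L\<^esub> a)))"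
    have \<delta>: "\<delta> \<in> IDer k A m"
      unfolding \<delta>_def by (rule push[OF b(3)])
    have \<delta>_a: "\<delta> a = TA.push (snd b) (E (pt \<one>\<^bsub>L\<^esub> a))" if "a \<in> carrier A" for a
      using that by (simp add: \<delta>_def)
    have p: "pt' (fst b) \<delta> \<in> carrier T'"
      using b(2) \<delta> by (intro TM.T.pure_closed) (simp_all add: carrier_M')
    have "\<Phi> (pt' (fst b) \<delta> \<otimes>\<^bsub>T'\<^esub> z) (pt \<one>\<^bsub>L\<^esub> a) = TA.recombine (b # bs) (E (pt \<one>\<^bsub>L\<^esub> a))" if "a \<in> carrier A" for a
    proof -
      have "\<Phi> (pt' (fst b) \<delta> \<otimes>\<^bsub>T'\<^esub> z) (pt \<one>\<^bsub>L\<^esub> a) =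
          scaled_extension k L A (fst b) \<delta> (pt \<one>\<^bsub>L\<^esub> a) \<oplus>\<^bsub>B\<^esub> \<Phi> z (pt \<one>\<^bsub>L\<^esub> a)"
        unfolding \<Phi>_add[OF p z(1)] \<Phi>_pure[OF b(2) \<delta>] using that by (simp add: N_add_apply pt_closed)
      also have "scaled_extension k L A (fst b) \<delta> (pt \<one>\<^bsub>L\<^esub> a) = pt (fst b) (\<delta> a)"
        by (rule scaled_extension_IDer(2)[OF b(2) \<delta> that])
      finally show ?thesis
        using that z(2) \<delta>_a[OF that] by (simp add: B_simps)
    qed
    then show ?case
      using p z(1) by (intro bexI[of _ "pt' (fst b) \<delta> \<otimes>\<^bsub>T'\<^esub> z"]) simp_all
  qed
  then obtain z where z: "z \<in> carrier T'" "\<forall>a\<in>carrier A. \<Phi> z (pt \<one>\<^bsub>L\<^esub> a) = E (pt \<one>\<^bsub>L\<^esub> a)"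
    using bs(2) by auto
  have "E \<in> module_homs L B B"
    using E by (simp add: Der_def)
  then have "\<Phi> z = E"
    using z by (intro B_hom_eqI IDer_module_homs[OF \<Phi>_closed]) simp_all
  then show ?thesis
    using z(1) by blast
qed

lemma \<Phi>_iso: "is_module_iso B BM N \<Phi>"
  unfolding is_module_iso_def
proof (intro conjI)
  show "\<Phi> \<in> module_homs B BM N"
  proof (rule module_homsI)
    show "\<Phi> \<in> extensional (carrier BM)"
      unfolding IDer_base_change_map_def BM_simps(1) by (rule TM.T.tensor_lift_extensional)
  qed (simp_all add: BM_simps(1,2) \<Phi>_closed \<Phi>_add \<Phi>_smult IDer_module_B_simps(1))
  have "IDer L B m \<subseteq> \<Phi> ` carrier T'"
    using \<Phi>_surj IDer_Der IDer_push[OF _ m] by blast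
  then show "bij_betw \<Phi> (carrier BM) (carrier N)"
    using inj_on_\<Phi> \<Phi>_closed unfolding bij_betw_def BM_simps(1) IDer_module_B_simps(1) by blast
qed (rule module_BM N.module_axioms)+

end

text \<open>Upwards: the contractions of \<open>E\<close> are integrable to length \<open>m\<close>,
  hence to length \<open>n\<close>, so \<open>E\<close> is in the image of the base change map at
  \<open>n\<close>. Downwards: contracting the extension of \<open>\<delta>\<close> with a
  functional of value one at the unit of \<open>L\<close> returns \<open>\<delta>\<close>.\<close>

lemma IDer_eq_iff:
  assumes "m > 0" "n > 0" "\<one>\<^bsub>L\<^esub> \<noteq> \<zero>\<^bsub>L\<^esub>"
  shows "IDer k A m \<subseteq> IDer k A n \<longleftrightarrow> IDer L B m \<subseteq> IDer L B n"
proof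
  assume sub: "IDer k A m \<subseteq> IDer k A n"
  show "IDer L B m \<subseteq> IDer L B n"
  proof
    fix E assume E: "E \<in> IDer L B m"
    then have "\<exists>z\<in>carrier (tensor_group k L (restrict_scalars A (IDer_module k A n))). IDer_base_change_map k L A n z = E"
      using IDer_push[OF E assms(1)] sub by (intro \<Phi>_surj[OF assms(2) IDer_Der[OF E]]) blast
    then show "E \<in> IDer L B n"
      using \<Phi>_closed[OF assms(2)] by blast
  qed
next
  assume sub: "IDer L B m \<subseteq> IDer L B n"
  obtain \<phi> where \<phi>: "linear_functional k L \<phi>" "\<phi> \<one>\<^bsub>L\<^esub> = \<one>\<^bsub>k\<^esub>"
    using functional_exists[OF L.one_closed assms(3)] by blast
  show "IDer k A m \<subseteq> IDer k A n"
  proof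
    fix \<delta> assume \<delta>: "\<delta> \<in> IDer k A m"
    then have X: "extend_der k L A \<delta> \<in> IDer L B n"
      using extend_der_IDer[OF \<delta> assms(1)] sub by blast
    have "(\<lambda>a\<in>carrier A. TA.push \<phi> (extend_der k L A \<delta> (pt \<one>\<^bsub>L\<^esub> a))) = restrict \<delta> (carrier A)"
      using extend_der(2)[OF IDer_module_homs[OF \<delta>]] \<phi> CA.IDer_closed[OF \<delta>]
      by (intro restrict_ext) (simp add: TA.push_pure)
    then show "\<delta> \<in> IDer k A n"
      using IDer_push[OF X assms(2) \<phi>(1)] CA.IDer_restrict[OF \<delta>] by simp
  qed
qed

lemma Leaps_eq:
  assumes "\<one>\<^bsub>L\<^esub> \<noteq> \<zero>\<^bsub>L\<^esub>"
  shows "Leaps k A = Leaps L B"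
proof -
  have "IDer k A s \<subset> IDer k A (s - 1) \<longleftrightarrow> IDer L B s \<subset> IDer L B (s - 1)" if "s > 1" for s
    unfolding less_le_not_le
    using IDer_eq_iff[of "s - 1" s] assms that IDer_antimono[of "s - 1" s k A] IDer_antimono[of "s - 1" s L B]
    by simp
  then show ?thesis
    unfolding Leaps_def by blast
qed

end

lemma (in field) prime_of_has_char:
  assumes "has_char R p" "p > 0"
  shows "normalization_semidom_class.prime p"
proof -
  have char: "add_pow R n \<one> = \<zero> \<longleftrightarrow> p dvd n" for n :: nat
    using assms(1) by (simp add: has_char_def)
  have "p \<noteq> 1"
    using char[of 1] by auto
  moreover have "n = 1 \<or> n = p" if n: "n dvd p" for n
  proof -
    obtain l where l: "p = n * l"
      using n by (auto simp: dvd_def)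
    have "add_pow R n \<one> \<otimes> add_pow R l \<one> = add_pow R p \<one>"
      by (simp add: l add_pow_ldistr add_pow_rdistr add.nat_pow_pow mult.commute)
    also have "\<dots> = \<zero>"
      by (simp add: char)
    finally have "p dvd n \<or> p dvd l"
      using integral[of "add_pow R n \<one>" "add_pow R l \<one>"] char by auto
    then show ?thesis
    proof
      assume "p dvd n"
      then show ?thesis
        using n dvd_antisym by blast
    next
      assume "p dvd l"
      then have "l = p"
        using l by (metis dvd_antisym dvd_triv_right)
      then show ?thesis
        using l assms(2) by simp
    qed
  qed
  ultimately show ?thesis
    using assms(2) by (auto simp: prime_nat_iff)
qed

theorem corollary3p29:
  fixes k :: "'k ring" and L :: "('k, 'l) module" and A :: "('k, 'a) module" and p :: nat
  assumes "field k" and "has_char k p" and "p > 0"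
    and "separable_algebra k L"
    and "inj_on (\<lambda>r. r \<odot>\<^bsub>L\<^esub> \<one>\<^bsub>L\<^esub>) (carrier k)"
    and "fin_gen_algebra k A"
  shows "(\<forall>m\<ge>1.
      is_module_iso (base_change k L A)
        (base_change_module k L A (IDer_module k A m))
        (IDer_module L (base_change k L A) m)
        (IDer_base_change_map k L A m) \<and>
      (\<forall>c\<in>carrier L. \<forall>\<delta>\<in>IDer k A m.
        IDer_base_change_map k L A m
          (pure_tensor k L (restrict_scalars A (IDer_module k A m)) c \<delta>)
        = scaled_extension k L A c \<delta>)) \<and>
    Leaps k A = Leaps L (base_change k L A)"
proof -
  interpret k: field k
    by fact
  have "algebra k L" "algebra k A"
    using assms(4,6) by (simp_all add: separable_algebra_def fin_gen_algebra_def)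
  then interpret L: algebra k L + A: algebra k A .
  interpret separable_base_change k L A p
  proof unfold_locales
    show "normalization_semidom_class.prime p"
      by (rule k.prime_of_has_char[OF assms(2,3)])
    show "add_pow k p \<one>\<^bsub>k\<^esub> = \<zero>\<^bsub>k\<^esub>"
      using assms(2) by (simp add: has_char_def)
  qed (rule assms(4,6))+
  \<comment> \<open>Injectivity of \<open>k \<rightarrow> L\<close> makes \<open>L\<close> nonzero,
    so that some functional takes the value one at its unit; the comparison of leaps rests on
    it.\<close>
  have "\<one>\<^bsub>L\<^esub> \<noteq> \<zero>\<^bsub>L\<^esub>"
  proof
    assume "\<one>\<^bsub>L\<^esub> = \<zero>\<^bsub>L\<^esub>"
    then have "\<one>\<^bsub>k\<^esub> \<odot>\<^bsub>L\<^esub> \<one>\<^bsub>L\<^esub> = \<zero>\<^bsub>k\<^esub> \<odot>\<^bsub>L\<^esub> \<one>\<^bsub>L\<^esub>"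
      by simp
    then have "\<one>\<^bsub>k\<^esub> = \<zero>\<^bsub>k\<^esub>"
      by (rule inj_onD[OF assms(5)]) simp_all
    then show False
      by simp
  qed
  note leaps = Leaps_eq[OF this]
  show ?thesis
  proof (intro conjI allI impI ballI)
    fix m :: nat assume "1 \<le> m"
    then have m: "m > 0"
      by simp
    show "is_module_iso (base_change k L A) (base_change_module k L A (IDer_module k A m))
        (IDer_module L (base_change k L A) m) (IDer_base_change_map k L A m)"
      by (rule \<Phi>_iso[OF m])
    show "IDer_base_change_map k L A m (pure_tensor k L (restrict_scalars A (IDer_module k A m)) c \<delta>) =
        scaled_extension k L A c \<delta>" if "c \<in> carrier L" "\<delta> \<in> IDer k A m" for c \<delta>
      by (rule \<Phi>_pure[OF m that])
  qed (rule leaps)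
qed

end
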